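(* Assume that conditions (B1) and (B2) stated in the context hold, and let $I=[0,T]$. Consider the Black–Scholes type model with volatility $\sigma(\cdot)$, interest rate $r(\cdot)$ and bond price process $S_0(t)=\exp\left(\int_0^tr(s)\,ds\right)$ given by $(Q_{1,t},Q_t)_{t\in I}$ with $$\frac{dQ_{1,t}}{dQ_t}=\exp\left(\int_0^t\sigma(s)\,d\bar W_s-\int_0^t\frac{\sigma(s)^2}{2}\,ds\right)=\exp\left(\int_0^t\sigma(s)\,dW_s-\int_0^t\Big(r(s)+\frac{\sigma(s)^2}{2}\Big)ds\right).$$ Then, as $N\to\infty$, the finite dimensional marginal distributions of the discounted price process $\left(X^1_{[\frac tTN]\frac TN,N}\right)_{t\in I}$ converge weakly to the finite dimensional marginals of $\mathcal{L}\left(\left(\frac{dQ_{1,t}}{dQ_t}\right)_{t\in I}\Big|\,Q_T\right)$ under the martingale measure $Q_N=\bigotimes_{j=1}^NQ_N(j)$, and to those of $\mathcal{L}\left(\left(\frac{dQ_{1,t}}{dQ_t}\right)_{t\in I}\Big|\,Q_{1,T}\right)$ under the measure $Q_{1,N}=\bigotimes_{j=1}^NQ_{1,N}(j)$.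
   Context: Fix $0<T<\infty$; $[x]$ denotes the integer part of $x$, and $\mathcal{L}(Y\,|\,Q)$ the law of $Y$ under $Q$. (B1) At stage $N$ the bond is $S^0_{0,N}=1$, $S^0_{kT/N,N}=\prod_{i=1}^k\left(1+\frac{\rho_{i,N}T}{N}\right)$, with deterministic interest rates $\frac{\rho_{i,N}T}N\ge0$ on $\left(\frac{(i-1)T}{N},\frac{iT}{N}\right]$ satisfying $\max\{\rho_{i,N}:i\le N,N\in\mathbb{N}\}\le R<\infty$. Moreover $r:[0,T]\to[0,\infty)$ is a square integrable function with $$\prod_{i=1}^{[tN/T]}\left(1+\frac{\rho_{i,N}T}{N}\right)\longrightarrow\exp\left(\int_0^tr(u)\,du\right)\quad(N\to\infty)\quad\text{for each }t\in[0,T].$$ (B2) $P_0$ is a probability measure on a measurable space $(\Omega,\mathcal{A})$, and $g\in L_2(P_0)$ satisfies $\int g\,dP_0=0$, $\int g^2\,dP_0=1$ and $g>-C$ for some constant $C>0$. Let $(P_\vartheta)_{0\le\vartheta\le C^{-1}}$ be the path of probability measures $\frac{dP_\vartheta}{dP_0}=1+\vartheta g$. Let $\sigma_{i,N}$ ($1\le i\le N$) be deterministic with $0<\delta\le\sigma_{i,N}\le K$ for constants $\delta,K$ ($\frac{\sigma_{i,N}\sqrt T}{\sqrt N}$ is the volatility in the $i$-th period). Put $P_N(j)=P_{\sigma_{j,N}\sqrt T/\sqrt N}$, $S^1_{0,N}=1$ and $$S^1_{kT/N,N}(x_1,\dots,x_k)=\prod_{i=1}^k\frac{dP_N(i)}{dP_0}(x_i).$$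 With $\sigma_N(u)=\sum_{k=1}^N\sigma_{k,N}1_{\left(\frac{(k-1)T}{N},\frac{kT}{N}\right]}(u)$, there is a square integrable function $\sigma:[0,T]\to\mathbb{R}$ with $\int_0^T(\sigma_N(u)-\sigma(u))^2\,du\to0$ as $N\to\infty$. Put $\theta_{k,N}=\frac{\rho_{k,N}}{\sigma_{k,N}}$. The discounted price process is $$X^1_{0,N}=1,\qquad X^1_{kT/N,N}(x_1,\dots,x_k)=\prod_{i=1}^k\left(\frac{dP_N(i)}{dP_0}(x_i)\Big/\Big(1+\frac{\rho_{i,N}T}{N}\Big)\right).$$ For $N$ large enough (so that the following parameters, and those above, lie in the admissible range), the martingale measures for the single periods are $Q_N(j)=P_{\theta_{j,N}\sqrt T/\sqrt N}$, and $Q_{1,N}(j)$ is the probability measure with $$\frac{dQ_{1,N}(j)}{dQ_N(j)}(x_j)=\frac{dP_N(j)}{dP_0}(x_j)\Big/\Big(1+\frac{\rho_{j,N}T}{N}\Big).$$ $Q_N$ and $Q_{1,N}$ are the product measures on $\Omega^N$. Limit model: $W$ is a standard one-dimensional Brownian motion on $[0,T]$ under a (real world) probability measure $P$ with its filtration $(\mathcal{F}_t)$, $\theta(\cdot)=\frac{r(\cdot)}{\sigma(\cdot)}$, $Q_T$ is given by $\frac{dQ_T}{dP}=\exp\left(\int_0^T\theta(s)\,dW_s-\frac12\int_0^T\theta(s)^2\,ds\right)$, and $\bar W_t=W_t-\int_0^t\theta(s)\,ds$, which is a Brownian motion under $Q_T$. $Q_t$ is the restriction of $Q_T$ to $\mathcal{F}_t$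 and $Q_{1,t}$ is the probability measure on $\mathcal{F}_t$ with the density with respect to $Q_t$ displayed in the claim. *)

theory Defs
  imports "HOL-Probability.Probability"
begin

section \<open>Square integrability and weak convergence\<close>

definition square_integrable :: "'a measure \<Rightarrow> ('a \<Rightarrow> real) \<Rightarrow> bool" where
  "square_integrable M f \<longleftrightarrow> f \<in> borel_measurable M \<and> integrable M (\<lambda>x. (f x)\<^sup>2)"

text \<open>The library notion \<^const>\<open>weak_conv_m\<close> is formulated with distribution functions and covers
  only measures on the real line.\<close>

definition weakly_converges ::
    "(nat \<Rightarrow> 'b::topological_space measure) \<Rightarrow> 'b measure \<Rightarrow> bool" where
  "weakly_converges M L \<longleftrightarrow>
     (\<forall>f :: 'b \<Rightarrow> real. continuous_on UNIV f \<and> bounded (range f) \<longrightarrow>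
        (\<lambda>N. \<integral>x. f x \<partial>M N) \<longlonglongrightarrow> (\<integral>x. f x \<partial>L))"


section \<open>The discrete models\<close>

text \<open>Double-indexed families are written with the indices in the order period, stage.\<close>

definition bond :: "real \<Rightarrow> (nat \<Rightarrow> nat \<Rightarrow> real) \<Rightarrow> nat \<Rightarrow> nat \<Rightarrow> real" where
  "bond T rho N k = (\<Prod>i=1..k. 1 + rho i N * T / real N)"

definition step_volatility :: "real \<Rightarrow> (nat \<Rightarrow> nat \<Rightarrow> real) \<Rightarrow> nat \<Rightarrow> real \<Rightarrow> real" where
  "step_volatility T sig N u =
     (\<Sum>k=1..N. sig k N * indicator {(real k - 1) * T / real N <.. real k * T / real N} u)"

definition path_density :: "('a \<Rightarrow> real) \<Rightarrow> real \<Rightarrow> 'a \<Rightarrow> real" where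
  "path_density g \<theta> x = 1 + \<theta> * g x"

text \<open>\<open>path_measure P0 g \<theta>\<close> is a probability measure for parameters between \<open>0\<close> and \<open>1/C\<close>. Outside
  this range, which occurs only for finitely many stages, negative density values are cut off
  at \<open>0\<close>; this does not affect limits.\<close>

definition path_measure :: "'a measure \<Rightarrow> ('a \<Rightarrow> real) \<Rightarrow> real \<Rightarrow> 'a measure" where
  "path_measure P0 g \<theta> = density P0 (\<lambda>x. ennreal (path_density g \<theta> x))"

definition period_param :: "real \<Rightarrow> nat \<Rightarrow> real \<Rightarrow> real" where
  "period_param T N c = c * sqrt T / sqrt (real N)"

definition discounted_ratio ::
    "real \<Rightarrow> (nat \<Rightarrow> nat \<Rightarrow> real) \<Rightarrow> (nat \<Rightarrow> nat \<Rightarrow> real) \<Rightarrow> ('a \<Rightarrow> real) \<Rightarrow> nat \<Rightarrow> nat \<Rightarrow> 'a \<Rightarrow> real" where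
  "discounted_ratio T rho sig g N i y =
     path_density g (period_param T N (sig i N)) y / (1 + rho i N * T / real N)"

definition discounted_price ::
    "real \<Rightarrow> (nat \<Rightarrow> nat \<Rightarrow> real) \<Rightarrow> (nat \<Rightarrow> nat \<Rightarrow> real) \<Rightarrow> ('a \<Rightarrow> real) \<Rightarrow> nat \<Rightarrow> nat \<Rightarrow> (nat \<Rightarrow> 'a) \<Rightarrow> real"
  where
  "discounted_price T rho sig g N k x = (\<Prod>i=1..k. discounted_ratio T rho sig g N i (x i))"

definition period_Q ::
    "real \<Rightarrow> (nat \<Rightarrow> nat \<Rightarrow> real) \<Rightarrow> (nat \<Rightarrow> nat \<Rightarrow> real) \<Rightarrow> 'a measure \<Rightarrow> ('a \<Rightarrow> real) \<Rightarrow> nat \<Rightarrow> nat \<Rightarrow> 'a measure"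
  where
  "period_Q T rho sig P0 g N j = path_measure P0 g (period_param T N (rho j N / sig j N))"

definition period_Q1 ::
    "real \<Rightarrow> (nat \<Rightarrow> nat \<Rightarrow> real) \<Rightarrow> (nat \<Rightarrow> nat \<Rightarrow> real) \<Rightarrow> 'a measure \<Rightarrow> ('a \<Rightarrow> real) \<Rightarrow> nat \<Rightarrow> nat \<Rightarrow> 'a measure"
  where
  "period_Q1 T rho sig P0 g N j =
     density (period_Q T rho sig P0 g N j) (\<lambda>y. ennreal (discounted_ratio T rho sig g N j y))"

definition product_Q ::
    "real \<Rightarrow> (nat \<Rightarrow> nat \<Rightarrow> real) \<Rightarrow> (nat \<Rightarrow> nat \<Rightarrow> real) \<Rightarrow> 'a measure \<Rightarrow> ('a \<Rightarrow> real) \<Rightarrow> nat \<Rightarrow> (nat \<Rightarrow> 'a) measure"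
  where
  "product_Q T rho sig P0 g N = PiM {1..N} (period_Q T rho sig P0 g N)"

definition product_Q1 ::
    "real \<Rightarrow> (nat \<Rightarrow> nat \<Rightarrow> real) \<Rightarrow> (nat \<Rightarrow> nat \<Rightarrow> real) \<Rightarrow> 'a measure \<Rightarrow> ('a \<Rightarrow> real) \<Rightarrow> nat \<Rightarrow> (nat \<Rightarrow> 'a) measure"
  where
  "product_Q1 T rho sig P0 g N = PiM {1..N} (period_Q1 T rho sig P0 g N)"


section \<open>Brownian motion and the Wiener integral\<close>

text \<open>Brownian motion with respect to a filtration \<open>F\<close>; the filtration generated by \<open>W\<close> and its
  completion are the standard instances.\<close>

definition brownian_motion ::
    "'w measure \<Rightarrow> (real \<Rightarrow> 'w measure) \<Rightarrow> real \<Rightarrow> (real \<Rightarrow> 'w \<Rightarrow> real) \<Rightarrow> bool" where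
  "brownian_motion P F T W \<longleftrightarrow>
     prob_space P \<and>
     (\<forall>t\<in>{0..T}. subalgebra P (F t)) \<and>
     (\<forall>s\<in>{0..T}. \<forall>t\<in>{s..T}. sets (F s) \<subseteq> sets (F t)) \<and>
     (\<forall>t\<in>{0..T}. W t \<in> borel_measurable (F t)) \<and>
     (AE \<omega> in P. W 0 \<omega> = 0) \<and>
     (AE \<omega> in P. continuous_on {0..T} (\<lambda>t. W t \<omega>)) \<and>
     (\<forall>s\<in>{0..T}. \<forall>t\<in>{s<..T}.
        distributed P lborel (\<lambda>\<omega>. W t \<omega> - W s \<omega>) (normal_density 0 (sqrt (t - s))) \<and>
        prob_space.indep_set P (sets (F s))
          (sets (vimage_algebra (space P) (\<lambda>\<omega>. W t \<omega> - W s \<omega>) borel)))"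

definition step_fun :: "nat \<Rightarrow> (nat \<Rightarrow> real) \<Rightarrow> (nat \<Rightarrow> real) \<Rightarrow> real \<Rightarrow> real" where
  "step_fun m p c u = (\<Sum>i<m. c i * indicator {p i <.. p (Suc i)} u)"

definition step_integral ::
    "(real \<Rightarrow> 'w \<Rightarrow> real) \<Rightarrow> nat \<Rightarrow> (nat \<Rightarrow> real) \<Rightarrow> (nat \<Rightarrow> real) \<Rightarrow> 'w \<Rightarrow> real" where
  "step_integral W m p c \<omega> = (\<Sum>i<m. c i * (W (p (Suc i)) \<omega> - W (p i) \<omega>))"

text \<open>\<open>Y\<close> is an \<open>F t\<close>-measurable version of the stochastic integral over \<open>{0..t}\<close> of the deterministic
  function \<open>f\<close>, i.e. the mean square limit of the integrals of step functions that converge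
  to \<open>f\<close> in \<open>L\<^sup>2\<close>. The two convergences are stated with \<open>\<integral>\<^sup>+\<close>, because the Bochner integral of a
  non-integrable function is \<open>0\<close>.\<close>

definition is_wiener_integral ::
    "'w measure \<Rightarrow> (real \<Rightarrow> 'w measure) \<Rightarrow> (real \<Rightarrow> 'w \<Rightarrow> real) \<Rightarrow> real \<Rightarrow> (real \<Rightarrow> real) \<Rightarrow> ('w \<Rightarrow> real) \<Rightarrow> bool"
  where
  "is_wiener_integral P F W t f Y \<longleftrightarrow>
     Y \<in> borel_measurable (F t) \<and>
     (\<exists>m p c.
        (\<forall>n. 0 \<le> p n 0 \<and> (\<forall>i<m n. p n i \<le> p n (Suc i)) \<and> p n (m n) \<le> t) \<and>
        (\<lambda>n. \<integral>\<^sup>+u. ennreal ((step_fun (m n) (p n) (c n) u - f u)\<^sup>2) \<partial>lebesgue_on {0..t}) \<longlonglongrightarrow> 0 \<and>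
        (\<lambda>n. \<integral>\<^sup>+\<omega>. ennreal ((step_integral W (m n) (p n) (c n) \<omega> - Y \<omega>)\<^sup>2) \<partial>P) \<longlonglongrightarrow> 0)"

text \<open>By the isometry the integral is determined up to null sets; the operator picks a version.\<close>

definition wiener_integral ::
    "'w measure \<Rightarrow> (real \<Rightarrow> 'w measure) \<Rightarrow> (real \<Rightarrow> 'w \<Rightarrow> real) \<Rightarrow> real \<Rightarrow> (real \<Rightarrow> real) \<Rightarrow> 'w \<Rightarrow> real" where
  "wiener_integral P F W t f = (SOME Y. is_wiener_integral P F W t f Y)"


section \<open>The limit model\<close>

definition market_price_of_risk :: "(real \<Rightarrow> real) \<Rightarrow> (real \<Rightarrow> real) \<Rightarrow> real \<Rightarrow> real" where
  "market_price_of_risk r \<sigma> s = r s / \<sigma> s"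

definition limit_QT ::
    "'w measure \<Rightarrow> (real \<Rightarrow> 'w measure) \<Rightarrow> real \<Rightarrow> (real \<Rightarrow> 'w \<Rightarrow> real) \<Rightarrow> (real \<Rightarrow> real) \<Rightarrow> (real \<Rightarrow> real) \<Rightarrow> 'w measure"
  where
  "limit_QT P F T W r \<sigma> =
     density P (\<lambda>\<omega>. ennreal (exp
       (wiener_integral P F W T (market_price_of_risk r \<sigma>) \<omega>
        - 1/2 * (\<integral>s. (market_price_of_risk r \<sigma> s)\<^sup>2 \<partial>lebesgue_on {0..T}))))"

definition W_bar ::
    "(real \<Rightarrow> 'w \<Rightarrow> real) \<Rightarrow> (real \<Rightarrow> real) \<Rightarrow> (real \<Rightarrow> real) \<Rightarrow> real \<Rightarrow> 'w \<Rightarrow> real" where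
  "W_bar W r \<sigma> t \<omega> = W t \<omega> - (\<integral>s. market_price_of_risk r \<sigma> s \<partial>lebesgue_on {0..t})"

text \<open>The version of \<open>dQ\<^sub>1\<^sub>,\<^sub>t/dQ\<^sub>t\<close> defining the model. Its stochastic integrator \<open>W_bar\<close> is a Brownian
  motion under \<open>limit_QT\<close>, so the integral is formed under this measure.\<close>

definition BS_density ::
    "'w measure \<Rightarrow> (real \<Rightarrow> 'w measure) \<Rightarrow> real \<Rightarrow> (real \<Rightarrow> 'w \<Rightarrow> real) \<Rightarrow> (real \<Rightarrow> real) \<Rightarrow> (real \<Rightarrow> real)
      \<Rightarrow> real \<Rightarrow> 'w \<Rightarrow> real" where
  "BS_density P F T W r \<sigma> t \<omega> =
     exp (wiener_integral (limit_QT P F T W r \<sigma>) F (W_bar W r \<sigma>) t \<sigma> \<omega>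
          - (\<integral>s. (\<sigma> s)\<^sup>2 / 2 \<partial>lebesgue_on {0..t}))"

definition limit_Q ::
    "'w measure \<Rightarrow> (real \<Rightarrow> 'w measure) \<Rightarrow> real \<Rightarrow> (real \<Rightarrow> 'w \<Rightarrow> real) \<Rightarrow> (real \<Rightarrow> real) \<Rightarrow> (real \<Rightarrow> real)
      \<Rightarrow> real \<Rightarrow> 'w measure" where
  "limit_Q P F T W r \<sigma> t = restr_to_subalg (limit_QT P F T W r \<sigma>) (F t)"

definition limit_Q1 ::
    "'w measure \<Rightarrow> (real \<Rightarrow> 'w measure) \<Rightarrow> real \<Rightarrow> (real \<Rightarrow> 'w \<Rightarrow> real) \<Rightarrow> (real \<Rightarrow> real) \<Rightarrow> (real \<Rightarrow> real)
      \<Rightarrow> real \<Rightarrow> 'w measure" where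
  "limit_Q1 P F T W r \<sigma> t =
     density (limit_Q P F T W r \<sigma> t) (\<lambda>\<omega>. ennreal (BS_density P F T W r \<sigma> t \<omega>))"

end

theory Submission
  imports Defs
begin

text \<open>
  Why the theorem holds. Put \<open>h = \<surd>(T/N)\<close>. Both the discrete log price and the logarithm of the
  limit density have explicit characteristic functions, and these agree in the limit.

  \<^item> In the discrete model the log price is a sum of independent one-period terms
    \<open>ln (1 + \<sigma> h g) - ln (1 + \<rho> h\<^sup>2)\<close>. Put \<open>\<kappa> = \<i> l\<close> under \<open>Q\<^sub>N\<close> and \<open>\<kappa> = 1 + \<i> l\<close> under \<open>Q\<^sub>1\<^sub>,\<^sub>N\<close>, whose
    one-period density with respect to \<open>Q\<^sub>N\<close> is the exponential of this very term. In both cases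
    the one-period characteristic function at \<open>l\<close> is the \<open>P\<^sub>0\<close>-integral of
    \<open>(1 + \<theta> h g) (1 + \<sigma> h g)\<^sup>\<kappa> / (1 + \<rho> h\<^sup>2)\<^sup>\<kappa>\<close>. Since \<open>g\<close> is centred with variance one and
    \<open>\<theta> \<sigma> = \<rho>\<close>, the interest rate cancels to second order and
    \<open>exp (h\<^sup>2 \<sigma>\<^sup>2 \<kappa> (\<kappa> - 1) / 2) + o(h\<^sup>2)\<close> remains, uniformly in the period (\<open>one_period_char\<close>).
    Multiplying over the periods leaves a function of the sums of \<open>\<sigma>\<^sub>k\<^sup>2 T / N\<close> over the first
    periods, which converge to \<open>\<integral>\<^sub>0\<^sup>t \<sigma>\<^sup>2\<close> (\<open>market_char_tendsto\<close>, \<open>volatility_clock\<close>).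

  \<^item> In the limit model the Wiener integral of a deterministic function is a limit of linear
    combinations of independent normal increments. This gives the joint exponential moments
    \<open>E exp (Z + \<i> Y)\<close> of two Wiener integrals in closed form (\<open>wiener_pair_exp\<close>), hence the laws of
    Wiener integrals after the change of measure with density \<open>exp (Z - \<parallel>\<psi>\<parallel>\<^sup>2 / 2)\<close>
    (\<open>girsanov_char\<close>). The measure \<open>Q\<^sub>T\<close> is the case \<open>\<psi> = \<theta>\<close>, and \<open>Q\<^sub>1\<^sub>,\<^sub>T\<close> is the case
    \<open>\<psi> = \<theta> + \<sigma>\<close> (\<open>Q1_eq\<close>). As \<open>W_bar\<close> and \<open>W\<close> differ
    by \<open>\<integral> \<theta>\<close>, the stochastic integrals of \<open>\<sigma>\<close> with respect to them differ by \<open>\<integral> \<theta> \<sigma> = \<integral> r\<close>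
    (\<open>wiener_integral_W_bar\<close>).

  Convergence of the characteristic functions of the log-price vectors implies their weak
  convergence by Levy's continuity theorem in several dimensions, which is derived from the
  one-dimensional theorem (\<open>levy_continuity_euclidean\<close>). Applying the continuous map \<open>exp\<close>
  coordinatewise gives the statement about prices (\<open>weak_limit_exponential\<close>).
\<close>

section \<open>Levy continuity theorem in several dimensions\<close>

inductive trig_poly :: "('a::euclidean_space \<Rightarrow> complex) \<Rightarrow> bool" where
  monomial: "trig_poly (\<lambda>x. a * cis (l \<bullet> x))"
| add: "trig_poly f \<Longrightarrow> trig_poly g \<Longrightarrow> trig_poly (\<lambda>x. f x + g x)"

lemma trig_poly_mult:
  assumes "trig_poly f" "trig_poly g"
  shows "trig_poly (\<lambda>x. f x * g x)"
  using assms(1)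
proof induction
  case (monomial a l)
  show ?case
    using assms(2)
  proof induction
    case (monomial b k)
    have "(\<lambda>x. a * cis (l \<bullet> x) * (b * cis (k \<bullet> x))) = (\<lambda>x. (a * b) * cis ((l + k) \<bullet> x))"
      by (simp add: fun_eq_iff inner_add_left flip: cis_mult)
    then show ?case
      by (metis trig_poly.monomial)
  next
    case (add f g)
    then show ?case
      using trig_poly.add by (fastforce simp: distrib_left)
  qed
next
  case (add f g)
  then show ?case
    using trig_poly.add by (fastforce simp: distrib_right)
qed

lemma trig_poly_sum:
  assumes "finite I" "\<And>i. i \<in> I \<Longrightarrow> trig_poly (f i)"
  shows "trig_poly (\<lambda>x. \<Sum>i\<in>I. f i x)"
  using assms
proof (induction I rule: finite_induct)
  case empty
  have "trig_poly (\<lambda>x. 0 * cis (0 \<bullet> x))"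
    by (rule trig_poly.monomial)
  then show ?case by simp
next
  case (insert i I)
  then show ?case
    by (simp add: trig_poly.add)
qed

lemma trig_poly_continuous_bounded:
  assumes "trig_poly f"
  shows "continuous_on UNIV f" "\<exists>B. \<forall>x. norm (f x) \<le> B"
proof -
  show "continuous_on UNIV f"
    using assms by induction (auto intro!: continuous_intros)
  show "\<exists>B. \<forall>x. norm (f x) \<le> B"
    using assms
  proof induction
    case (monomial a l)
    then show ?case by (intro exI[of _ "norm a"]) (simp add: norm_mult)
  next
    case (add f g)
    then obtain B B' where "\<And>x. norm (f x) \<le> B" "\<And>x. norm (g x) \<le> B'" by blast
    then have "\<And>x. norm (f x + g x) \<le> B + B'"
      by (metis add_mono norm_triangle_le)
    then show ?case by blast
  qed
qed

lemma trig_poly_integrable: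
  assumes "trig_poly f" "prob_space M" "sets M = sets borel"
  shows "integrable M f"
proof -
  interpret prob_space M by fact
  obtain B where "\<And>x. norm (f x) \<le> B"
    using trig_poly_continuous_bounded[OF assms(1)] by blast
  moreover have "f \<in> borel_measurable M"
    using trig_poly_continuous_bounded[OF assms(1)] assms(3)
    by (metis borel_measurable_continuous_onI measurable_cong_sets)
  ultimately show ?thesis
    by (intro integrable_const_bound[where B=B]) auto
qed

lemma trig_poly_tendsto:
  fixes M :: "nat \<Rightarrow> 'a::euclidean_space measure"
  assumes M: "\<And>n. prob_space (M n)" "\<And>n. sets (M n) = sets borel"
    and L: "prob_space L" "sets L = sets borel"
    and conv: "\<And>l. (\<lambda>n. \<integral>x. cis (l \<bullet> x) \<partial>M n) \<longlonglongrightarrow> (\<integral>x. cis (l \<bullet> x) \<partial>L)"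
    and f: "trig_poly f"
  shows "(\<lambda>n. \<integral>x. f x \<partial>M n) \<longlonglongrightarrow> (\<integral>x. f x \<partial>L)"
  using f
proof induction
  case (monomial a l)
  then show ?case by (auto intro!: tendsto_intros conv)
next
  case (add f g)
  then show ?case
    by (simp add: trig_poly_integrable M L tendsto_add)
qed

lemma trig_poly_sin:
  fixes l :: "'a::euclidean_space"
  shows "trig_poly (\<lambda>x. of_real (sin (l \<bullet> x)))"
proof -
  have *: "of_real (sin y) = - \<i> / 2 * cis y + \<i> / 2 * cis (- y)" for y :: real
    by (simp add: complex_eq_iff)
  have "trig_poly (\<lambda>x. - \<i> / 2 * cis (l \<bullet> x) + \<i> / 2 * cis ((- l) \<bullet> x))"
    by (intro trig_poly.intros)
  then show ?thesis
    by (simp add: *)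
qed

lemma trig_poly_const: "trig_poly (\<lambda>x. c)"
  using trig_poly.monomial[of c 0] by simp

text \<open>Substituting the sines of the coordinates into a polynomial gives a trigonometric polynomial. This
  turns uniform approximation by polynomials on a cube into uniform approximation by
  trigonometric polynomials on the whole space.\<close>

lemma trig_poly_polynomial_of_sines:
  fixes p :: "'a::euclidean_space \<Rightarrow> real"
  assumes "real_polynomial_function p"
  shows "trig_poly (\<lambda>x::'a. of_real (p (\<Sum>b\<in>Basis. sin (c * (x \<bullet> b)) *\<^sub>R b)))"
  using assms
proof induction
  case (linear p)
  have "p (\<Sum>b\<in>Basis. sin (c * (x \<bullet> b)) *\<^sub>R b) = (\<Sum>b\<in>Basis. sin ((c *\<^sub>R b) \<bullet> x) * p b)" for x
  proof -
    interpret bounded_linear p by fact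
    show ?thesis
      by (simp add: sum scaleR inner_commute)
  qed
  then show ?case
    by (simp only: of_real_sum of_real_mult)
       (intro trig_poly_sum trig_poly_mult trig_poly_sin trig_poly_const finite_Basis)
next
  case (const c)
  then show ?case by (simp add: trig_poly_const)
next
  case (add f g)
  then show ?case by (simp add: trig_poly.add)
next
  case (mult f g)
  then show ?case by (simp add: trig_poly_mult)
qed

text \<open>The triangle wave \<open>m * arcsin (sin (s / m))\<close> is the identity near \<open>0\<close> and depends on \<open>s\<close> through
  \<open>sin (s / m)\<close> only. Composing \<open>f\<close> with it in each coordinate makes \<open>f\<close> a continuous function of the
  sines, to which the Stone-Weierstrass theorem on the cube applies. The error bound holds
  everywhere, so no control of the approximant at infinity is lost.\<close>

lemma periodization_approx:
  fixes f :: "'a::euclidean_space \<Rightarrow> real"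
  assumes f: "continuous_on UNIV f" and m: "0 < m" and e: "0 < e"
  obtains p where "trig_poly p"
    "\<And>x. norm (p x - of_real (f (\<Sum>b\<in>Basis. (m * arcsin (sin (x \<bullet> b / m))) *\<^sub>R b))) < e"
proof -
  define S :: "'a set" where "S = cbox (- One) One"
  have S: "x \<in> S \<longleftrightarrow> (\<forall>b\<in>Basis. -1 \<le> x \<bullet> b \<and> x \<bullet> b \<le> 1)" for x
    by (simp add: S_def mem_box)
  define H where "H s = f (\<Sum>b\<in>Basis. (m * arcsin (s \<bullet> b)) *\<^sub>R b)" for s
  have "continuous_on S H"
    unfolding H_def
    by (intro continuous_on_compose2[OF f] continuous_intros) (auto simp: S)
  moreover have "compact S" by (simp add: S_def)
  ultimately obtain p where p: "real_polynomial_function p" "\<And>x. x \<in> S \<Longrightarrow> \<bar>H x - p x\<bar> < e"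
    using Stone_Weierstrass_real_polynomial_function e by blast
  define s where "s x = (\<Sum>b\<in>Basis. sin (1/m * (x \<bullet> b)) *\<^sub>R b)" for x :: 'a
  have s: "s x \<bullet> b = sin (1/m * (x \<bullet> b))" if "b \<in> Basis" for x b
    using that by (simp add: s_def)
  have sS: "s x \<in> S" for x by (simp add: S s)
  have "norm (of_real (p (s x)) - complex_of_real (f (\<Sum>b\<in>Basis. (m
      * arcsin (sin (x \<bullet> b / m))) *\<^sub>R b))) < e" for x
  proof -
    have "H (s x) = f (\<Sum>b\<in>Basis. (m * arcsin (sin (x \<bullet> b / m))) *\<^sub>R b)"
      unfolding H_def by (simp add: s)
    then show ?thesis
      using p(2)[OF sS[of x]] by (simp flip: of_real_diff)
  qed
  then show thesis
    using that[of "\<lambda>x. of_real (p (s x))"] trig_poly_polynomial_of_sines[OF p(1), of "1/m"] by (simp add: s_def)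
qed

text \<open>The one-dimensional continuity theorem, applied to a coordinate. It supplies the tightness of the
  marginals.\<close>

lemma marginal_tendsto:
  fixes M :: "nat \<Rightarrow> 'a::euclidean_space measure"
  assumes M: "\<And>n. prob_space (M n)" "\<And>n. sets (M n) = sets borel"
    and L: "prob_space L" "sets L = sets borel"
    and conv: "\<And>l. (\<lambda>n. \<integral>x. cis (l \<bullet> x) \<partial>M n) \<longlonglongrightarrow> (\<integral>x. cis (l \<bullet> x) \<partial>L)"
    and h: "\<And>s. isCont h s" "\<And>s::real. \<bar>h s :: real\<bar> \<le> B"
  shows "(\<lambda>n. \<integral>x. h (x \<bullet> b) \<partial>M n) \<longlonglongrightarrow> (\<integral>x. h (x \<bullet> b) \<partial>L)"
proof -
  have mb: "(\<lambda>x. x \<bullet> b) \<in> borel_measurable N" if "sets N = sets borel" for N :: "'a measure"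
    by (subst measurable_cong_sets[OF that refl]) simp
  have rd: "real_distribution (distr N borel (\<lambda>x. x \<bullet> b))" if "prob_space N" "sets N
      = sets borel" for N :: "'a measure"
    using that mb by (intro prob_space.real_distribution_distr) auto
  have hm: "h \<in> borel_measurable borel"
    using h by (intro borel_measurable_continuous_onI continuous_at_imp_continuous_on) auto
  have ch: "char (distr N borel (\<lambda>x. x \<bullet> b)) t = (\<integral>x. cis ((t *\<^sub>R b) \<bullet> x) \<partial>N)" if "sets N
      = sets borel" for N :: "'a measure" and t
    unfolding char_def using mb[OF that]
    by (subst integral_distr) (auto simp: cis_conv_exp inner_commute)
  have "weak_conv_m (\<lambda>n. distr (M n) borel (\<lambda>x. x \<bullet> b)) (distr L borel (\<lambda>x. x \<bullet> b))"
    using rd M L conv by (intro levy_continuity) (auto simp only: ch)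
  then have "(\<lambda>n. \<integral>s. h s \<partial>distr (M n) borel (\<lambda>x. x \<bullet> b)) \<longlonglongrightarrow> (\<integral>s. h s \<partial>distr L borel (\<lambda>x. x \<bullet> b))"
    using rd M L h by (intro weak_conv_imp_integral_bdd_continuous_conv[where B=B]) auto
  then show ?thesis
    using mb M L hm by (simp add: integral_distr)
qed

text \<open>A bounded continuous function equals its periodization on a large cube, and the periodization is
  uniformly close to a trigonometric polynomial, whose integrals converge by assumption. The
  mass outside the cube is controlled by the one-dimensional marginals.\<close>

theorem levy_continuity_euclidean:
  fixes M :: "nat \<Rightarrow> 'a::euclidean_space measure"
  assumes M: "\<And>n. prob_space (M n)" "\<And>n. sets (M n) = sets borel"
    and L: "prob_space L" "sets L = sets borel"
    and conv: "\<And>l. (\<lambda>n. \<integral>x. cis (l \<bullet> x) \<partial>M n) \<longlonglongrightarrow> (\<integral>x. cis (l \<bullet> x) \<partial>L)"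
  shows "weakly_converges M L"
  unfolding weakly_converges_def
proof (intro allI impI, elim conjE)
  fix f :: "'a \<Rightarrow> real"
  assume f: "continuous_on UNIV f" "bounded (range f)"
  then obtain B where B: "\<And>x. \<bar>f x\<bar> \<le> B"
    by (auto simp: bounded_iff)
  have B0: "0 \<le> B" using B[of 0] by linarith
  \<comment> \<open>continuous, equal to 1 for \<open>|s| \<ge> m + 1\<close> and to 0 for \<open>|s| \<le> m\<close>\<close>
  define \<tau> :: "nat \<Rightarrow> real \<Rightarrow> real" where "\<tau> m s = min 1 (max 0 (\<bar>s\<bar> - real m))" for m s
  define tail where "tail N m = (\<Sum>b\<in>Basis. \<integral>x. \<tau> m (x \<bullet> b) \<partial>N)" for N :: "'a measure" and m
  have \<tau>: "\<bar>\<tau> m s\<bar> \<le> 1" "0 \<le> \<tau> m s" for m s by (auto simp: \<tau>_def)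
  have \<tau>c: "isCont (\<tau> m) s" for m s unfolding \<tau>_def by (intro continuous_intros)
  have \<tau>m[measurable]: "\<tau> m \<in> borel_measurable borel" for m
    unfolding \<tau>_def by measurable
  have tail_lim: "(\<lambda>n. tail (M n) m) \<longlonglongrightarrow> tail L m" for m
    unfolding tail_def by (intro tendsto_sum marginal_tendsto[OF M L conv \<tau>c \<tau>(1)])
  have tail_L: "(\<lambda>m. tail L m) \<longlonglongrightarrow> (\<Sum>b\<in>(Basis::'a set). 0)"
    unfolding tail_def
  proof (intro tendsto_sum)
    fix b :: 'a
    interpret L: prob_space L by fact
    have "(\<lambda>m. \<integral>x. \<tau> m (x \<bullet> b) \<partial>L) \<longlonglongrightarrow> (\<integral>x. 0 \<partial>L)"
    proof (rule integral_dominated_convergence[where w="\<lambda>_. 1"])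
      show "AE x in L. (\<lambda>m. \<tau> m (x \<bullet> b)) \<longlonglongrightarrow> 0"
      proof (intro AE_I2 tendsto_eventually)
        fix x
        obtain m0 where "\<bar>x \<bullet> b\<bar> \<le> real m0" using real_arch_simple by blast
        then have "\<tau> m (x \<bullet> b) = 0" if "m \<ge> m0" for m
          using that by (auto simp: \<tau>_def)
        then show "\<forall>\<^sub>F m in sequentially. \<tau> m (x \<bullet> b) = 0"
          by (auto simp: eventually_sequentially)
      qed
    qed (use \<tau> L(2) in \<open>auto simp: measurable_cong_sets[OF L(2) refl]\<close>)
    then show "(\<lambda>m. \<integral>x. \<tau> m (x \<bullet> b) \<partial>L) \<longlonglongrightarrow> 0" by simp
  qed
  show "(\<lambda>n. \<integral>x. f x \<partial>M n) \<longlonglongrightarrow> (\<integral>x. f x \<partial>L)"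
  proof (rule LIMSEQ_I)
    fix r :: real assume r: "0 < r"
    define e where "e = r / (10 * (B + 1))"
    have e: "0 < e" using r B0 by (simp add: e_def)
    have eB: "e * (2 * B) \<le> r / 5"
      using r B0 by (simp add: e_def field_simps)
    have "\<forall>\<^sub>F m in sequentially. tail L m < e"
      using tail_L e by (intro order_tendstoD(2)) auto
    then obtain m :: nat where m: "tail L m < e"
      by (auto simp: eventually_sequentially)
    define m' where "m' = real m + 1"
    have m': "0 < m'" by (simp add: m'_def)
    define k where "k x = f (\<Sum>b\<in>Basis. (m' * arcsin (sin (x \<bullet> b / m'))) *\<^sub>R b)" for x
    obtain p where p: "trig_poly p" "\<And>x. norm (p x - of_real (k x)) < r / 10"
      using periodization_approx[OF f(1) m', of "r/10"] r unfolding k_def by auto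
    define q where "q x = Re (p x)" for x
    have pc: "continuous_on UNIV p" using trig_poly_continuous_bounded(1)[OF p(1)] .
    have diff: "\<bar>f x - q x\<bar> \<le> r / 10 + 2 * B * (\<Sum>b\<in>Basis. \<tau> m (x \<bullet> b))" for x
    proof -
      have qk: "\<bar>q x - k x\<bar> < r / 10"
        using p(2)[of x] abs_Re_le_cmod[of "p x - of_real (k x)"] by (simp add: q_def)
      have "\<bar>f x - k x\<bar> \<le> 2 * B * (\<Sum>b\<in>Basis. \<tau> m (x \<bullet> b))"
      proof (cases "\<forall>b\<in>Basis. \<bar>x \<bullet> b\<bar> \<le> m'")
        case True
        have "m' * arcsin (sin (x \<bullet> b / m')) = x \<bullet> b" if "b \<in> Basis" for b
        proof -
          have "\<bar>x \<bullet> b / m'\<bar> \<le> 1" using True that m' by (simp add: field_simps)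
          then have "arcsin (sin (x \<bullet> b / m')) = x \<bullet> b / m'"
            using pi_ge_two by (intro arcsin_sin) (simp_all only: abs_le_iff, linarith+)
          then show ?thesis using m' by simp
        qed
        then have "k x = f x"
          by (simp add: k_def euclidean_representation)
        then show ?thesis using B0 \<tau> by (auto intro!: mult_nonneg_nonneg sum_nonneg)
      next
        case False
        then obtain b where b: "b \<in> Basis" "\<bar>x \<bullet> b\<bar> > m'" by force
        then have "1 = \<tau> m (x \<bullet> b)" by (simp add: \<tau>_def m'_def)
        also have "\<dots> \<le> (\<Sum>b\<in>Basis. \<tau> m (x \<bullet> b))"
          using b \<tau> by (intro member_le_sum) auto
        finally have "2 * B * 1 \<le> 2 * B * (\<Sum>b\<in>Basis. \<tau> m (x \<bullet> b))"
          using B0 by (intro mult_left_mono) auto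
        moreover have "\<bar>f x - k x\<bar> \<le> 2 * B"
          using B[of x] B[of "\<Sum>b\<in>Basis. (m' * arcsin (sin (x \<bullet> b / m'))) *\<^sub>R b"] unfolding k_def by linarith
        ultimately show ?thesis by linarith
      qed
      then show ?thesis using qk by linarith
    qed
    have main: "\<bar>(\<integral>x. f x \<partial>N) - (\<integral>x. q x \<partial>N)\<bar> \<le> r / 10 + 2 * B * tail N m"
      if N: "prob_space N" "sets N = sets borel" for N :: "'a measure"
    proof -
      interpret N: prob_space N by fact
      note [measurable_cong] = N(2)
      have fm[measurable]: "f \<in> borel_measurable borel" using f(1) by (rule borel_measurable_continuous_onI)
      have [measurable]: "p \<in> borel_measurable borel" using pc by (rule borel_measurable_continuous_onI)
      have if': "integrable N f"
        by (intro N.integrable_const_bound[where B=B]) (use B in auto)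
      have iq: "integrable N q"
        unfolding q_def using trig_poly_integrable[OF p(1) N] by simp
      have i\<tau>: "integrable N (\<lambda>x. \<tau> m (x \<bullet> b))" for b
        by (intro N.integrable_const_bound[where B=1]) (use \<tau> in auto)
      have "\<bar>(\<integral>x. f x \<partial>N) - (\<integral>x. q x \<partial>N)\<bar> = \<bar>\<integral>x. f x - q x \<partial>N\<bar>"
        using if' iq by simp
      also have "\<dots> \<le> (\<integral>x. \<bar>f x - q x\<bar> \<partial>N)"
        by (rule integral_abs_bound)
      also have "\<dots> \<le> (\<integral>x. r / 10 + 2 * B * (\<Sum>b\<in>Basis. \<tau> m (x \<bullet> b)) \<partial>N)"
        using if' iq i\<tau> diff by (intro integral_mono) auto
      also have "\<dots> = r / 10 + 2 * B * tail N m"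
        using i\<tau> by (simp add: tail_def N.prob_space Bochner_Integration.integral_sum)
      finally show ?thesis .
    qed
    have "(\<lambda>n. \<integral>x. q x \<partial>M n) \<longlonglongrightarrow> (\<integral>x. q x \<partial>L)"
      using tendsto_Re[OF trig_poly_tendsto[OF M L conv p(1)]]
      by (simp add: q_def trig_poly_integrable[OF p(1)] M L)
    then have "\<forall>\<^sub>F n in sequentially. dist (\<integral>x. q x \<partial>M n) (\<integral>x. q x \<partial>L) < r / 10"
      using r by (intro tendstoD) auto
    moreover have "\<forall>\<^sub>F n in sequentially. tail (M n) m < e"
      using tail_lim m by (rule order_tendstoD)
    ultimately have "\<forall>\<^sub>F n in sequentially. norm ((\<integral>x. f x \<partial>M n) - (\<integral>x. f x \<partial>L)) < r"
    proof eventually_elim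
      case (elim n)
      have "2 * B * tail (M n) m \<le> r / 5" "2 * B * tail L m \<le> r / 5"
        using elim(2) m eB B0 mult_left_mono[of "tail (M n) m" e "2 * B"] mult_left_mono[of "tail L m" e "2
            * B"]
        by (simp_all add: mult.commute)
      then show ?case
        using main[OF M, of n] main[OF L] elim(1) r unfolding dist_real_def real_norm_def abs_le_iff
        by linarith
    qed
    then show "\<exists>no. \<forall>n\<ge>no. norm ((\<integral>x. f x \<partial>M n) - (\<integral>x. f x \<partial>L)) < r"
      by (simp add: eventually_sequentially)
  qed
qed

section \<open>Normal laws\<close>

text \<open>Completing the square for the real part of \<open>z\<close> shifts the density and leaves the characteristic
  function of the normal law at the imaginary part.\<close>

lemma std_normal_exp:
  fixes z :: complex
  shows "integrable std_normal_distribution (\<lambda>x. exp (z * of_real x))" (is ?int)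
    and "(\<integral>x. exp (z * of_real x) \<partial>std_normal_distribution) = exp (z\<^sup>2 / 2)" (is ?eq)
proof -
  define a b where "a = Re z" and "b = Im z"
  interpret N: prob_space std_normal_distribution
    by (rule prob_space_normal_density) simp
  have z: "z = of_real a + \<i> * of_real b"
    by (simp add: a_def b_def complex_eq_iff)
  have [measurable]: "(\<lambda>x. cis (b * (a + x))) \<in> borel_measurable borel"
    by (intro borel_measurable_continuous_onI continuous_intros)
  have i0: "integrable std_normal_distribution (\<lambda>x. cis (b * (a + x)))"
    by (intro N.integrable_const_bound[where B=1]) auto
  then have i1: "integrable lborel (\<lambda>x. std_normal_density x *\<^sub>R cis (b * (a + x)))"
    by (subst (asm) integrable_density) auto
  define f where "f x = std_normal_density x *\<^sub>R exp (z * of_real x)" for x :: real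
  have f: "f (a + 1 * x) = exp (a\<^sup>2 / 2) *\<^sub>R (std_normal_density x *\<^sub>R cis (b * (a + x)))" for x
  proof -
    have "std_normal_density (a + x) * exp (a * (a + x)) = exp (a\<^sup>2 / 2) * std_normal_density x"
      by (simp add: std_normal_density_def power2_eq_square field_simps flip: exp_add)
    moreover have "exp (z * of_real (a + x)) = of_real (exp (a * (a + x))) * cis (b * (a + x))"
      by (simp add: z cis_conv_exp distrib_right distrib_left exp_add exp_of_real[symmetric] mult.assoc)
    ultimately show ?thesis
      unfolding f_def by (simp add: scaleR_conv_of_real mult.assoc flip: of_real_mult)
  qed
  have "integrable lborel (\<lambda>x. f (a + 1 * x))"
    unfolding f using i1 by (intro integrable_scaleR_right)
  then have i2: "integrable lborel f"
    by (subst (asm) lborel_integrable_real_affine_iff) auto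
  show ?int
    using i2 unfolding f_def by (subst integrable_density) auto
  have "(\<integral>x. exp (z * of_real x) \<partial>std_normal_distribution) = integral\<^sup>L lborel f"
    unfolding f_def by (subst integral_density) auto
  also have "\<dots> = (\<integral>x. f (a + 1 * x) \<partial>lborel)"
    by (subst lborel_integral_real_affine[where c=1 and t=a]) simp_all
  also have "\<dots> = exp (a\<^sup>2 / 2) *\<^sub>R (\<integral>x. cis (b * (a + x)) \<partial>std_normal_distribution)"
    unfolding f by (simp only: integral_scaleR_right) (subst integral_density, auto)
  also have "(\<integral>x. cis (b * (a + x)) \<partial>std_normal_distribution) = cis (b * a) * char std_normal_distribution b"
    unfolding char_def by (simp add: distrib_left cis_conv_exp exp_add flip: cis_mult)
  also have "exp (a\<^sup>2 / 2) *\<^sub>R (cis (b * a) * char std_normal_distribution b) = exp (z\<^sup>2 / 2)"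
  proof -
    have "z\<^sup>2 / 2 = of_real (a\<^sup>2 / 2) + (\<i> * of_real (b * a) + of_real (- (b\<^sup>2) / 2))"
      by (simp add: z power2_eq_square algebra_simps add_divide_distrib diff_divide_distrib)
    then show ?thesis
      by (simp only: char_std_normal_distribution scaleR_conv_of_real cis_conv_exp exp_add exp_of_real)
  qed
  finally show ?eq .
qed

text \<open>The law is written as the image of the standard normal law under an affine map, so that the
  degenerate case \<open>v = 0\<close>, which has no density, is included.\<close>

lemma normal_lawI:
  assumes P: "prob_space P" and Y: "Y \<in> borel_measurable P"
    and ch: "\<And>u. (\<integral>\<omega>. exp (\<i> * of_real (u * Y \<omega>)) \<partial>P) = exp (\<i> * of_real (u * m) - of_real (u\<^sup>2 * v / 2))"
    and v: "0 \<le> v"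
  shows "distr P borel Y = distr std_normal_distribution borel (\<lambda>x. m + sqrt v * x)"
proof (rule Levy_uniqueness)
  interpret N: prob_space std_normal_distribution
    by (rule prob_space_normal_density) simp
  show "real_distribution (distr P borel Y)"
    using P Y by (rule prob_space.real_distribution_distr)
  show "real_distribution (distr std_normal_distribution borel (\<lambda>x. m + sqrt v * x))"
    by (rule N.real_distribution_distr) simp
  show "char (distr P borel Y) = char (distr std_normal_distribution borel (\<lambda>x. m + sqrt v * x))"
  proof
    fix u
    have "char (distr P borel Y) u = exp (\<i> * of_real (u * m) - of_real (u\<^sup>2 * v / 2))"
      unfolding char_def using Y ch by (simp add: integral_distr)
    also have "\<dots> = exp (\<i> * of_real (u * m)) * exp ((\<i> * of_real (u * sqrt v))\<^sup>2 / 2)"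
    proof -
      have "(\<i> * complex_of_real (u * sqrt v))\<^sup>2 = - of_real (u\<^sup>2 * v)"
        using v by (simp add: power_mult_distrib flip: of_real_power)
      then show ?thesis
        by (simp flip: exp_add)
    qed
    also have "\<dots> = (\<integral>x. exp (\<i> * of_real (u * m)) * exp ((\<i> * of_real (u * sqrt v))
        * of_real x) \<partial>std_normal_distribution)"
      by (simp add: std_normal_exp)
    also have "\<dots> = char (distr std_normal_distribution borel (\<lambda>x. m + sqrt v * x)) u"
      unfolding char_def by (subst integral_distr) (simp_all add: distrib_left mult.assoc exp_add)
    finally show "char (distr P borel Y) u = char (distr std_normal_distribution borel (\<lambda>x. m
        + sqrt v * x)) u" .
  qed
qed

lemma normal_law_second_moment:
  assumes law: "distr P borel Y = distr std_normal_distribution borel (\<lambda>x. m + sqrt v * x)"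
    and Y: "Y \<in> borel_measurable P" and v: "0 \<le> v"
  shows "(\<integral>\<^sup>+\<omega>. ennreal ((Y \<omega>)\<^sup>2) \<partial>P) = ennreal (m\<^sup>2 + v)"
proof -
  interpret N: prob_space std_normal_distribution
    by (rule prob_space_normal_density) simp
  have i: "integrable std_normal_distribution (\<lambda>x. x ^ k)" for k
    by (rule integrable_std_normal_distribution_moment)
  have i1: "integrable std_normal_distribution (\<lambda>x. x)" and i2: "integrable std_normal_distribution (\<lambda>x. x\<^sup>2)"
    using i[of 1] i[of 2] by simp_all
  have e: "(m + sqrt v * x)\<^sup>2 = m\<^sup>2 + 2 * m * sqrt v * x + v * x\<^sup>2" for x
    using v by (simp add: power2_eq_square algebra_simps)
  have "(\<integral>\<^sup>+\<omega>. ennreal ((Y \<omega>)\<^sup>2) \<partial>P) = (\<integral>\<^sup>+y. ennreal (y\<^sup>2) \<partial>distr P borel Y)"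
    using Y by (simp add: nn_integral_distr)
  also have "\<dots> = (\<integral>\<^sup>+x. ennreal ((m + sqrt v * x)\<^sup>2) \<partial>std_normal_distribution)"
    by (simp add: law nn_integral_distr)
  also have "\<dots> = ennreal (\<integral>x. (m + sqrt v * x)\<^sup>2 \<partial>std_normal_distribution)"
  proof (intro nn_integral_eq_integral)
    show "integrable std_normal_distribution (\<lambda>x. (m + sqrt v * x)\<^sup>2)"
      unfolding e using i1 i2 by auto
  qed auto
  also have "(\<integral>x. (m + sqrt v * x)\<^sup>2 \<partial>std_normal_distribution) = m\<^sup>2 + v"
    unfolding e using i1 i2 std_normal_distribution_even_moments(1)[of 1]
        integral_std_normal_distribution_moment_odd[of 1]
    N.prob_space by (simp add: numeral_2_eq_2)
  finally show ?thesis .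
qed

lemma normal_law_exp_moment:
  assumes law: "distr P borel Y = distr std_normal_distribution borel (\<lambda>x. m + sqrt v * x)"
    and Y: "Y \<in> borel_measurable P" and v: "0 \<le> v"
  shows "(\<integral>\<^sup>+\<omega>. ennreal (exp (a * Y \<omega>)) \<partial>P) = ennreal (exp (a * m + a\<^sup>2 * v / 2))"
proof -
  have i: "integrable std_normal_distribution (\<lambda>x. exp (b * x))"
    and e: "(\<integral>x. exp (b * x) \<partial>std_normal_distribution) = exp (b\<^sup>2 / 2)" for b :: real
  proof -
    have *: "complex_of_real (exp (b * x)) = exp (of_real b * of_real x)" for x
      by (simp flip: exp_of_real)
    have "integrable std_normal_distribution (\<lambda>x. complex_of_real (exp (b * x)))"
      unfolding * by (rule std_normal_exp)
    then show "integrable std_normal_distribution (\<lambda>x. exp (b * x))"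
      by (simp add: complex_of_real_integrable_eq)
    have "complex_of_real (\<integral>x. exp (b * x) \<partial>std_normal_distribution)
        = (\<integral>x. complex_of_real (exp (b * x)) \<partial>std_normal_distribution)"
      by (rule integral_complex_of_real[symmetric])
    also have "\<dots> = exp ((of_real b)\<^sup>2 / 2)" unfolding * by (rule std_normal_exp)
    also have "\<dots> = of_real (exp (b\<^sup>2 / 2))"
      by (simp add: exp_of_real[symmetric])
    finally show "(\<integral>x. exp (b * x) \<partial>std_normal_distribution) = exp (b\<^sup>2 / 2)"
      by (simp only: of_real_eq_iff)
  qed
  have "(\<integral>\<^sup>+\<omega>. ennreal (exp (a * Y \<omega>)) \<partial>P) = (\<integral>\<^sup>+y. ennreal (exp (a * y)) \<partial>distr P borel Y)"
    using Y by (simp add: nn_integral_distr)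
  also have "\<dots> = (\<integral>\<^sup>+x. ennreal (exp (a * m) * exp ((a * sqrt v) * x)) \<partial>std_normal_distribution)"
    by (simp add: law nn_integral_distr distrib_left exp_add mult.assoc)
  also have "\<dots> = ennreal (\<integral>x. exp (a * m) * exp ((a * sqrt v) * x) \<partial>std_normal_distribution)"
    using i by (intro nn_integral_eq_integral) auto
  also have "\<dots> = ennreal (exp (a * m) * exp ((a * sqrt v)\<^sup>2 / 2))"
    by (simp only: integral_mult_right_zero e)
  also have "exp (a * m) * exp ((a * sqrt v)\<^sup>2 / 2) = exp (a * m + a\<^sup>2 * v / 2)"
    using v by (simp add: power_mult_distrib exp_add)
  finally show ?thesis .
qed

section \<open>Mean square convergence\<close>

lemma square_integrable_measurable: "square_integrable M f \<Longrightarrow> f \<in> borel_measurable M"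
  and square_integrable_integrable: "square_integrable M f \<Longrightarrow> integrable M (\<lambda>x. (f x)\<^sup>2)"
  by (simp_all add: square_integrable_def)

lemma square_integrable_mult:
  assumes "square_integrable M f" "square_integrable M g"
  shows "integrable M (\<lambda>x. f x * g x)"
proof (rule Bochner_Integration.integrable_bound)
  show "integrable M (\<lambda>x. (f x)\<^sup>2 + (g x)\<^sup>2)"
    using assms by (intro Bochner_Integration.integrable_add) (auto simp: square_integrable_def)
  show "(\<lambda>x. f x * g x) \<in> borel_measurable M"
    using assms by (auto simp: square_integrable_def)
  have "\<bar>f x * g x\<bar> \<le> (f x)\<^sup>2 + (g x)\<^sup>2" for x
  proof -
    have "2 * \<bar>f x * g x\<bar> \<le> (f x)\<^sup>2 + (g x)\<^sup>2"
      using sum_squares_bound[of "\<bar>f x\<bar>" "\<bar>g x\<bar>"] by (simp add: abs_mult mult.assoc)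
    moreover have "0 \<le> \<bar>f x * g x\<bar>" by simp
    ultimately show ?thesis by linarith
  qed
  then show "AE x in M. norm (f x * g x) \<le> norm ((f x)\<^sup>2 + (g x)\<^sup>2)"
    by (auto intro: order_trans[OF _ abs_ge_self])
qed

lemma square_integrable_lincomb:
  assumes "square_integrable M f" "square_integrable M g"
  shows "square_integrable M (\<lambda>x. a * f x + b * g x)"
proof -
  have e: "(a * f x + b * g x)\<^sup>2 = a\<^sup>2 * (f x)\<^sup>2 + b\<^sup>2 * (g x)\<^sup>2 + 2 * a * b * (f x * g x)" for x
    by (simp add: power2_eq_square algebra_simps)
  show ?thesis
    unfolding square_integrable_def e
    using assms square_integrable_mult[OF assms] by (auto simp: square_integrable_def)
qed

lemma square_integrable_diff:
  "square_integrable M f \<Longrightarrow> square_integrable M g \<Longrightarrow> square_integrable M (\<lambda>x. f x - g x)"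
  using square_integrable_lincomb[of M f g 1 "-1"] by simp

lemma square_integrable_diff_square:
  assumes "square_integrable M f" "square_integrable M g"
  shows "integrable M (\<lambda>x. (f x - g x)\<^sup>2)"
  using square_integrable_diff[OF assms] by (simp add: square_integrable_def)

definition L2_lim :: "'a measure \<Rightarrow> (nat \<Rightarrow> 'a \<Rightarrow> real) \<Rightarrow> ('a \<Rightarrow> real) \<Rightarrow> bool" where
  "L2_lim M fs f \<longleftrightarrow> (\<forall>n. square_integrable M (fs n)) \<and> square_integrable M f \<and>
     (\<lambda>n. \<integral>x. (fs n x - f x)\<^sup>2 \<partial>M) \<longlonglongrightarrow> 0"

lemma sum_square_le: "(x + y)\<^sup>2 \<le> 2 * x\<^sup>2 + 2 * (y::real)\<^sup>2"
  using sum_squares_bound[of x y] by (simp add: power2_sum)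

lemma L2_lim_lincomb:
  assumes "L2_lim M fs f" "L2_lim M gs g"
  shows "L2_lim M (\<lambda>n x. a * fs n x + b * gs n x) (\<lambda>x. a * f x + b * g x)"
proof -
  note f = assms(1)[unfolded L2_lim_def] and g = assms(2)[unfolded L2_lim_def]
  let ?d = "\<lambda>n. \<integral>x. ((a * fs n x + b * gs n x) - (a * f x + b * g x))\<^sup>2 \<partial>M"
  let ?df = "\<lambda>n. \<integral>x. (fs n x - f x)\<^sup>2 \<partial>M" and ?dg = "\<lambda>n. \<integral>x. (gs n x - g x)\<^sup>2 \<partial>M"
  have df: "integrable M (\<lambda>x. (fs n x - f x)\<^sup>2)" for n using f by (auto intro: square_integrable_diff_square)
  have dg: "integrable M (\<lambda>x. (gs n x - g x)\<^sup>2)" for n using g by (auto intro: square_integrable_diff_square)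
  have le: "?d n \<le> 2 * a\<^sup>2 * ?df n + 2 * b\<^sup>2 * ?dg n" for n
  proof -
    have "?d n \<le> (\<integral>x. 2 * a\<^sup>2 * (fs n x - f x)\<^sup>2 + 2 * b\<^sup>2 * (gs n x - g x)\<^sup>2 \<partial>M)"
    proof (intro integral_mono)
      show "integrable M (\<lambda>x. ((a * fs n x + b * gs n x) - (a * f x + b * g x))\<^sup>2)"
        using f g by (intro square_integrable_diff_square square_integrable_lincomb) auto
      show "((a * fs n x + b * gs n x) - (a * f x + b * g x))\<^sup>2
        \<le> 2 * a\<^sup>2 * (fs n x - f x)\<^sup>2 + 2 * b\<^sup>2 * (gs n x - g x)\<^sup>2" for x
        using sum_square_le[of "a * (fs n x - f x)" "b * (gs n x - g x)"]
        by (simp add: algebra_simps flip: power_mult_distrib)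
    qed (use df dg in auto)
    then show ?thesis using df dg by simp
  qed
  have "(\<lambda>n. 2 * a\<^sup>2 * ?df n + 2 * b\<^sup>2 * ?dg n) \<longlonglongrightarrow> 0"
    using f g by (auto intro!: tendsto_eq_intros)
  then have "?d \<longlonglongrightarrow> 0"
    by (rule tendsto_sandwich[OF _ _ tendsto_const, rotated 2]) (use le in auto)
  then show ?thesis
    unfolding L2_lim_def using f g square_integrable_lincomb by blast
qed

text \<open>The cross term in \<open>(f + d)\<^sup>2 - f\<^sup>2\<close> is split by the weighted inequality \<open>2 |d f| \<le> d\<^sup>2 / \<eta> + \<eta> f\<^sup>2\<close> with
  small \<open>\<eta>\<close>.\<close>

lemma L2_lim_norm:
  assumes "L2_lim M fs f"
  shows "(\<lambda>n. \<integral>x. (fs n x)\<^sup>2 \<partial>M) \<longlonglongrightarrow> (\<integral>x. (f x)\<^sup>2 \<partial>M)"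
proof (rule LIMSEQ_I)
  fix e :: real assume e: "0 < e"
  note f = assms[unfolded L2_lim_def]
  define B where "B = (\<integral>x. (f x)\<^sup>2 \<partial>M)"
  have B: "0 \<le> B" by (simp add: B_def)
  \<comment> \<open>keeps \<open>\<eta> * B\<close> below \<open>e / 2\<close>, also if \<open>B = 0\<close>\<close>
  define \<eta> where "\<eta> = e / (2 * (B + 1))"
  have \<eta>: "0 < \<eta>" "\<eta> * B \<le> e / 2" using e B by (auto simp: \<eta>_def field_simps)
  have i: "integrable M (\<lambda>x. (f x)\<^sup>2)" "integrable M (\<lambda>x. (fs n x)\<^sup>2)"
    "integrable M (\<lambda>x. (fs n x - f x)\<^sup>2)" for n
    using f by (auto intro: square_integrable_diff_square square_integrable_integrable)
  have bound: "\<bar>(fs n x)\<^sup>2 - (f x)\<^sup>2\<bar> \<le> (1 + 1 / \<eta>) * (fs n x - f x)\<^sup>2 + \<eta> * (f x)\<^sup>2" for n x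
  proof -
    define d where "d = fs n x - f x"
    have "(fs n x)\<^sup>2 - (f x)\<^sup>2 = d\<^sup>2 + 2 * (d * f x)"
      by (simp add: d_def power2_eq_square algebra_simps)
    moreover have "2 * \<bar>d * f x\<bar> \<le> d\<^sup>2 / \<eta> + \<eta> * (f x)\<^sup>2"
    proof -
      have "2 * (\<bar>d\<bar> / sqrt \<eta>) * (sqrt \<eta> * \<bar>f x\<bar>) \<le> (\<bar>d\<bar> / sqrt \<eta>)\<^sup>2 + (sqrt \<eta> * \<bar>f x\<bar>)\<^sup>2"
        by (rule sum_squares_bound)
      then show ?thesis using \<eta> by (simp add: power_divide power_mult_distrib abs_mult)
    qed
    moreover have "0 \<le> d\<^sup>2" by simp
    ultimately have "\<bar>(fs n x)\<^sup>2 - (f x)\<^sup>2\<bar> \<le> d\<^sup>2 + (d\<^sup>2 / \<eta> + \<eta> * (f x)\<^sup>2)"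
      by linarith
    then show ?thesis by (simp add: d_def algebra_simps)
  qed
  have main: "\<bar>(\<integral>x. (fs n x)\<^sup>2 \<partial>M) - B\<bar> \<le> (1 + 1 / \<eta>) * (\<integral>x. (fs n x - f x)\<^sup>2 \<partial>M) + \<eta> * B" for n
  proof -
    have "\<bar>(\<integral>x. (fs n x)\<^sup>2 \<partial>M) - B\<bar> = \<bar>\<integral>x. (fs n x)\<^sup>2 - (f x)\<^sup>2 \<partial>M\<bar>"
      using i by (simp add: B_def)
    also have "\<dots> \<le> (\<integral>x. \<bar>(fs n x)\<^sup>2 - (f x)\<^sup>2\<bar> \<partial>M)" by (rule integral_abs_bound)
    also have "\<dots> \<le> (\<integral>x. (1 + 1 / \<eta>) * (fs n x - f x)\<^sup>2 + \<eta> * (f x)\<^sup>2 \<partial>M)"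
      using i bound by (intro integral_mono) auto
    also have "\<dots> = (1 + 1 / \<eta>) * (\<integral>x. (fs n x - f x)\<^sup>2 \<partial>M) + \<eta> * B"
      using i by (simp add: B_def)
    finally show ?thesis .
  qed
  have "(\<lambda>n. (1 + 1 / \<eta>) * (\<integral>x. (fs n x - f x)\<^sup>2 \<partial>M)) \<longlonglongrightarrow> 0"
    using f by (auto intro!: tendsto_eq_intros)
  then have "\<forall>\<^sub>F n in sequentially. (1 + 1 / \<eta>) * (\<integral>x. (fs n x - f x)\<^sup>2 \<partial>M) < e / 2"
    using e by (intro order_tendstoD(2)) auto
  then have "\<forall>\<^sub>F n in sequentially. norm ((\<integral>x. (fs n x)\<^sup>2 \<partial>M) - (\<integral>x. (f x)\<^sup>2 \<partial>M)) < e"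
  proof eventually_elim
    case (elim n)
    then show ?case using main[of n] \<eta> unfolding B_def real_norm_def by linarith
  qed
  then show "\<exists>no. \<forall>n\<ge>no. norm ((\<integral>x. (fs n x)\<^sup>2 \<partial>M) - (\<integral>x. (f x)\<^sup>2 \<partial>M)) < e"
    by (simp add: eventually_sequentially)
qed

text \<open>Polarization reduces inner products to norms.\<close>

lemma L2_lim_inner:
  assumes "L2_lim M fs f" "L2_lim M gs g"
  shows "(\<lambda>n. \<integral>x. fs n x * gs n x \<partial>M) \<longlonglongrightarrow> (\<integral>x. f x * g x \<partial>M)"
proof -
  note f = assms(1)[unfolded L2_lim_def] and g = assms(2)[unfolded L2_lim_def]
  have pol: "(\<integral>x. h x * k x \<partial>M) = ((\<integral>x. (1 * h x + 1 * k x)\<^sup>2 \<partial>M) - (\<integral>x. (1 * h x + (-1) * k x)\<^sup>2 \<partial>M)) / 4"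
    if "square_integrable M h" "square_integrable M k" for h k
  proof -
    have "(\<integral>x. (1 * h x + 1 * k x)\<^sup>2 \<partial>M) - (\<integral>x. (1 * h x + (-1) * k x)\<^sup>2 \<partial>M)
      = (\<integral>x. (1 * h x + 1 * k x)\<^sup>2 - (1 * h x + (-1) * k x)\<^sup>2 \<partial>M)"
      using that by (intro Bochner_Integration.integral_diff[symmetric] square_integrable_integrable
          square_integrable_lincomb)
    also have "\<dots> = (\<integral>x. 4 * (h x * k x) \<partial>M)"
      by (intro Bochner_Integration.integral_cong) (auto simp: power2_eq_square algebra_simps)
    finally show ?thesis by simp
  qed
  show ?thesis
    using f g L2_lim_norm[OF L2_lim_lincomb[OF assms, of 1 1]] L2_lim_norm[OF L2_lim_lincomb[OF assms, of 1
        "-1"]]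
    by (simp only: pol) (intro tendsto_intros, auto)
qed

lemma L2_lim_imp_L1:
  assumes "finite_measure M" "L2_lim M fs f"
  shows "(\<lambda>n. \<integral>x. \<bar>fs n x - f x\<bar> \<partial>M) \<longlonglongrightarrow> 0" and "\<And>n. integrable M (\<lambda>x. \<bar>fs n x - f x\<bar>)"
proof -
  interpret finite_measure M by fact
  note f = assms(2)[unfolded L2_lim_def]
  have c: "square_integrable M (\<lambda>x. 1)" by (simp add: square_integrable_def)
  have d: "square_integrable M (\<lambda>x. \<bar>fs n x - f x\<bar>)" for n
    using f square_integrable_diff[of M "fs n" f]
    by (auto simp: square_integrable_def intro!: borel_measurable_abs)
  show i: "integrable M (\<lambda>x. \<bar>fs n x - f x\<bar>)" for n
    using square_integrable_mult[OF d c] by simp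
  have "L2_lim M (\<lambda>n x. \<bar>fs n x - f x\<bar>) (\<lambda>x. 0)"
    using f d by (auto simp: L2_lim_def square_integrable_def)
  moreover have "L2_lim M (\<lambda>n x. 1) (\<lambda>x. 1)"
    using c by (simp add: L2_lim_def)
  ultimately show "(\<lambda>n. \<integral>x. \<bar>fs n x - f x\<bar> \<partial>M) \<longlonglongrightarrow> 0"
    using L2_lim_inner by fastforce
qed

lemma L2_limI_nn:
  assumes fs: "\<And>n. square_integrable M (fs n)" and f: "f \<in> borel_measurable M"
    and lim: "(\<lambda>n. \<integral>\<^sup>+x. ennreal ((fs n x - f x)\<^sup>2) \<partial>M) \<longlonglongrightarrow> 0"
  shows "L2_lim M fs f"
proof -
  have m: "fs n \<in> borel_measurable M" for n using fs by (simp add: square_integrable_def)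
  have "\<forall>\<^sub>F n in sequentially. (\<integral>\<^sup>+x. ennreal ((fs n x - f x)\<^sup>2) \<partial>M) < 1"
    using lim by (rule order_tendstoD) simp
  then obtain n where n: "(\<integral>\<^sup>+x. ennreal ((fs n x - f x)\<^sup>2) \<partial>M) < 1"
    by (auto simp: eventually_sequentially)
  have "integrable M (\<lambda>x. (fs n x - f x)\<^sup>2)"
    using m f order_less_trans[OF n] by (intro integrableI_nonneg) (auto simp: ennreal_1[symmetric] simp
        del: ennreal_1)
  then have "square_integrable M (\<lambda>x. fs n x - f x)"
    using m f by (simp add: square_integrable_def)
  then have sf: "square_integrable M f"
    using square_integrable_diff[OF fs[of n], of "\<lambda>x. fs n x - f x"] by simp
  have "(\<lambda>n. enn2real (\<integral>\<^sup>+x. ennreal ((fs n x - f x)\<^sup>2) \<partial>M)) \<longlonglongrightarrow> enn2real 0"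
    using lim by (intro tendsto_enn2real) auto
  moreover have "enn2real (\<integral>\<^sup>+x. ennreal ((fs n x - f x)\<^sup>2) \<partial>M) = (\<integral>x. (fs n x - f x)\<^sup>2 \<partial>M)" for n
    using m f by (intro integral_eq_nn_integral[symmetric]) auto
  ultimately show ?thesis
    using fs sf by (simp add: L2_lim_def)
qed

lemma L2_lim_nn:
  assumes "L2_lim M fs f"
  shows "(\<lambda>n. \<integral>\<^sup>+x. ennreal ((fs n x - f x)\<^sup>2) \<partial>M) \<longlonglongrightarrow> 0"
proof -
  note f = assms[unfolded L2_lim_def]
  have "(\<lambda>n. ennreal (\<integral>x. (fs n x - f x)\<^sup>2 \<partial>M)) \<longlonglongrightarrow> ennreal 0"
    using f by (intro tendsto_ennrealI) auto
  moreover have "(\<integral>\<^sup>+x. ennreal ((fs n x - f x)\<^sup>2) \<partial>M) = ennreal (\<integral>x. (fs n x - f x)\<^sup>2 \<partial>M)" for n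
    using f by (intro nn_integral_eq_integral square_integrable_diff_square) auto
  ultimately show ?thesis by simp
qed

lemma norm_integral_le:
  fixes f :: "'a \<Rightarrow> 'b::{banach, second_countable_topology}"
  assumes "integrable M f" "integrable M g" "\<And>x. x \<in> space M \<Longrightarrow> norm (f x) \<le> g x"
  shows "norm (\<integral>x. f x \<partial>M) \<le> (\<integral>x. g x \<partial>M)"
  using assms by (intro order_trans[OF integral_norm_bound integral_mono]) auto

text \<open>Mean value inequality on the half plane to the left of the larger real part.\<close>

lemma norm_exp_diff_le:
  fixes w z :: complex
  shows "norm (exp w - exp z) \<le> norm (w - z) * (exp (Re w) + exp (Re z))"
proof -
  define c where "c = max (Re w) (Re z)"
  have "norm (exp w - exp z) \<le> exp c * norm (w - z)"
  proof (rule field_differentiable_bound[where S="{x. Re x \<le> c}" and f'=exp])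
    show "convex {x. Re x \<le> c}" by (rule convex_halfspace_Re_le)
  qed (auto simp: c_def intro!: derivative_eq_intros)
  also have "\<dots> \<le> (exp (Re w) + exp (Re z)) * norm (w - z)"
    by (intro mult_right_mono) (auto simp: c_def max_def add_increasing add_increasing2)
  finally show ?thesis by (simp add: mult.commute)
qed

section \<open>Brownian increments and step functions\<close>

locale wiener =
  fixes P :: "'w measure" and F :: "real \<Rightarrow> 'w measure" and T :: real and W :: "real \<Rightarrow> 'w \<Rightarrow> real"
  assumes BM: "brownian_motion P F T W" and T: "0 < T"
begin

abbreviation \<L> :: "real measure" where "\<L> \<equiv> lebesgue_on {0..T}"

abbreviation sqnorm :: "(real \<Rightarrow> real) \<Rightarrow> real" where
  "sqnorm \<phi> \<equiv> (\<integral>u. (\<phi> u)\<^sup>2 \<partial>\<L>)"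

abbreviation inner_prod :: "(real \<Rightarrow> real) \<Rightarrow> (real \<Rightarrow> real) \<Rightarrow> real" where
  "inner_prod \<psi> \<phi> \<equiv> (\<integral>u. \<psi> u * \<phi> u \<partial>\<L>)"

sublocale P: prob_space P
  using BM by (simp add: brownian_motion_def)

sublocale \<L>: finite_measure \<L>
  by (rule finite_measure_lebesgue_on) simp

lemma F_subalgebra: "t \<in> {0..T} \<Longrightarrow> subalgebra P (F t)"
  and F_mono: "s \<in> {0..T} \<Longrightarrow> t \<in> {s..T} \<Longrightarrow> sets (F s) \<subseteq> sets (F t)"
  and W_adapted: "t \<in> {0..T} \<Longrightarrow> W t \<in> borel_measurable (F t)"
  and W_start: "AE \<omega> in P. W 0 \<omega> = 0"
  and W_increment: "s \<in> {0..T} \<Longrightarrow> t \<in> {s<..T} \<Longrightarrow>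
        distributed P lborel (\<lambda>\<omega>. W t \<omega> - W s \<omega>) (normal_density 0 (sqrt (t - s)))"
  and W_indep: "s \<in> {0..T} \<Longrightarrow> t \<in> {s<..T} \<Longrightarrow>
        P.indep_set (sets (F s)) (sets (vimage_algebra (space P) (\<lambda>\<omega>. W t \<omega> - W s \<omega>) borel))"
  using BM unfolding brownian_motion_def by blast+

lemma F_measurable_mono:
  assumes "s \<in> {0..T}" "t \<in> {s..T}" "f \<in> measurable (F s) N"
  shows "f \<in> measurable (F t) N"
proof (rule measurable_from_subalg[OF _ assms(3)])
  have "subalgebra P (F s)" "subalgebra P (F t)"
    using assms F_subalgebra by auto
  then show "subalgebra (F t) (F s)"
    using F_mono[OF assms(1,2)] by (simp add: subalgebra_def)
qed

lemma F_measurable_P: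
  assumes "t \<in> {0..T}" "f \<in> measurable (F t) N"
  shows "f \<in> measurable P N"
  using measurable_from_subalg[OF F_subalgebra assms(2)] assms(1) by simp

lemma W_measurable: "t \<in> {0..T} \<Longrightarrow> W t \<in> borel_measurable P"
  using F_measurable_P W_adapted by blast

text \<open>In this form the independence of the increments enters the induction over the time points, which adds
  one increment at a time.\<close>

lemma indep_past_increment:
  fixes U :: "'w \<Rightarrow> 'b::{topological_space}"
  assumes s: "s \<in> {0..T}" "t \<in> {s<..T}" and U: "U \<in> borel_measurable (F s)"
    and h: "h \<in> borel_measurable borel"
  shows "P.indep_var borel U borel (\<lambda>\<omega>. h (W t \<omega> - W s \<omega>))"
proof -
  have t: "t \<in> {0..T}" using s by auto
  define V where "V = vimage_algebra (space P) (\<lambda>\<omega>. W t \<omega> - W s \<omega>) borel"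
  have spF: "space (F s) = space P" using F_subalgebra[OF s(1)] by (simp add: subalgebra_def)
  have D: "(\<lambda>\<omega>. W t \<omega> - W s \<omega>) \<in> borel_measurable P"
    using W_measurable s(1) t by simp
  have hV: "(\<lambda>\<omega>. h (W t \<omega> - W s \<omega>)) \<in> borel_measurable V"
    unfolding V_def by (rule measurable_compose[OF measurable_vimage_algebra1 h]) auto
  have spV: "space V = space P" by (simp add: V_def)
  have sub: "sigma_sets (space P) {f -` A \<inter> space P |A. A \<in> sets borel} \<subseteq> sets N"
    if "f \<in> borel_measurable N" "space N = space P" for f :: "'w \<Rightarrow> 'b" and N
  proof -
    have "{f -` A \<inter> space P |A. A \<in> sets borel} \<subseteq> sets N"
      using measurable_sets[OF that(1)] that(2) by auto
    then show ?thesis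
      using sets.sigma_sets_subset[of _ N] that(2) by simp
  qed
  have "P.indep_set (sets (F s)) (sets V)"
    unfolding V_def using W_indep s by simp
  then have "P.indep_set (sigma_sets (space P) {U -` A \<inter> space P |A. A \<in> sets borel})
     (sigma_sets (space P) {(\<lambda>\<omega>. h (W t \<omega> - W s \<omega>)) -` A \<inter> space P |A. A \<in> sets borel})"
    unfolding P.indep_set_def
    by (rule P.indep_sets_mono_sets) (use sub[OF U spF] sub[OF hV spV] in \<open>auto split: bool.split\<close>)
  moreover have "U \<in> borel_measurable P" using F_measurable_P[OF s(1) U] .
  moreover have "(\<lambda>\<omega>. h (W t \<omega> - W s \<omega>)) \<in> borel_measurable P"
    using measurable_compose[OF D h] .
  ultimately show ?thesis
    by (simp add: P.indep_var_eq)
qed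

lemma increment_exp:
  fixes z :: complex
  assumes s: "s \<in> {0..T}" "t \<in> {s<..T}"
  shows "integrable P (\<lambda>\<omega>. exp (z * of_real (W t \<omega> - W s \<omega>)))" (is ?int)
    and "(\<integral>\<omega>. exp (z * of_real (W t \<omega> - W s \<omega>)) \<partial>P) = exp (z\<^sup>2 * of_real (t - s) / 2)" (is ?eq)
proof -
  define v where "v = sqrt (t - s)"
  have v: "0 < v" "v\<^sup>2 = t - s" using s by (auto simp: v_def)
  have m: "W t \<in> borel_measurable P" "W s \<in> borel_measurable P"
    using W_measurable s by auto
  have "distributed P lborel (\<lambda>\<omega>. (W t \<omega> - W s \<omega> - 0) / v) std_normal_density"
    using W_increment[OF s] v P.normal_standard_normal_convert[of v "\<lambda>\<omega>. W t \<omega> - W s \<omega>" 0] by (simp add: v_def)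
  then have "distr P lborel (\<lambda>\<omega>. (W t \<omega> - W s \<omega>) / v) = std_normal_distribution"
    by (simp add: distributed_def)
  moreover have "distr P borel (\<lambda>\<omega>. (W t \<omega> - W s \<omega>) / v) = distr P lborel (\<lambda>\<omega>. (W t \<omega> - W s \<omega>) / v)"
    by (rule distr_cong) auto
  ultimately have d: "distr P borel (\<lambda>\<omega>. (W t \<omega> - W s \<omega>) / v) = std_normal_distribution"
    by simp
  have e: "exp (z * of_real (W t \<omega> - W s \<omega>)) = exp (z * of_real v * of_real ((W t \<omega> - W s \<omega>) / v))" for \<omega>
  proof -
    have "W t \<omega> - W s \<omega> = v * ((W t \<omega> - W s \<omega>) / v)" using v by simp
    then show ?thesis by (metis mult.assoc of_real_mult)
  qed
  show ?int
    unfolding e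
    by (subst integrable_distr_eq[of "\<lambda>\<omega>. (W t \<omega> - W s \<omega>) / v" P borel "\<lambda>x. exp (z * of_real v
        * of_real x)", symmetric])
       (use m std_normal_exp in \<open>auto simp: d\<close>)
  show ?eq
    unfolding e
    by (subst integral_distr[of "\<lambda>\<omega>. (W t \<omega> - W s \<omega>) / v" P borel "\<lambda>x. exp (z * of_real v
        * of_real x)", symmetric])
       (use m std_normal_exp v in \<open>auto simp: d power_mult_distrib simp flip: of_real_power\<close>)
qed

text \<open>Step functions are parametrized by their jump times instead of by partitions, so that two of them
  have common jump times after a trivial enlargement.\<close>

definition step :: "(real \<Rightarrow> 'b::real_normed_field) \<Rightarrow> real set \<Rightarrow> real \<Rightarrow> 'b" where
  "step c S u = (\<Sum>t\<in>S. c t * indicator {0<..t} u)"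

definition step_int :: "(real \<Rightarrow> 'b::real_normed_field) \<Rightarrow> real set \<Rightarrow> 'w \<Rightarrow> 'b" where
  "step_int c S \<omega> = (\<Sum>t\<in>S. c t * of_real (W t \<omega>))"

lemma step_measurable:
  fixes c :: "real \<Rightarrow> 'b::{real_normed_field,banach,second_countable_topology}"
  shows "step c S \<in> borel_measurable \<L>"
proof -
  have "step c S \<in> borel_measurable borel"
    unfolding step_def by measurable
  then show ?thesis
    by (intro measurable_restrict_space1 measurable_completion) simp
qed

lemma step_bound: "norm (step c S u) \<le> (\<Sum>t\<in>S. norm (c t))"
  unfolding step_def
  by (rule order_trans[OF norm_sum]) (auto intro!: sum_mono simp: norm_mult indicator_def)

lemma step_power_integrable:
  fixes c :: "real \<Rightarrow> 'b::{real_normed_field,banach,second_countable_topology}"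
  shows "integrable \<L> (\<lambda>u. (step c S u) ^ n)"
  using step_bound[of c S]
  by (intro \<L>.integrable_const_bound[where B="(\<Sum>t\<in>S. norm (c t)) ^ n"] AE_I2)
     (auto simp: norm_power intro!: power_mono borel_measurable_power step_measurable)

lemma sum_fun_upd_add:
  fixes c :: "'i \<Rightarrow> 'b::comm_ring_1"
  assumes "finite S" "a \<in> S"
  shows "(\<Sum>t\<in>S. (c(a := c a + d)) t * x t) = (\<Sum>t\<in>S. c t * x t) + d * x a"
  using assms by (simp add: sum.remove[of S a] algebra_simps)

lemma integral_interval:
  assumes "0 \<le> a" "a \<le> b" "b \<le> T"
  shows "integrable \<L> (\<lambda>u. indicator {a<..b} u :: real)"
    and "(\<integral>u. (indicator {a<..b} u :: real) \<partial>\<L>) = b - a"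
proof -
  have sub: "{a<..b} \<subseteq> {0..T}" using assms by auto
  have mb: "{a<..b} \<in> sets \<L>"
    using sub by (intro sets_restrict_space_iff[THEN iffD2]) auto
  show "integrable \<L> (\<lambda>u. indicator {a<..b} u :: real)"
    using mb by (intro integrable_real_indicator) (auto simp: less_top[symmetric])
  have "measure \<L> {a<..b} = b - a"
    using sub assms by (simp add: measure_restrict_space)
  then show "(\<integral>u. (indicator {a<..b} u :: real) \<partial>\<L>) = b - a"
    using sub by (simp add: Int_absorb1 Int_absorb2)
qed

lemma integral_interval_complex:
  assumes "0 \<le> a" "a \<le> b" "b \<le> T"
  shows "integrable \<L> (\<lambda>u. indicator {a<..b} u :: complex)"
    and "(\<integral>u. (indicator {a<..b} u :: complex) \<partial>\<L>) = of_real (b - a)"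
proof -
  have e: "(indicator {a<..b} u :: complex) = of_real (indicator {a<..b} u)" for u
    by (simp add: indicator_def)
  show "integrable \<L> (\<lambda>u. indicator {a<..b} u :: complex)"
    unfolding e complex_of_real_integrable_eq by (rule integral_interval(1)[OF assms])
  show "(\<integral>u. (indicator {a<..b} u :: complex) \<partial>\<L>) = of_real (b - a)"
    unfolding e integral_complex_of_real integral_interval(2)[OF assms] ..
qed

text \<open>Exponential moments with complex coefficients, by induction on the largest time point \<open>b\<close>. With \<open>a\<close>
  the preceding time point, the term \<open>c b * W b\<close> is split into \<open>c b * W a\<close>, which is absorbed into
  the coefficient at \<open>a\<close>, and an increment independent of the past; on the side of the step
  functions, the new part lives on the interval from \<open>a\<close> to \<open>b\<close>, where the old part vanishes, so the
  squares add up as well. The time point \<open>0\<close> is always included so that a predecessor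
  exists. Complex coefficients serve the real exponent of a change of measure and the
  imaginary exponent of a characteristic function at the same time.\<close>

lemma step_int_exp_pos:
  fixes c :: "real \<Rightarrow> complex"
  assumes "finite A" "A \<subseteq> {0<..T}"
  shows "integrable P (\<lambda>\<omega>. exp (step_int c (insert 0 A) \<omega>)) \<and>
    (\<integral>\<omega>. exp (step_int c (insert 0 A) \<omega>) \<partial>P) = exp ((\<integral>u. (step c (insert 0 A) u)\<^sup>2 \<partial>\<L>) / 2)"
  using assms
proof (induction A arbitrary: c rule: finite_linorder_max_induct)
  case empty
  have ae: "AE \<omega> in P. exp (step_int c {0} \<omega>) = 1"
    using W_start by (auto simp: step_int_def)
  have m: "(\<lambda>\<omega>. exp (step_int c {0} \<omega>)) \<in> borel_measurable P"
    using W_measurable[of 0] T by (simp add: step_int_def)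
  have "integrable P (\<lambda>\<omega>. exp (step_int c {0} \<omega>)) \<longleftrightarrow> integrable P (\<lambda>\<omega>. 1::complex)"
    using ae m by (intro integrable_cong_AE) auto
  moreover have "(\<integral>\<omega>. exp (step_int c {0} \<omega>) \<partial>P) = (\<integral>\<omega>. 1 \<partial>P)"
    using ae m by (intro integral_cong_AE) auto
  ultimately show ?case by (simp add: step_def P.prob_space)
next
  case (insert b A)
  define S where "S = insert 0 A"
  define a where "a = Max S"
  have S: "finite S" "S \<noteq> {}" "b \<notin> S" using insert by (auto simp: S_def)
  have aS: "a \<in> S" and a_max: "\<And>t. t \<in> S \<Longrightarrow> t \<le> a"
    using S by (auto simp: a_def)
  have ab: "0 \<le> a" "a < b" "b \<le> T"
    using aS a_max[of 0] insert by (auto simp: S_def)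
  have aT: "a \<in> {0..T}" "b \<in> {a<..T}" using ab by auto
  define c' where "c' = c(a := c a + c b)"
  have IH: "integrable P (\<lambda>\<omega>. exp (step_int c' S \<omega>))"
      "(\<integral>\<omega>. exp (step_int c' S \<omega>) \<partial>P) = exp ((\<integral>u. (step c' S u)\<^sup>2 \<partial>\<L>) / 2)"
    using insert by (auto simp: S_def)
  have ins: "insert 0 (insert b A) = insert b S" by (auto simp: S_def)
  have e1: "step_int c (insert b S) \<omega> = step_int c' S \<omega> + c b * of_real (W b \<omega> - W a \<omega>)" for \<omega>
    using S sum_fun_upd_add[OF S(1) aS, of c "c b" "\<lambda>t. of_real (W t \<omega>)"]
    by (simp add: step_int_def c'_def algebra_simps)
  have e2: "step c (insert b S) u = step c' S u + c b * indicator {a<..b} u" for u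
  proof -
    have "indicator {0<..b} u = indicator {0<..a} u + (indicator {a<..b} u :: complex)"
      using ab by (auto simp: indicator_def)
    then show ?thesis
      using S sum_fun_upd_add[OF S(1) aS, of c "c b" "\<lambda>t. indicator {0<..t} u"]
      by (simp only: step_def c'_def sum.insert[OF S(1,3)] distrib_left add_ac)
  qed
  have e3: "(step c (insert b S) u)\<^sup>2 = (step c' S u)\<^sup>2 + (c b)\<^sup>2 * indicator {a<..b} u" for u
  proof (cases "u \<in> {a<..b}")
    case True
    then have "step c' S u = 0"
      using a_max unfolding step_def by (intro sum.neutral) (force simp: indicator_def)
    moreover have "indicator {a<..b} u = (1::complex)"
      using True by (rule indicator_simps(1))
    ultimately show ?thesis by (simp add: e2)
  next
    case False
    then have "indicator {a<..b} u = (0::complex)"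
      by (rule indicator_simps(2))
    then show ?thesis by (simp add: e2)
  qed
  have "(\<integral>u. (step c (insert b S) u)\<^sup>2 \<partial>\<L>) = (\<integral>u. (step c' S u)\<^sup>2 \<partial>\<L>) + (c b)\<^sup>2 * of_real (b - a)"
    unfolding e3 using integral_interval_complex[of a b] ab
    by (subst Bochner_Integration.integral_add) (auto intro: step_power_integrable)
  then have e4: "exp ((\<integral>u. (step c (insert b S) u)\<^sup>2 \<partial>\<L>) / 2)
     = exp ((\<integral>u. (step c' S u)\<^sup>2 \<partial>\<L>) / 2) * exp ((c b)\<^sup>2 * of_real (b - a) / 2)"
    by (simp add: add_divide_distrib exp_add)
  have [measurable]: "W t \<in> borel_measurable (F a)" if t: "t \<in> S" for t
  proof -
    have "t \<in> {0..T}" "a \<in> {t..T}" using t ab a_max[OF t] insert by (auto simp: S_def)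
    then show "W t \<in> borel_measurable (F a)"
      using F_measurable_mono W_adapted by blast
  qed
  have "step_int c' S \<in> borel_measurable (F a)"
    unfolding step_int_def by measurable
  then have "(\<lambda>\<omega>. exp (step_int c' S \<omega>)) \<in> borel_measurable (F a)" by simp
  then have ind: "P.indep_var borel (\<lambda>\<omega>. exp (step_int c' S \<omega>)) borel (\<lambda>\<omega>. exp (c b * of_real (W b \<omega> - W a \<omega>)))"
    by (rule indep_past_increment[OF aT, where h="\<lambda>x. exp (c b * of_real x)"]) simp
  show ?case
    unfolding ins e1 exp_add e4[unfolded e1]
    using P.indep_var_integrable[OF ind IH(1) increment_exp(1)[OF aT]]
          P.indep_var_lebesgue_integral[OF ind IH(1) increment_exp(1)[OF aT]]
          IH(2) increment_exp(2)[OF aT, of "c b"] e4 by simp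
qed

lemma step_int_exp:
  fixes c :: "real \<Rightarrow> complex"
  assumes "finite S" "S \<subseteq> {0..T}"
  shows "integrable P (\<lambda>\<omega>. exp (step_int c S \<omega>))"
    "(\<integral>\<omega>. exp (step_int c S \<omega>) \<partial>P) = exp ((\<integral>u. (step c S u)\<^sup>2 \<partial>\<L>) / 2)"
proof -
  define d where "d t = (if t \<in> S then c t else 0)" for t
  define A where "A = S - {0}"
  have ext: "(\<Sum>t\<in>S. c t * x t) = (\<Sum>t\<in>insert 0 A. d t * x t)" for x :: "real \<Rightarrow> complex"
    using assms by (intro sum.mono_neutral_cong_left) (auto simp: A_def d_def)
  have "step_int c S = step_int d (insert 0 A)" "step c S = step d (insert 0 A)"
    by (auto simp: step_int_def step_def ext)
  moreover have "finite A" "A \<subseteq> {0<..T}" using assms by (auto simp: A_def)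
  ultimately show "integrable P (\<lambda>\<omega>. exp (step_int c S \<omega>))"
    "(\<integral>\<omega>. exp (step_int c S \<omega>) \<partial>P) = exp ((\<integral>u. (step c S u)\<^sup>2 \<partial>\<L>) / 2)"
    using step_int_exp_pos by simp_all
qed

end

section \<open>Wiener integrals of deterministic functions\<close>

context wiener begin

definition elementary :: "(real \<Rightarrow> real) \<Rightarrow> ('w \<Rightarrow> real) \<Rightarrow> bool" where
  "elementary \<phi> Y \<longleftrightarrow> (\<exists>S c. finite S \<and> S \<subseteq> {0..T} \<and> \<phi> = step c S \<and> Y = step_int c S)"

lemma elementary_interval: "t \<in> {0..T} \<Longrightarrow> elementary (indicator {0<..t}) (W t)"
  unfolding elementary_def
  by (intro exI[of _ "{t}"] exI[of _ "\<lambda>_. 1"]) (auto simp: step_def step_int_def)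

lemma step_superset:
  fixes c :: "real \<Rightarrow> real"
  assumes "finite S'" "S \<subseteq> S'"
  shows "step c S = step (\<lambda>t. if t \<in> S then c t else 0) S'"
    "step_int c S = step_int (\<lambda>t. if t \<in> S then c t else 0) S'"
proof -
  have "(\<Sum>t\<in>S. c t * x t) = (\<Sum>t\<in>S'. (if t \<in> S then c t else 0) * x t)" for x
    using assms by (intro sum.mono_neutral_cong_left) auto
  then show "step c S = step (\<lambda>t. if t \<in> S then c t else 0) S'"
    "step_int c S = step_int (\<lambda>t. if t \<in> S then c t else 0) S'"
    by (auto simp: step_def step_int_def)
qed

lemma elementary_common:
  assumes "elementary \<phi> Y" "elementary \<psi> Z"
  obtains S c d where "finite S" "S \<subseteq> {0..T}" "\<phi> = step c S" "Y = step_int c S" "\<psi> = step d S" "Z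
      = step_int d S"
proof -
  from assms obtain S1 c1 S2 c2 where S: "finite S1" "S1 \<subseteq> {0..T}" "\<phi> = step c1 S1" "Y = step_int c1 S1"
     "finite S2" "S2 \<subseteq> {0..T}" "\<psi> = step c2 S2" "Z = step_int c2 S2"
    unfolding elementary_def by blast
  then have f: "finite (S1 \<union> S2)" and sub: "S1 \<union> S2 \<subseteq> {0..T}" by auto
  show thesis
  proof (rule that[OF f sub])
    show "\<phi> = step (\<lambda>t. if t \<in> S1 then c1 t else 0) (S1 \<union> S2)"
      "Y = step_int (\<lambda>t. if t \<in> S1 then c1 t else 0) (S1 \<union> S2)"
      using step_superset[OF f, of S1 c1] S by auto
    show "\<psi> = step (\<lambda>t. if t \<in> S2 then c2 t else 0) (S1 \<union> S2)"
      "Z = step_int (\<lambda>t. if t \<in> S2 then c2 t else 0) (S1 \<union> S2)"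
      using step_superset[OF f, of S2 c2] S by auto
  qed
qed

lemma elementary_lincomb:
  assumes "elementary \<phi> Y" "elementary \<psi> Z"
  shows "elementary (\<lambda>u. a * \<phi> u + b * \<psi> u) (\<lambda>\<omega>. a * Y \<omega> + b * Z \<omega>)"
proof -
  obtain S c d where S: "finite S" "S \<subseteq> {0..T}" "\<phi> = step c S" "Y = step_int c S" "\<psi> = step d S" "Z
      = step_int d S"
    using elementary_common[OF assms] .
  have "(\<lambda>u. a * \<phi> u + b * \<psi> u) = step (\<lambda>t. a * c t + b * d t) S"
    by (rule ext) (simp only: S step_def distrib_right sum.distrib sum_distrib_left mult.assoc)
  moreover have "(\<lambda>\<omega>. a * Y \<omega> + b * Z \<omega>) = step_int (\<lambda>t. a * c t + b * d t) S"
    by (rule ext) (simp only: S step_int_def distrib_right sum.distrib sum_distrib_left mult.assoc)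
  ultimately show ?thesis using S(1,2) unfolding elementary_def by blast
qed

lemma elementary_zero: "elementary (\<lambda>u. 0) (\<lambda>\<omega>. 0)"
  unfolding elementary_def by (intro exI[of _ "{}"] exI[of _ "\<lambda>_. 0"]) (auto simp: step_def step_int_def)

lemma elementary_sum:
  assumes "finite I" "\<And>i. i \<in> I \<Longrightarrow> elementary (\<phi> i) (Y i)"
  shows "elementary (\<lambda>u. \<Sum>i\<in>I. \<phi> i u) (\<lambda>\<omega>. \<Sum>i\<in>I. Y i \<omega>)"
  using assms
proof (induction I rule: finite_induct)
  case empty
  then show ?case by (simp add: elementary_zero)
next
  case (insert i I)
  then have "elementary (\<lambda>u. 1 * \<phi> i u + 1 * (\<Sum>i\<in>I. \<phi> i u)) (\<lambda>\<omega>. 1 * Y i \<omega> + 1 * (\<Sum>i\<in>I. Y i \<omega>))"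
    by (intro elementary_lincomb) auto
  then show ?case using insert by simp
qed

lemma elementary_square_integrable_time:
  assumes "elementary \<phi> Y"
  shows "square_integrable \<L> \<phi>"
  using assms step_measurable step_power_integrable[where n=2] unfolding elementary_def
      square_integrable_def by auto

lemma elementary_measurable:
  assumes "elementary \<phi> Y"
  shows "Y \<in> borel_measurable P"
proof -
  obtain S c where S: "finite S" "S \<subseteq> {0..T}" "\<phi> = step c S" "Y = step_int c S"
    using assms unfolding elementary_def by blast
  have [measurable]: "W t \<in> borel_measurable P" if "t \<in> S" for t
    using that S W_measurable by auto
  show ?thesis unfolding S step_int_def by measurable
qed

lemma elementary_exp:
  assumes "elementary \<psi> Z" "elementary \<phi> Y"
  shows "integrable P (\<lambda>\<omega>. exp (of_real (Z \<omega>) + \<i> * of_real (Y \<omega>)))"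
    and "(\<integral>\<omega>. exp (of_real (Z \<omega>) + \<i> * of_real (Y \<omega>)) \<partial>P)
     = exp (of_real ((sqnorm \<psi> - (sqnorm \<phi>)) / 2) + \<i> * of_real (inner_prod \<psi> \<phi>))"
proof -
  obtain S c d where S: "finite S" "S \<subseteq> {0..T}" "\<psi> = step c S" "Z = step_int c S" "\<phi> = step d S" "Y
      = step_int d S"
    using elementary_common[OF assms] .
  define k where "k t = of_real (c t) + \<i> * complex_of_real (d t)" for t
  have Y: "of_real (Z \<omega>) + \<i> * of_real (Y \<omega>) = step_int k S \<omega>" for \<omega>
    by (simp add: S step_int_def k_def distrib_right sum.distrib sum_distrib_left mult.assoc)
  have ind: "complex_of_real (indicator A x) = indicator A x" for A and x :: real
    by (simp add: indicator_def)
  have \<phi>: "step k S u = of_real (\<psi> u) + \<i> * of_real (\<phi> u)" for u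
    by (simp only: S step_def k_def distrib_right sum.distrib sum_distrib_left mult.assoc of_real_sum
        of_real_mult ind)
  have sq: "(step k S u)\<^sup>2 = of_real ((\<psi> u)\<^sup>2 - (\<phi> u)\<^sup>2) + \<i> * of_real (2 * (\<psi> u * \<phi> u))" for u
    by (simp add: \<phi> power2_eq_square algebra_simps)
  have i: "integrable \<L> (\<lambda>u. (\<psi> u)\<^sup>2)" "integrable \<L> (\<lambda>u. (\<phi> u)\<^sup>2)" "integrable \<L> (\<lambda>u. \<psi> u * \<phi> u)"
    using elementary_square_integrable_time[OF assms(1)] elementary_square_integrable_time[OF assms(2)]
    by (auto intro: square_integrable_mult square_integrable_integrable)
  have "(\<integral>u. (step k S u)\<^sup>2 \<partial>\<L>) = (\<integral>u. of_real ((\<psi> u)\<^sup>2 - (\<phi> u)\<^sup>2) \<partial>\<L>)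
      + (\<integral>u. \<i> * complex_of_real (2 * (\<psi> u * \<phi> u)) \<partial>\<L>)"
    unfolding sq using i by (intro Bochner_Integration.integral_add integrable_mult_right integrable_of_real
        Bochner_Integration.integrable_diff) auto
  also have "\<dots> = of_real (sqnorm \<psi> - (sqnorm \<phi>)) + \<i> * of_real (2 * (inner_prod \<psi> \<phi>))"
    using i by (simp only: integral_mult_right_zero integral_complex_of_real Bochner_Integration.integral_diff)
  finally have e: "(\<integral>u. (step k S u)\<^sup>2 \<partial>\<L>) / 2 = of_real ((sqnorm \<psi> - (sqnorm \<phi>)) / 2)
      + \<i> * of_real (inner_prod \<psi> \<phi>)"
    by (simp add: add_divide_distrib)
  show "integrable P (\<lambda>\<omega>. exp (of_real (Z \<omega>) + \<i> * of_real (Y \<omega>)))"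
    unfolding Y using step_int_exp[OF S(1,2)] by blast
  show "(\<integral>\<omega>. exp (of_real (Z \<omega>) + \<i> * of_real (Y \<omega>)) \<partial>P)
     = exp (of_real ((sqnorm \<psi> - (sqnorm \<phi>)) / 2) + \<i> * of_real (inner_prod \<psi> \<phi>))"
    unfolding Y e[symmetric] using step_int_exp[OF S(1,2)] by blast
qed

lemma elementary_char:
  assumes "elementary \<phi> Y"
  shows "(\<integral>\<omega>. exp (\<i> * of_real (u * Y \<omega>)) \<partial>P) = exp (of_real (- (u\<^sup>2 * (sqnorm \<phi>) / 2)))"
proof -
  have "elementary (\<lambda>s. u * \<phi> s + 0 * 0) (\<lambda>\<omega>. u * Y \<omega> + 0 * 0)"
    by (rule elementary_lincomb[OF assms elementary_zero])
  then show ?thesis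
    using elementary_exp(2)[OF elementary_zero, of "\<lambda>s. u * \<phi> s" "\<lambda>\<omega>. u * Y \<omega>"]
        by (simp add: power_mult_distrib)
qed

lemma elementary_square_integrable:
  assumes "elementary \<phi> Y"
  shows "square_integrable P Y"
proof -
  have v: "0 \<le> (sqnorm \<phi>)" by simp
  have "distr P borel Y = distr std_normal_distribution borel (\<lambda>x. 0 + sqrt (sqnorm \<phi>) * x)"
    using elementary_char[OF assms]
    by (intro normal_lawI P.prob_space_axioms elementary_measurable[OF assms] v) simp_all
  from normal_law_second_moment[OF this elementary_measurable[OF assms] v]
  have "integrable P (\<lambda>\<omega>. (Y \<omega>)\<^sup>2)"
    using elementary_measurable[OF assms] by (intro integrableI_nonneg) auto
  then show ?thesis
    using elementary_measurable[OF assms] by (simp add: square_integrable_def)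
qed

text \<open>\<open>Y\<close> is a version of the Wiener integral of \<open>\<phi>\<close> over \<open>{0..T}\<close>. Integrals over \<open>{0..t}\<close> are those of
  \<open>indicator {0..t} u * \<phi> u\<close>, so that all of them live on one space and can be combined linearly.\<close>

definition wiener_pair :: "(real \<Rightarrow> real) \<Rightarrow> ('w \<Rightarrow> real) \<Rightarrow> bool" where
  "wiener_pair \<phi> Y \<longleftrightarrow> (\<exists>\<phi>s Ys. (\<forall>n. elementary (\<phi>s n) (Ys n)) \<and> L2_lim \<L> \<phi>s \<phi> \<and> L2_lim P Ys Y)"

lemma elementary_wiener_pair: "elementary \<phi> Y \<Longrightarrow> wiener_pair \<phi> Y"
  unfolding wiener_pair_def using elementary_square_integrable elementary_square_integrable_time
  by (intro exI[of _ "\<lambda>n. \<phi>"] exI[of _ "\<lambda>n. Y"]) (auto simp: L2_lim_def)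

lemma wiener_pair_lincomb:
  assumes "wiener_pair \<phi> Y" "wiener_pair \<psi> Z"
  shows "wiener_pair (\<lambda>u. a * \<phi> u + b * \<psi> u) (\<lambda>\<omega>. a * Y \<omega> + b * Z \<omega>)"
proof -
  from assms obtain \<phi>s Ys \<psi>s Zs where *:
    "\<And>n. elementary (\<phi>s n) (Ys n)" "L2_lim \<L> \<phi>s \<phi>" "L2_lim P Ys Y"
    "\<And>n. elementary (\<psi>s n) (Zs n)" "L2_lim \<L> \<psi>s \<psi>" "L2_lim P Zs Z"
    unfolding wiener_pair_def by blast
  then show ?thesis
    unfolding wiener_pair_def
    by (intro exI[of _ "\<lambda>n u. a * \<phi>s n u + b * \<psi>s n u"] exI[of _ "\<lambda>n \<omega>. a * Ys n \<omega> + b * Zs n \<omega>"])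
       (simp add: elementary_lincomb L2_lim_lincomb)
qed

lemma wiener_pair_square_integrable:
  assumes "wiener_pair \<phi> Y" shows "square_integrable \<L> \<phi>" "square_integrable P Y"
  using assms unfolding wiener_pair_def L2_lim_def by auto

lemma wiener_pair_measurable:
  assumes "wiener_pair \<phi> Y" shows "Y \<in> borel_measurable P" "\<phi> \<in> borel_measurable \<L>"
  using wiener_pair_square_integrable[OF assms] by (auto simp: square_integrable_def)

lemma wiener_pair_cong:
  assumes "wiener_pair \<phi> Y" "\<psi> \<in> borel_measurable \<L>" "AE u in \<L>. \<phi> u = \<psi> u"
  shows "wiener_pair \<psi> Y"
proof -
  obtain \<phi>s Ys where *: "\<And>n. elementary (\<phi>s n) (Ys n)" "L2_lim \<L> \<phi>s \<phi>" "L2_lim P Ys Y"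
    using assms unfolding wiener_pair_def by blast
  have m: "\<phi> \<in> borel_measurable \<L>" "\<phi>s n \<in> borel_measurable \<L>" for n
    using *(2) by (auto simp: L2_lim_def square_integrable_def)
  have "(\<integral>u. (\<phi>s n u - \<psi> u)\<^sup>2 \<partial>\<L>) = (\<integral>u. (\<phi>s n u - \<phi> u)\<^sup>2 \<partial>\<L>)" for n
    using m assms by (intro integral_cong_AE) auto
  moreover have "integrable \<L> (\<lambda>u. (\<psi> u)\<^sup>2) \<longleftrightarrow> integrable \<L> (\<lambda>u. (\<phi> u)\<^sup>2)"
    using m assms by (intro integrable_cong_AE) auto
  ultimately have "L2_lim \<L> \<phi>s \<psi>"
    using *(2) assms(2) by (simp add: L2_lim_def square_integrable_def)
  then show ?thesis using * unfolding wiener_pair_def by blast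
qed

text \<open>Passing to the limit in the formula for step functions: the exponential is Lipschitz on the imaginary
  axis and mean square convergence implies convergence in mean.\<close>

lemma wiener_pair_char:
  assumes "wiener_pair \<phi> Y"
  shows "(\<integral>\<omega>. exp (\<i> * of_real (u * Y \<omega>)) \<partial>P) = exp (of_real (- (u\<^sup>2 * (sqnorm \<phi>) / 2)))"
proof -
  obtain \<phi>s Ys where *: "\<And>n. elementary (\<phi>s n) (Ys n)" "L2_lim \<L> \<phi>s \<phi>" "L2_lim P Ys Y"
    using assms unfolding wiener_pair_def by blast
  let ?e = "\<lambda>X \<omega>. exp (\<i> * complex_of_real (u * X \<omega>))"
  have m[measurable]: "Y \<in> borel_measurable P" "Ys n \<in> borel_measurable P" for n
    using *(3) by (auto simp: L2_lim_def square_integrable_def)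
  have i: "integrable P (?e X)" if "X \<in> borel_measurable P" for X
    using that by (intro P.integrable_const_bound[where B=1]) auto
  have le: "norm ((\<integral>\<omega>. ?e (Ys n) \<omega> \<partial>P) - (\<integral>\<omega>. ?e Y \<omega> \<partial>P)) \<le> 2 * \<bar>u\<bar> * (\<integral>\<omega>. \<bar>Ys n \<omega> - Y \<omega>\<bar> \<partial>P)" for n
  proof -
    have "norm ((\<integral>\<omega>. ?e (Ys n) \<omega> \<partial>P) - (\<integral>\<omega>. ?e Y \<omega> \<partial>P)) = norm (\<integral>\<omega>. ?e (Ys n) \<omega> - ?e Y \<omega> \<partial>P)"
      using i m by simp
    also have "\<dots> \<le> (\<integral>\<omega>. 2 * \<bar>u\<bar> * \<bar>Ys n \<omega> - Y \<omega>\<bar> \<partial>P)"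
    proof (rule norm_integral_le)
      show "norm (?e (Ys n) \<omega> - ?e Y \<omega>) \<le> 2 * \<bar>u\<bar> * \<bar>Ys n \<omega> - Y \<omega>\<bar>" for \<omega>
      proof -
        have "norm (\<i> * of_real (u * Ys n \<omega>) - \<i> * of_real (u * Y \<omega>)) = \<bar>u\<bar> * \<bar>Ys n \<omega> - Y \<omega>\<bar>"
          by (simp add: norm_mult flip: right_diff_distrib of_real_diff abs_mult)
        then show ?thesis
          using norm_exp_diff_le[of "\<i> * of_real (u * Ys n \<omega>)" "\<i> * of_real (u * Y \<omega>)"] by simp
      qed
    qed (use i m L2_lim_imp_L1(2)[OF P.finite_measure_axioms *(3)] in auto)
    finally show ?thesis by simp
  qed
  have "(\<lambda>n. 2 * \<bar>u\<bar> * (\<integral>\<omega>. \<bar>Ys n \<omega> - Y \<omega>\<bar> \<partial>P)) \<longlonglongrightarrow> 0"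
    using L2_lim_imp_L1(1)[OF P.finite_measure_axioms *(3)] by (auto intro!: tendsto_eq_intros)
  then have "(\<lambda>n. (\<integral>\<omega>. ?e (Ys n) \<omega> \<partial>P) - (\<integral>\<omega>. ?e Y \<omega> \<partial>P)) \<longlonglongrightarrow> 0"
    by (rule Lim_null_comparison[rotated]) (use le in auto)
  then have "(\<lambda>n. \<integral>\<omega>. ?e (Ys n) \<omega> \<partial>P) \<longlonglongrightarrow> (\<integral>\<omega>. ?e Y \<omega> \<partial>P)"
    by (simp add: LIM_zero_iff)
  moreover have "(\<lambda>n. \<integral>\<omega>. ?e (Ys n) \<omega> \<partial>P) \<longlonglongrightarrow> exp (of_real (- (u\<^sup>2 * (sqnorm \<phi>) / 2)))"
    unfolding elementary_char[OF *(1)] by (intro tendsto_intros L2_lim_norm[OF *(2)]) auto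
  ultimately show ?thesis by (rule LIMSEQ_unique)
qed

lemma wiener_pair_law:
  assumes "wiener_pair \<phi> Y"
  shows "distr P borel Y = distr std_normal_distribution borel (\<lambda>x. 0 + sqrt (sqnorm \<phi>) * x)"
  using wiener_pair_char[OF assms] wiener_pair_measurable(1)[OF assms]
  by (intro normal_lawI P.prob_space_axioms) simp_all

lemma wiener_pair_isometry:
  assumes "wiener_pair \<phi> Y"
  shows "(\<integral>\<omega>. (Y \<omega>)\<^sup>2 \<partial>P) = (sqnorm \<phi>)"
proof -
  have "(\<integral>\<^sup>+\<omega>. ennreal ((Y \<omega>)\<^sup>2) \<partial>P) = ennreal (sqnorm \<phi>)"
    using normal_law_second_moment[OF wiener_pair_law[OF assms] wiener_pair_measurable(1)[OF assms]] by simp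
  then show ?thesis
    using wiener_pair_measurable(1)[OF assms] by (subst integral_eq_nn_integral) auto
qed

lemma wiener_pair_exp_moment:
  assumes "wiener_pair \<phi> Y"
  shows "integrable P (\<lambda>\<omega>. exp (a * Y \<omega>))"
    "(\<integral>\<omega>. exp (a * Y \<omega>) \<partial>P) = exp (a\<^sup>2 * (sqnorm \<phi>) / 2)"
proof -
  have m: "(\<lambda>\<omega>. exp (a * Y \<omega>)) \<in> borel_measurable P"
    using wiener_pair_measurable(1)[OF assms] by measurable
  have "(\<integral>\<^sup>+\<omega>. ennreal (exp (a * Y \<omega>)) \<partial>P) = ennreal (exp (a\<^sup>2 * (sqnorm \<phi>) / 2))"
    using normal_law_exp_moment[OF wiener_pair_law[OF assms] wiener_pair_measurable(1)[OF assms], of a] by simp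
  then show "integrable P (\<lambda>\<omega>. exp (a * Y \<omega>))"
    "(\<integral>\<omega>. exp (a * Y \<omega>) \<partial>P) = exp (a\<^sup>2 * (sqnorm \<phi>) / 2)"
    using m by (auto simp: integral_eq_nn_integral intro!: integrableI_nonneg)
qed

text \<open>The same limit with a real part in the exponent, where the exponential is not Lipschitz. The error is
  at most \<open>|difference of the exponents| * (exp (Zs n) + exp Z)\<close>; the first factor tends to \<open>0\<close> in mean
  square, the second one has bounded second moments because the \<open>Zs n\<close> and \<open>Z\<close> are normal with
  convergent variances.\<close>

lemma wiener_pair_exp:
  assumes \<psi>: "wiener_pair \<psi> Z" and \<phi>: "wiener_pair \<phi> Y"
  shows "integrable P (\<lambda>\<omega>. exp (of_real (Z \<omega>) + \<i> * of_real (Y \<omega>)))"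
    and "(\<integral>\<omega>. exp (of_real (Z \<omega>) + \<i> * of_real (Y \<omega>)) \<partial>P)
     = exp (of_real ((sqnorm \<psi> - (sqnorm \<phi>)) / 2) + \<i> * of_real (inner_prod \<psi> \<phi>))"
proof -
  have int: "integrable P (\<lambda>\<omega>. exp (of_real (Z \<omega>) + \<i> * of_real (Y \<omega>)))"
    if "wiener_pair \<psi> Z" "wiener_pair \<phi> Y" for \<psi> Z \<phi> Y
  proof (rule Bochner_Integration.integrable_bound)
    show "integrable P (\<lambda>\<omega>. exp (1 * Z \<omega>))" using wiener_pair_exp_moment(1)[OF that(1)] .
    show "(\<lambda>\<omega>. exp (of_real (Z \<omega>) + \<i> * complex_of_real (Y \<omega>))) \<in> borel_measurable P"
      using that[THEN wiener_pair_measurable(1)] by measurable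
  qed auto
  then show "integrable P (\<lambda>\<omega>. exp (of_real (Z \<omega>) + \<i> * of_real (Y \<omega>)))" using assms by blast
  obtain \<phi>s Ys \<psi>s Zs where *:
    "\<And>n. elementary (\<phi>s n) (Ys n)" "L2_lim \<L> \<phi>s \<phi>" "L2_lim P Ys Y"
    "\<And>n. elementary (\<psi>s n) (Zs n)" "L2_lim \<L> \<psi>s \<psi>" "L2_lim P Zs Z"
    using assms unfolding wiener_pair_def by blast
  define D where "D n \<omega> = exp (of_real (Zs n \<omega>) + \<i> * complex_of_real (Ys n \<omega>))" for n \<omega>
  define D' where "D' \<omega> = exp (of_real (Z \<omega>) + \<i> * complex_of_real (Y \<omega>))" for \<omega>
  define a where "a n = (\<integral>\<omega>. (Zs n \<omega> - Z \<omega>)\<^sup>2 \<partial>P) + (\<integral>\<omega>. (Ys n \<omega> - Y \<omega>)\<^sup>2 \<partial>P)" for n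
  define b where "b n = (\<integral>\<omega>. exp (2 * Zs n \<omega>) \<partial>P) + (\<integral>\<omega>. exp (2 * Z \<omega>) \<partial>P)" for n
  have iD: "integrable P (D n)" "integrable P D'" for n
    unfolding D_def D'_def using int elementary_wiener_pair * assms by blast+
  have iZ: "integrable P (\<lambda>\<omega>. exp (2 * Zs n \<omega>))" "integrable P (\<lambda>\<omega>. exp (2 * Z \<omega>))"
    "integrable P (\<lambda>\<omega>. (Zs n \<omega> - Z \<omega>)\<^sup>2)" "integrable P (\<lambda>\<omega>. (Ys n \<omega> - Y \<omega>)\<^sup>2)" for n
    using wiener_pair_exp_moment(1)[OF elementary_wiener_pair[OF *(4)]] wiener_pair_exp_moment(1)[OF \<psi>] *(3,6)
    by (auto intro!: square_integrable_diff_square simp: L2_lim_def)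
  have a_lim: "a \<longlonglongrightarrow> 0"
    using *(3,6) unfolding a_def L2_lim_def by (auto intro!: tendsto_eq_intros)
  have b_lim: "b \<longlonglongrightarrow> exp (2 * (sqnorm \<psi>)) + exp (2 * (sqnorm \<psi>))"
    unfolding b_def wiener_pair_exp_moment(2)[OF \<psi>] wiener_pair_exp_moment(2)[OF elementary_wiener_pair[OF
        *(4)]]
    using L2_lim_norm[OF *(5)] by (auto intro!: tendsto_eq_intros)
  have bound: "norm ((\<integral>\<omega>. D n \<omega> \<partial>P) - (\<integral>\<omega>. D' \<omega> \<partial>P)) \<le> a n / \<eta> + \<eta> * b n" if \<eta>: "0 < \<eta>" for \<eta> n
  proof -
    have "norm ((\<integral>\<omega>. D n \<omega> \<partial>P) - (\<integral>\<omega>. D' \<omega> \<partial>P)) = norm (\<integral>\<omega>. D n \<omega> - D' \<omega> \<partial>P)"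
      using iD by simp
    also have "\<dots> \<le> (\<integral>\<omega>. ((Zs n \<omega> - Z \<omega>)\<^sup>2 + (Ys n \<omega> - Y \<omega>)\<^sup>2) / \<eta> + \<eta> * (exp (2 * Zs n \<omega>) + exp (2 * Z \<omega>)) \<partial>P)"
    proof (rule norm_integral_le)
      show "norm (D n \<omega> - D' \<omega>) \<le> ((Zs n \<omega> - Z \<omega>)\<^sup>2 + (Ys n \<omega> - Y \<omega>)\<^sup>2) / \<eta> + \<eta> * (exp (2 * Zs n \<omega>)
          + exp (2 * Z \<omega>))" for \<omega>
      proof -
        define d where "d = norm ((of_real (Zs n \<omega>) + \<i> * complex_of_real (Ys n \<omega>)) - (of_real (Z \<omega>)
            + \<i> * complex_of_real (Y \<omega>)))"
        define e where "e = exp (Zs n \<omega>) + exp (Z \<omega>)"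
        have d2: "d\<^sup>2 = (Zs n \<omega> - Z \<omega>)\<^sup>2 + (Ys n \<omega> - Y \<omega>)\<^sup>2"
          by (simp add: d_def cmod_def)
        have "e\<^sup>2 \<le> 2 * (exp (Zs n \<omega>))\<^sup>2 + 2 * (exp (Z \<omega>))\<^sup>2"
          unfolding e_def by (rule sum_square_le)
        then have e2: "e\<^sup>2 \<le> 2 * (exp (2 * Zs n \<omega>) + exp (2 * Z \<omega>))"
          by (simp add: exp_double)
        have "2 * (d / sqrt \<eta>) * (sqrt \<eta> * e) \<le> (d / sqrt \<eta>)\<^sup>2 + (sqrt \<eta> * e)\<^sup>2"
          by (rule sum_squares_bound)
        then have "2 * (d * e) \<le> d\<^sup>2 / \<eta> + \<eta> * e\<^sup>2"
          using \<eta> by (simp add: power_divide power_mult_distrib)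
        moreover have "\<eta> * e\<^sup>2 \<le> 2 * (\<eta> * (exp (2 * Zs n \<omega>) + exp (2 * Z \<omega>)))"
          using mult_left_mono[OF e2, of \<eta>] \<eta> by (simp add: mult.left_commute)
        moreover have "0 \<le> d\<^sup>2 / \<eta>" using \<eta> by simp
        ultimately have "d * e \<le> d\<^sup>2 / \<eta> + \<eta> * (exp (2 * Zs n \<omega>) + exp (2 * Z \<omega>))"
          by linarith
        moreover have "norm (D n \<omega> - D' \<omega>) \<le> d * e"
          unfolding D_def D'_def d_def e_def
          using norm_exp_diff_le[of "of_real (Zs n \<omega>) + \<i> * complex_of_real (Ys n \<omega>)" "of_real (Z \<omega>)
              + \<i> * complex_of_real (Y \<omega>)"] by simp
        ultimately show ?thesis unfolding d2 by linarith
      qed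
    qed (use iD iZ in auto)
    also have "\<dots> = a n / \<eta> + \<eta> * b n"
      using iZ by (simp add: a_def b_def)
    finally show ?thesis .
  qed
  have "(\<lambda>n. \<integral>\<omega>. D n \<omega> \<partial>P) \<longlonglongrightarrow> (\<integral>\<omega>. D' \<omega> \<partial>P)"
  proof (rule LIMSEQ_I)
    fix e :: real assume e: "0 < e"
    define B where "B = exp (2 * (sqnorm \<psi>)) + exp (2 * (sqnorm \<psi>))"
    have B: "0 < B" by (simp add: B_def add_pos_pos)
    define \<eta> where "\<eta> = e / (2 * B)"
    have \<eta>: "0 < \<eta>" using e B by (simp add: \<eta>_def)
    have "(\<lambda>n. a n / \<eta> + \<eta> * b n) \<longlonglongrightarrow> 0 / \<eta> + \<eta> * B"
      unfolding B_def by (intro tendsto_intros a_lim b_lim) (use \<eta> in auto)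
    moreover have "0 / \<eta> + \<eta> * B < e" using B e by (simp add: \<eta>_def)
    ultimately have "\<forall>\<^sub>F n in sequentially. a n / \<eta> + \<eta> * b n < e"
      by (rule order_tendstoD)
    then have "\<forall>\<^sub>F n in sequentially. norm ((\<integral>\<omega>. D n \<omega> \<partial>P) - (\<integral>\<omega>. D' \<omega> \<partial>P)) < e"
      by eventually_elim (use bound[OF \<eta>] in \<open>auto intro: le_less_trans\<close>)
    then show "\<exists>no. \<forall>n\<ge>no. norm ((\<integral>\<omega>. D n \<omega> \<partial>P) - (\<integral>\<omega>. D' \<omega> \<partial>P)) < e"
      by (simp add: eventually_sequentially)
  qed
  moreover have "(\<lambda>n. \<integral>\<omega>. D n \<omega> \<partial>P) \<longlonglongrightarrow> exp (of_real ((sqnorm \<psi> - (sqnorm \<phi>)) / 2)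
      + \<i> * of_real (inner_prod \<psi> \<phi>))"
    unfolding D_def elementary_exp(2)[OF *(4) *(1)]
    by (intro tendsto_intros L2_lim_norm[OF *(2)] L2_lim_norm[OF *(5)] L2_lim_inner[OF *(5) *(2)]) auto
  ultimately show "(\<integral>\<omega>. exp (of_real (Z \<omega>) + \<i> * of_real (Y \<omega>)) \<partial>P)
     = exp (of_real ((sqnorm \<psi> - (sqnorm \<phi>)) / 2) + \<i> * of_real (inner_prod \<psi> \<phi>))"
    unfolding D'_def[symmetric] by (rule LIMSEQ_unique)
qed

end

section \<open>Existence of Wiener integrals\<close>

definition partition_in :: "real \<Rightarrow> nat \<Rightarrow> (nat \<Rightarrow> real) \<Rightarrow> bool" where
  "partition_in t m p \<longleftrightarrow> 0 \<le> p 0 \<and> (\<forall>i<m. p i \<le> p (Suc i)) \<and> p m \<le> t"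

lemma partition_in_mono:
  assumes "partition_in t m p" "i \<le> j" "j \<le> m"
  shows "p i \<le> p j"
  using assms(2,3)
proof (induction rule: dec_induct)
  case (step n)
  then have "p i \<le> p n" "p n \<le> p (Suc n)" using assms(1) by (auto simp: partition_in_def)
  then show ?case by (rule order_trans)
qed simp

lemma partition_in_bounds:
  assumes "partition_in t m p" "i \<le> m"
  shows "0 \<le> p i" "p i \<le> t"
  using partition_in_mono[OF assms(1), of 0 i] partition_in_mono[OF assms(1), of i m] assms
  by (auto simp: partition_in_def)

lemma step_fun_eq:
  assumes p: "partition_in t m p" and i: "i < m" "p i < u" "u \<le> p (Suc i)"
  shows "step_fun m p c u = c i"
proof -
  have "indicator {p j<..p (Suc j)} u = (0::real)" if "j < m" "j \<noteq> i" for j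
  proof (cases "j < i")
    case True
    then have "p (Suc j) \<le> p i" using i p by (intro partition_in_mono) auto
    then show ?thesis using i by auto
  next
    case False
    then have "p (Suc i) \<le> p j" using that i p by (intro partition_in_mono) auto
    then show ?thesis using i by auto
  qed
  then have "step_fun m p c u = (\<Sum>j<m. if j = i then c i else 0)"
    unfolding step_fun_def using i by (intro sum.cong) auto
  then show ?thesis using i by simp
qed

lemma step_fun_outside:
  assumes "partition_in t m p" "u \<le> 0 \<or> t < u"
  shows "step_fun m p c u = 0"
  unfolding step_fun_def
proof (intro sum.neutral ballI)
  fix i assume i: "i \<in> {..<m}"
  then show "c i * indicator {p i<..p (Suc i)} u = 0"
    using partition_in_bounds[OF assms(1), of i] partition_in_bounds[OF assms(1), of "Suc i"] assms(2) by auto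
qed

lemma uniform_partition:
  assumes "0 \<le> t"
  shows "partition_in t n (\<lambda>i. real i * t / real n)"
  using assms by (cases "n = 0") (auto simp: partition_in_def field_simps)

lemma uniform_partition_cover:
  assumes u: "u \<in> {0<..t}" and n: "0 < n"
  obtains i where "i < n" "real i * t / real n < u" "u \<le> real (Suc i) * t / real n"
proof
  define i where "i = nat (\<lceil>u * n / t\<rceil> - 1)"
  have t0: "0 < t" using u by auto
  have "0 < u * n / t" "u * n / t \<le> n" using u n t0 by (auto simp: field_simps)
  then have c: "1 \<le> \<lceil>u * n / t\<rceil>" "\<lceil>u * n / t\<rceil> \<le> int n"
    by linarith+
  then have ri: "real i = real_of_int \<lceil>u * n / t\<rceil> - 1"
    unfolding i_def by linarith
  show "i < n" unfolding i_def using c n by linarith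
  have "real i < u * n / t" "u * n / t \<le> real (Suc i)"
    using ri by linarith+
  then show "real i * t / real n < u" "u \<le> real (Suc i) * t / real n"
    using t0 n by (auto simp: field_simps)
qed

definition step_approximable :: "real \<Rightarrow> (real \<Rightarrow> real) \<Rightarrow> bool" where
  "step_approximable t f \<longleftrightarrow> (\<forall>e>0. \<exists>m p c. partition_in t m p \<and>
     (\<integral>u. (step_fun m p c u - f u)\<^sup>2 \<partial>lebesgue_on {0..t}) < e)"

lemma step_fun_square_integrable: "square_integrable (lebesgue_on {0..t}) (step_fun m p c)"
proof -
  interpret finite_measure "lebesgue_on {0..t}"
    by (rule finite_measure_lebesgue_on) simp
  have "step_fun m p c \<in> borel_measurable borel"
    unfolding step_fun_def by measurable
  then have m: "step_fun m p c \<in> borel_measurable (lebesgue_on {0..t})"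
    by (intro measurable_restrict_space1 measurable_completion) simp
  have b: "\<bar>step_fun m p c u\<bar> \<le> (\<Sum>i<m. \<bar>c i\<bar>)" for u
    unfolding step_fun_def
    by (rule order_trans[OF sum_abs]) (auto intro!: sum_mono simp: indicator_def)
  have "integrable (lebesgue_on {0..t}) (\<lambda>u. (step_fun m p c u)\<^sup>2)"
    using m power_mono[OF b abs_ge_zero, where n=2]
    by (intro integrable_const_bound[where B="(\<Sum>i<m. \<bar>c i\<bar>)\<^sup>2"] AE_I2) auto
  then show ?thesis using m by (simp add: square_integrable_def)
qed

lemma step_approximable_continuous:
  assumes t: "0 \<le> t" and f: "continuous_on {0..t} f" and sf: "square_integrable (lebesgue_on {0..t}) f"
  shows "step_approximable t f"
  unfolding step_approximable_def
proof (intro allI impI)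
  fix e :: real assume e: "0 < e"
  interpret finite_measure "lebesgue_on {0..t}"
    by (rule finite_measure_lebesgue_on) simp
  define \<eta> where "\<eta> = sqrt (e / (t + 1))"
  have \<eta>: "0 < \<eta>" "\<eta>\<^sup>2 * t < e" using e t by (auto simp: \<eta>_def field_simps)
  have "uniformly_continuous_on {0..t} f"
    using f by (intro compact_uniformly_continuous) auto
  then obtain d where d: "0 < d" "\<And>x y. x \<in> {0..t} \<Longrightarrow> y \<in> {0..t} \<Longrightarrow> dist x y < d \<Longrightarrow> dist (f x) (f y) < \<eta>"
    using \<eta> unfolding uniformly_continuous_on_def by metis
  obtain n :: nat where n: "t / d < real n" using reals_Archimedean2 by blast
  then have n0: "0 < n" using t d by (cases n) (auto simp: divide_less_0_iff)
  have nd: "t / real n < d" using n n0 d by (simp add: field_simps)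
  define p where "p i = real i * t / real n" for i
  have p: "partition_in t n p"
    using uniform_partition[OF t] by (simp add: p_def[abs_def])
  define s where "s = step_fun n p (\<lambda>i. f (p (Suc i)))"
  have close: "\<bar>s u - f u\<bar> < \<eta>" if u: "u \<in> {0<..t}" for u
  proof -
    obtain i where i: "i < n" and pi: "p i < u" "u \<le> p (Suc i)"
      using uniform_partition_cover[OF u n0] unfolding p_def by blast
    have "s u = f (p (Suc i))"
      unfolding s_def by (rule step_fun_eq[OF p i pi])
    moreover have "dist (f (p (Suc i))) (f u) < \<eta>"
    proof (rule d(2))
      have "p (Suc i) - p i = t / n" using n0 by (simp add: p_def field_simps)
      then show "dist (p (Suc i)) u < d" using pi nd by (simp add: dist_real_def)
      show "p (Suc i) \<in> {0..t}" using partition_in_bounds[OF p, of "Suc i"] i by simp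
    qed (use u in auto)
    ultimately show ?thesis by (simp add: dist_real_def)
  qed
  have ae: "AE u in lebesgue_on {0..t}. u \<noteq> 0"
  proof -
    have "AE u in lebesgue. u \<noteq> (0::real)"
      by (rule AE_completion) (rule AE_lborel_singleton)
    then show ?thesis by (subst AE_restrict_space_iff) auto
  qed
  have "(\<integral>u. (s u - f u)\<^sup>2 \<partial>lebesgue_on {0..t}) \<le> (\<integral>u. \<eta>\<^sup>2 \<partial>lebesgue_on {0..t})"
  proof (rule integral_mono_AE)
    show "integrable (lebesgue_on {0..t}) (\<lambda>u. (s u - f u)\<^sup>2)"
      unfolding s_def by (intro square_integrable_diff_square step_fun_square_integrable sf)
    show "AE u in lebesgue_on {0..t}. (s u - f u)\<^sup>2 \<le> \<eta>\<^sup>2"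
      using ae
    proof (rule AE_mp, intro AE_I2 impI)
      fix u assume "u \<in> space (lebesgue_on {0..t})" "u \<noteq> 0"
      then have "\<bar>s u - f u\<bar> < \<eta>" using close by auto
      then show "(s u - f u)\<^sup>2 \<le> \<eta>\<^sup>2" using \<eta> by (intro power2_le_iff_abs_le[THEN iffD2]) auto
    qed
  qed auto
  also have "\<dots> = \<eta>\<^sup>2 * t" using t by (simp add: measure_restrict_space)
  also have "\<dots> < e" by fact
  finally show "\<exists>m p c. partition_in t m p \<and>
     (\<integral>u. (step_fun m p c u - f u)\<^sup>2 \<partial>lebesgue_on {0..t}) < e"
    using p unfolding s_def by blast
qed

lemma step_approximable_L2_lim:
  assumes L: "L2_lim (lebesgue_on {0..t}) fs f" and s: "\<And>n. step_approximable t (fs n)"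
  shows "step_approximable t f"
  unfolding step_approximable_def
proof (intro allI impI)
  fix e :: real assume e: "0 < e"
  note l = L[unfolded L2_lim_def]
  have "\<forall>\<^sub>F n in sequentially. (\<integral>u. (fs n u - f u)\<^sup>2 \<partial>lebesgue_on {0..t}) < e / 4"
    using l e by (intro order_tendstoD(2)) auto
  then obtain n where n: "(\<integral>u. (fs n u - f u)\<^sup>2 \<partial>lebesgue_on {0..t}) < e / 4"
    by (auto simp: eventually_sequentially)
  obtain m p c where p: "partition_in t m p"
     "(\<integral>u. (step_fun m p c u - fs n u)\<^sup>2 \<partial>lebesgue_on {0..t}) < e / 4"
    using s[of n] e unfolding step_approximable_def by (meson divide_pos_pos zero_less_numeral)
  have i: "integrable (lebesgue_on {0..t}) (\<lambda>u. (step_fun m p c u - fs n u)\<^sup>2)"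
      "integrable (lebesgue_on {0..t}) (\<lambda>u. (fs n u - f u)\<^sup>2)"
      "integrable (lebesgue_on {0..t}) (\<lambda>u. (step_fun m p c u - f u)\<^sup>2)"
    using l by (auto intro!: square_integrable_diff_square step_fun_square_integrable)
  have "(\<integral>u. (step_fun m p c u - f u)\<^sup>2 \<partial>lebesgue_on {0..t})
    \<le> (\<integral>u. 2 * (step_fun m p c u - fs n u)\<^sup>2 + 2 * (fs n u - f u)\<^sup>2 \<partial>lebesgue_on {0..t})"
    using i sum_square_le[of "step_fun m p c u - fs n u" "fs n u - f u" for u]
    by (intro integral_mono) auto
  also have "\<dots> = 2 * (\<integral>u. (step_fun m p c u - fs n u)\<^sup>2 \<partial>lebesgue_on {0..t})
      + 2 * (\<integral>u. (fs n u - f u)\<^sup>2 \<partial>lebesgue_on {0..t})"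
    using i by simp
  also have "\<dots> < e" using n p by linarith
  finally show "\<exists>m p c. partition_in t m p \<and>
     (\<integral>u. (step_fun m p c u - f u)\<^sup>2 \<partial>lebesgue_on {0..t}) < e"
    using p by blast
qed

lemma L2_lim_dominated:
  assumes fs: "\<And>n. fs n \<in> borel_measurable M" and f: "f \<in> borel_measurable M"
    and lim: "AE x in M. (\<lambda>n. fs n x) \<longlonglongrightarrow> f x"
    and sf: "square_integrable M f"
    and w: "integrable M w" "\<And>n x. x \<in> space M \<Longrightarrow> (fs n x - f x)\<^sup>2 \<le> w x"
  shows "L2_lim M fs f"
proof -
  have i: "integrable M (\<lambda>x. (fs n x - f x)\<^sup>2)" for n
    by (rule Bochner_Integration.integrable_bound[OF w(1)])
       (use fs f w(2) in \<open>auto intro!: AE_I2 order_trans[OF _ abs_ge_self]\<close>)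
  then have "square_integrable M (\<lambda>x. fs n x - f x)" for n
    using fs f by (simp add: square_integrable_def)
  then have "square_integrable M (fs n)" for n
    using square_integrable_lincomb[OF _ sf, of "\<lambda>x. fs n x - f x" 1 1] by simp
  moreover have "(\<lambda>n. \<integral>x. (fs n x - f x)\<^sup>2 \<partial>M) \<longlonglongrightarrow> (\<integral>x. 0 \<partial>M)"
  proof (rule integral_dominated_convergence[OF _ _ w(1)])
    show "AE x in M. (\<lambda>n. (fs n x - f x)\<^sup>2) \<longlonglongrightarrow> 0"
      using lim by eventually_elim (auto intro!: tendsto_eq_intros)
    show "AE x in M. norm ((fs n x - f x)\<^sup>2) \<le> w x" for n
      using w(2) by auto
  qed (use fs f in auto)
  ultimately show ?thesis using sf by (simp add: L2_lim_def)
qed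

definition clamp_real :: "real \<Rightarrow> real \<Rightarrow> real" where "clamp_real B x = max (- B) (min B x)"

text \<open>A Lebesgue measurable function is almost everywhere a limit of continuous functions; truncation
  makes the convergence dominated.\<close>

lemma step_approximable_bounded:
  assumes t: "0 \<le> t" and m: "f \<in> borel_measurable (lebesgue_on {0..t})" and B: "\<And>x. \<bar>f x\<bar> \<le> B"
  shows "step_approximable t f"
proof -
  interpret finite_measure "lebesgue_on {0..t}"
    by (rule finite_measure_lebesgue_on) simp
  have B0: "0 \<le> B" using B[of 0] by linarith
  have "f measurable_on {0..t}"
    using m by (subst measurable_on_iff_borel_measurable) auto
  then obtain N g where N: "negligible N" and g: "\<And>n. continuous_on UNIV (g n)"
      "\<And>x. x \<notin> N \<Longrightarrow> (\<lambda>n. g n x) \<longlonglongrightarrow> (if x \<in> {0..t} then f x else 0)"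
    unfolding measurable_on_def by blast
  define h where "h n x = clamp_real B (g n x)" for n and x :: real
  have hB: "\<bar>h n x\<bar> \<le> B" for n x using B0 by (auto simp: h_def clamp_real_def)
  have hc: "continuous_on UNIV (h n)" for n
    unfolding h_def clamp_real_def using g by (intro continuous_intros) auto
  have hm: "h n \<in> borel_measurable (lebesgue_on {0..t})" for n
    by (intro measurable_restrict_space1 measurable_completion)
       (use borel_measurable_continuous_onI[OF hc[of n]] in simp)
  have sq: "square_integrable (lebesgue_on {0..t}) k" if "k \<in> borel_measurable (lebesgue_on {0..t})" "\<And>x. \<bar>k
      x\<bar> \<le> B" for k
  proof -
    have "integrable (lebesgue_on {0..t}) (\<lambda>u. (k u)\<^sup>2)"
      using that(1) power_mono[OF that(2) abs_ge_zero, where n=2]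
      by (intro integrable_const_bound[where B="B\<^sup>2"] AE_I2) auto
    then show ?thesis using that(1) by (simp add: square_integrable_def)
  qed
  have "L2_lim (lebesgue_on {0..t}) h f"
  proof (rule L2_lim_dominated[where w="\<lambda>_. (2 * B)\<^sup>2"])
    have "AE x in lebesgue. x \<notin> N"
      using N by (intro AE_not_in) (simp add: negligible_iff_null_sets)
    then have "AE x in lebesgue_on {0..t}. x \<notin> N"
      by (subst AE_restrict_space_iff) auto
    then show "AE x in lebesgue_on {0..t}. (\<lambda>n. h n x) \<longlonglongrightarrow> f x"
    proof (rule AE_mp, intro AE_I2 impI)
      fix x assume "x \<in> space (lebesgue_on {0..t})" "x \<notin> N"
      then have "(\<lambda>n. g n x) \<longlonglongrightarrow> f x" using g(2)[of x] by simp
      then have "(\<lambda>n. h n x) \<longlonglongrightarrow> max (- B) (min B (f x))"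
        unfolding h_def clamp_real_def by (intro tendsto_intros)
      then show "(\<lambda>n. h n x) \<longlonglongrightarrow> f x" using B[of x] by (simp add: max_def min_def abs_le_iff split: if_splits)
    qed
    show "(h n x - f x)\<^sup>2 \<le> (2 * B)\<^sup>2" for n x
      using hB[of n x] B[of x] B0 by (intro power2_le_iff_abs_le[THEN iffD2]) auto
  qed (use hm m sq B in auto)
  then show ?thesis
    by (rule step_approximable_L2_lim)
       (intro step_approximable_continuous t continuous_on_subset[OF hc] sq hm hB subset_UNIV)
qed

lemma step_functions_dense:
  assumes t: "0 \<le> t" and f: "square_integrable (lebesgue_on {0..t}) f"
  shows "step_approximable t f"
proof -
  have m: "f \<in> borel_measurable (lebesgue_on {0..t})" and i: "integrable (lebesgue_on {0..t}) (\<lambda>x. (f x)\<^sup>2)"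
    using f by (auto simp: square_integrable_def)
  have cm: "(\<lambda>x. clamp_real (real n) (f x)) \<in> borel_measurable (lebesgue_on {0..t})" for n
    unfolding clamp_real_def using m by measurable
  have "L2_lim (lebesgue_on {0..t}) (\<lambda>n x. clamp_real (real n) (f x)) f"
  proof (rule L2_lim_dominated[OF cm m _ f i])
    show "AE x in lebesgue_on {0..t}. (\<lambda>n. clamp_real (real n) (f x)) \<longlonglongrightarrow> f x"
    proof (intro AE_I2 tendsto_eventually)
      fix x
      obtain n0 where "\<bar>f x\<bar> \<le> real n0" using real_arch_simple by blast
      then have "clamp_real (real n) (f x) = f x" if "n \<ge> n0" for n
        using that by (auto simp: clamp_real_def)
      then show "\<forall>\<^sub>F n in sequentially. clamp_real (real n) (f x) = f x"
        by (auto simp: eventually_sequentially)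
    qed
    show "(clamp_real (real n) (f x) - f x)\<^sup>2 \<le> (f x)\<^sup>2" for n x
      by (auto simp: clamp_real_def abs_le_square_iff[symmetric])
  qed
  moreover have "step_approximable t (\<lambda>x. clamp_real (real n) (f x))" for n
    by (rule step_approximable_bounded[OF t cm, where B="real n"]) (auto simp: clamp_real_def)
  ultimately show ?thesis by (rule step_approximable_L2_lim)
qed

lemma is_wiener_integralD:
  assumes "is_wiener_integral P F W t f Y"
  shows "\<exists>m p c. (\<forall>n. partition_in t (m n) (p n)) \<and>
    (\<lambda>n. \<integral>\<^sup>+u. ennreal ((step_fun (m n) (p n) (c n) u - f u)\<^sup>2) \<partial>lebesgue_on {0..t}) \<longlonglongrightarrow> 0 \<and>
    (\<lambda>n. \<integral>\<^sup>+\<omega>. ennreal ((step_integral W (m n) (p n) (c n) \<omega> - Y \<omega>)\<^sup>2) \<partial>P) \<longlonglongrightarrow> 0"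
  using assms[unfolded is_wiener_integral_def, THEN conjunct2] by (simp only: partition_in_def)

lemma is_wiener_integralI:
  assumes "Y \<in> borel_measurable (F t)" "\<forall>n. partition_in t (m n) (p n)"
    "(\<lambda>n. \<integral>\<^sup>+u. ennreal ((step_fun (m n) (p n) (c n) u - f u)\<^sup>2) \<partial>lebesgue_on {0..t}) \<longlonglongrightarrow> 0"
    "(\<lambda>n. \<integral>\<^sup>+\<omega>. ennreal ((step_integral W (m n) (p n) (c n) \<omega> - Y \<omega>)\<^sup>2) \<partial>P) \<longlonglongrightarrow> 0"
  shows "is_wiener_integral P F W t f Y"
  unfolding is_wiener_integral_def
  by (intro conjI assms(1) exI[of _ m] exI[of _ p] exI[of _ c] assms(3,4))
     (use assms(2) in \<open>simp add: partition_in_def\<close>)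

context wiener begin

lemma lebesgue_on_initial:
  assumes "t \<in> {0..T}"
  shows "lebesgue_on {0..t} = restrict_space \<L> {0..t}" "{0..t} \<inter> space \<L> \<in> sets \<L>"
proof -
  have "{0..T} \<inter> {0..t} = {0..t}" using assms by auto
  then show "lebesgue_on {0..t} = restrict_space \<L> {0..t}"
    by (subst restrict_restrict_space) (simp_all del: Int_atLeastAtMost)
  show "{0..t} \<inter> space \<L> \<in> sets \<L>"
    using assms by (intro sets_restrict_space_iff[THEN iffD2]) auto
qed

lemma integral_initial:
  assumes "t \<in> {0..T}"
  shows "(\<integral>u. h u \<partial>lebesgue_on {0..t}) = (\<integral>u. indicator {0..t} u * (h u :: real) \<partial>\<L>)"
  unfolding lebesgue_on_initial(1)[OF assms]
  by (subst integral_restrict_space[OF lebesgue_on_initial(2)[OF assms]]) simp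

lemma integrable_initial:
  assumes "t \<in> {0..T}"
  shows "integrable (lebesgue_on {0..t}) h \<longleftrightarrow> integrable \<L> (\<lambda>u. indicator {0..t} u * (h u :: real))"
  unfolding lebesgue_on_initial(1)[OF assms]
  by (subst integrable_restrict_space[OF lebesgue_on_initial(2)[OF assms]]) simp

lemma measurable_initial:
  assumes "t \<in> {0..T}"
  shows "h \<in> borel_measurable (lebesgue_on {0..t}) \<longleftrightarrow> (\<lambda>u. indicator {0..t} u
      * (h u :: real)) \<in> borel_measurable \<L>"
  unfolding lebesgue_on_initial(1)[OF assms]
  by (subst borel_measurable_restrict_space_iff[OF lebesgue_on_initial(2)[OF assms]]) simp

lemma indicator_square: "(indicator A u * (x::real))\<^sup>2 = indicator A u * x\<^sup>2"
  by (simp add: indicator_def)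

lemma square_integrable_initial:
  assumes "t \<in> {0..T}"
  shows "square_integrable (lebesgue_on {0..t}) h \<longleftrightarrow> square_integrable \<L> (\<lambda>u. indicator {0..t} u * h u)"
  unfolding square_integrable_def integrable_initial[OF assms] measurable_initial[OF assms] indicator_square
      by simp

lemma square_integrable_initial_mono:
  assumes t: "t \<in> {0..T}" and h: "square_integrable \<L> h"
  shows "square_integrable (lebesgue_on {0..t}) h"
proof -
  have "h \<in> borel_measurable (restrict_space \<L> {0..t})"
    by (rule measurable_restrict_space1) (use h in \<open>simp add: square_integrable_def\<close>)
  moreover have "integrable (lebesgue_on {0..t}) (\<lambda>u. (h u)\<^sup>2)"
  proof -
    have "{0..t} \<in> sets \<L>"
      using t by (intro sets_restrict_space_iff[THEN iffD2]) auto
    then show ?thesis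
      using h integrable_real_mult_indicator[of "{0..t}" \<L> "\<lambda>u. (h u)\<^sup>2"]
      by (simp add: integrable_initial[OF t] square_integrable_def mult.commute)
  qed
  ultimately show ?thesis
    unfolding lebesgue_on_initial(1)[OF t] square_integrable_def by simp
qed

lemma elementary_step_fun:
  assumes t: "t \<in> {0..T}" and p: "partition_in t m p"
  shows "elementary (step_fun m p c) (step_integral W m p c)"
proof -
  have "elementary (\<lambda>u. c i * indicator {p i<..p (Suc i)} u) (\<lambda>\<omega>. c i * (W (p (Suc i)) \<omega>
      - W (p i) \<omega>))" if i: "i < m" for i
  proof -
    have b: "0 \<le> p i" "p i \<le> p (Suc i)" "p (Suc i) \<le> t"
      using partition_in_bounds[OF p, of i] partition_in_bounds[OF p, of "Suc i"] partition_in_mono[OF p, of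
          i "Suc i"] i by auto
    have "elementary (\<lambda>u. c i * indicator {0<..p (Suc i)} u + (- c i) * indicator {0<..p i} u)
       (\<lambda>\<omega>. c i * W (p (Suc i)) \<omega> + (- c i) * W (p i) \<omega>)"
      using b t by (intro elementary_lincomb elementary_interval) auto
    moreover have "(\<lambda>u. c i * indicator {0<..p (Suc i)} u + (- c i) * indicator {0<..p i} u)
        = (\<lambda>u. c i * indicator {p i<..p (Suc i)} u)"
      using b by (auto simp: fun_eq_iff indicator_def)
    ultimately show ?thesis by (simp add: right_diff_distrib)
  qed
  then have "elementary (\<lambda>u. \<Sum>i<m. c i * indicator {p i<..p (Suc i)} u) (\<lambda>\<omega>. \<Sum>i<m. c i * (W (p (Suc i)) \<omega>
      - W (p i) \<omega>))"
    by (intro elementary_sum) auto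
  then show ?thesis
    by (simp add: step_fun_def[abs_def] step_integral_def[abs_def])
qed

lemma step_fun_initial:
  assumes p: "partition_in t m p"
  shows "indicator {0..t} u * (step_fun m p c u - f u) = step_fun m p c u - indicator {0..t} u * f u"
  using step_fun_outside[OF p, of u c] by (auto simp: indicator_def)

lemma is_wiener_integral_pair:
  assumes t: "t \<in> {0..T}" and f: "square_integrable \<L> f" and Y: "is_wiener_integral P F W t f Y"
  shows "wiener_pair (\<lambda>u. indicator {0..t} u * f u) Y" "Y \<in> borel_measurable (F t)"
proof -
  show Ym: "Y \<in> borel_measurable (F t)" using Y by (simp add: is_wiener_integral_def)
  from is_wiener_integralD[OF Y] obtain m p c where p': "\<forall>n. partition_in t (m n) (p n)"
    and L: "(\<lambda>n. \<integral>\<^sup>+u. ennreal ((step_fun (m n) (p n) (c n) u - f u)\<^sup>2) \<partial>lebesgue_on {0..t}) \<longlonglongrightarrow> 0"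
    and LP: "(\<lambda>n. \<integral>\<^sup>+\<omega>. ennreal ((step_integral W (m n) (p n) (c n) \<omega> - Y \<omega>)\<^sup>2) \<partial>P) \<longlonglongrightarrow> 0"
    by (elim conjE exE)
  note p = p'[rule_format]
  have el: "elementary (step_fun (m n) (p n) (c n)) (step_integral W (m n) (p n) (c n))" for n
    by (rule elementary_step_fun[OF t p])
  have sq: "square_integrable (lebesgue_on {0..t}) f" using square_integrable_initial_mono[OF t f] .
  have "L2_lim (lebesgue_on {0..t}) (\<lambda>n. step_fun (m n) (p n) (c n)) f"
    using sq by (intro L2_limI_nn step_fun_square_integrable L) (simp add: square_integrable_def)
  then have "(\<lambda>n. \<integral>u. (step_fun (m n) (p n) (c n) u - f u)\<^sup>2 \<partial>lebesgue_on {0..t}) \<longlonglongrightarrow> 0"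
    by (simp add: L2_lim_def)
  then have "L2_lim \<L> (\<lambda>n. step_fun (m n) (p n) (c n)) (\<lambda>u. indicator {0..t} u * f u)"
    using sq unfolding square_integrable_initial[OF t]
    by (simp add: L2_lim_def elementary_square_integrable_time[OF el] integral_initial[OF t]
        step_fun_initial[OF p] flip: indicator_square)
  moreover have "L2_lim P (\<lambda>n. step_integral W (m n) (p n) (c n)) Y"
    using F_measurable_P[OF t Ym] LP by (intro L2_limI_nn elementary_square_integrable[OF el])
  ultimately show "wiener_pair (\<lambda>u. indicator {0..t} u * f u) Y"
    unfolding wiener_pair_def using el
    by (intro exI[of _ "\<lambda>n. step_fun (m n) (p n) (c n)"] exI[of _ "\<lambda>n. step_integral W (m n) (p n) (c n)"]) simp
qed

text \<open>Approximate \<open>f\<close> by step functions with geometrically decreasing errors. By the isometry the integrals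
  \<open>Z n\<close> then have summable increments, so they converge almost surely. Their pointwise limit is
  measurable with respect to \<open>F t\<close>, whichever null sets \<open>F t\<close> contains, and Fatou's lemma gives the
  convergence in mean square.\<close>

lemma ex_wiener_integral:
  assumes t: "t \<in> {0..T}" and f: "square_integrable \<L> f"
  shows "\<exists>Y. is_wiener_integral P F W t f Y"
proof -
  \<comment> \<open>the square roots \<open>1 / 4 ^ n\<close> of the errors are summable\<close>
  define r :: real where "r = 1 / 16"
  have t0: "0 \<le> t" using t by simp
  have sq: "square_integrable (lebesgue_on {0..t}) f" using square_integrable_initial_mono[OF t f] .
  have "\<exists>m p c. partition_in t m p \<and> (\<integral>u. (step_fun m p c u - f u)\<^sup>2 \<partial>lebesgue_on {0..t}) < r ^ n" for n
    using step_functions_dense[OF t0 sq] unfolding step_approximable_def r_def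
    by (metis zero_less_divide_1_iff zero_less_numeral zero_less_power)
  then obtain m p c where p: "\<And>n. partition_in t (m n) (p n)"
    and err: "\<And>n. (\<integral>u. (step_fun (m n) (p n) (c n) u - f u)\<^sup>2 \<partial>lebesgue_on {0..t}) < r ^ n"
    by metis
  define \<phi> where "\<phi> n = step_fun (m n) (p n) (c n)" for n
  define Z where "Z n = step_integral W (m n) (p n) (c n)" for n
  have el: "elementary (\<phi> n) (Z n)" for n
    unfolding \<phi>_def Z_def by (rule elementary_step_fun[OF t p])
  have Zm[measurable]: "Z n \<in> borel_measurable P" for n using elementary_measurable[OF el] .
  have err': "(\<integral>u. (\<phi> n u - indicator {0..t} u * f u)\<^sup>2 \<partial>\<L>) < r ^ n" for n
    using err[of n] by (simp add: integral_initial[OF t] step_fun_initial[OF p] \<phi>_def flip: indicator_square)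
  have iso: "(\<integral>\<omega>. (Z k \<omega> - Z n \<omega>)\<^sup>2 \<partial>P) \<le> 4 * r ^ n" if "n \<le> k" for n k
  proof -
    have i: "integrable \<L> (\<lambda>u. (\<phi> n u - indicator {0..t} u * f u)\<^sup>2)" for n
      using sq unfolding square_integrable_initial[OF t]
      by (intro square_integrable_diff_square elementary_square_integrable_time[OF el])
    have "wiener_pair (\<lambda>u. 1 * \<phi> k u + (-1) * \<phi> n u) (\<lambda>\<omega>. 1 * Z k \<omega> + (-1) * Z n \<omega>)"
      by (intro wiener_pair_lincomb elementary_wiener_pair el)
    from wiener_pair_isometry[OF this]
    have "(\<integral>\<omega>. (Z k \<omega> - Z n \<omega>)\<^sup>2 \<partial>P) = (\<integral>u. (\<phi> k u - \<phi> n u)\<^sup>2 \<partial>\<L>)" by simp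
    also have "\<dots> \<le> (\<integral>u. 2 * (\<phi> k u - indicator {0..t} u * f u)\<^sup>2 + 2 * (\<phi> n u - indicator {0..t} u * f u)\<^sup>2 \<partial>\<L>)"
    proof (rule integral_mono)
      show "integrable \<L> (\<lambda>u. (\<phi> k u - \<phi> n u)\<^sup>2)"
        by (intro square_integrable_diff_square elementary_square_integrable_time[OF el])
      show "(\<phi> k u - \<phi> n u)\<^sup>2 \<le> 2 * (\<phi> k u - indicator {0..t} u * f u)\<^sup>2
          + 2 * (\<phi> n u - indicator {0..t} u * f u)\<^sup>2" for u
        using sum_square_le[of "\<phi> k u - indicator {0..t} u * f u" "- (\<phi> n u - indicator {0..t} u * f u)"]
        by (simp only: power2_minus) simp
    qed (use i in auto)
    also have "\<dots> = 2 * (\<integral>u. (\<phi> k u - indicator {0..t} u * f u)\<^sup>2 \<partial>\<L>)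
        + 2 * (\<integral>u. (\<phi> n u - indicator {0..t} u * f u)\<^sup>2 \<partial>\<L>)"
      using i by simp
    also have "\<dots> \<le> 2 * r ^ k + 2 * r ^ n"
      using err'[of k] err'[of n] by simp
    also have "r ^ k \<le> r ^ n"
      using that by (intro power_decreasing) (auto simp: r_def)
    finally show ?thesis by simp
  qed
  have iZ: "integrable P (\<lambda>\<omega>. (Z k \<omega> - Z n \<omega>)\<^sup>2)" for n k
    by (intro square_integrable_diff_square elementary_square_integrable[OF el])
  define d where "d n \<omega> = Z (Suc n) \<omega> - Z n \<omega>" for n \<omega>
  have dm[measurable]: "d n \<in> borel_measurable P" for n unfolding d_def by simp
  have dL: "(\<integral>\<^sup>+\<omega>. ennreal \<bar>d n \<omega>\<bar> \<partial>P) \<le> ennreal (5 * (1 / 4) ^ n)" for n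
  proof -
    have "(\<integral>\<^sup>+\<omega>. ennreal \<bar>d n \<omega>\<bar> \<partial>P) \<le> (\<integral>\<^sup>+\<omega>. ennreal (4 ^ n * (d n \<omega>)\<^sup>2 + (1 / 4) ^ n) \<partial>P)"
    proof (intro nn_integral_mono ennreal_leI)
      fix \<omega>
      have "2 * (2 ^ n * \<bar>d n \<omega>\<bar>) * (1 / 2) ^ n \<le> (2 ^ n * \<bar>d n \<omega>\<bar>)\<^sup>2 + ((1 / 2) ^ n)\<^sup>2"
        by (rule sum_squares_bound)
      moreover have "(2 ^ n * \<bar>d n \<omega>\<bar>) * (1 / 2) ^ n = \<bar>d n \<omega>\<bar>"
        by (simp add: power_divide)
      moreover have "(2 ^ n * \<bar>d n \<omega>\<bar>)\<^sup>2 = 4 ^ n * (d n \<omega>)\<^sup>2" "((1 / 2) ^ n)\<^sup>2 = (1 / 4 :: real) ^ n"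
        by (simp_all add: power_mult_distrib power_even_eq[symmetric] power_divide mult.commute[of n]
            power_mult)
      ultimately show "\<bar>d n \<omega>\<bar> \<le> 4 ^ n * (d n \<omega>)\<^sup>2 + (1 / 4) ^ n" by linarith
    qed
    also have "\<dots> = ennreal (\<integral>\<omega>. 4 ^ n * (d n \<omega>)\<^sup>2 + (1 / 4) ^ n \<partial>P)"
      using iZ unfolding d_def by (intro nn_integral_eq_integral) auto
    also have "(\<integral>\<omega>. 4 ^ n * (d n \<omega>)\<^sup>2 + (1 / 4) ^ n \<partial>P) = 4 ^ n * (\<integral>\<omega>. (d n \<omega>)\<^sup>2 \<partial>P) + (1 / 4) ^ n"
      using iZ unfolding d_def by (simp add: P.prob_space)
    also have "\<dots> \<le> 4 ^ n * (4 * r ^ n) + (1 / 4) ^ n"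
      using iso[of n "Suc n"] unfolding d_def by (intro add_mono mult_left_mono) auto
    also have "\<dots> = 5 * (1 / 4) ^ n"
      by (simp add: r_def power_mult_distrib[symmetric] flip: mult.assoc)
    finally show ?thesis by (simp add: ennreal_leI)
  qed
  have "(\<integral>\<^sup>+\<omega>. (\<Sum>n. ennreal \<bar>d n \<omega>\<bar>) \<partial>P) = (\<Sum>n. \<integral>\<^sup>+\<omega>. ennreal \<bar>d n \<omega>\<bar> \<partial>P)"
    by (intro nn_integral_suminf) simp
  also have "\<dots> \<le> (\<Sum>n. ennreal (5 * (1 / 4) ^ n))"
    by (intro suminf_le dL) auto
  also have "\<dots> < \<infinity>"
    by (subst suminf_ennreal2) (auto intro!: summable_mult summable_geometric)
  finally have "AE \<omega> in P. (\<Sum>n. ennreal \<bar>d n \<omega>\<bar>) \<noteq> \<infinity>"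
    by (intro nn_integral_PInf_AE) auto
  then have conv: "AE \<omega> in P. (\<lambda>n. Z n \<omega>) \<longlonglongrightarrow> lim (\<lambda>n. Z n \<omega>)"
  proof eventually_elim
    case (elim \<omega>)
    then have "summable (\<lambda>n. \<bar>d n \<omega>\<bar>)"
      by (intro summable_suminf_not_top) auto
    then have "summable (\<lambda>n. d n \<omega>)" by (rule summable_rabs_cancel)
    then have "convergent (\<lambda>n. \<Sum>i<n. d i \<omega>)"
      by (simp add: summable_iff_convergent)
    moreover have "(\<Sum>i<n. d i \<omega>) = Z n \<omega> - Z 0 \<omega>" for n
      unfolding d_def by (rule sum_lessThan_telescope)
    ultimately have "convergent (\<lambda>n. Z n \<omega> - Z 0 \<omega>)" by simp
    then have "convergent (\<lambda>n. (Z n \<omega> - Z 0 \<omega>) + Z 0 \<omega>)"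
      by (intro convergent_add convergent_const)
    then show ?case by (simp add: convergent_LIMSEQ_iff)
  qed
  define Y where "Y \<omega> = lim (\<lambda>n. Z n \<omega>)" for \<omega>
  have ZF: "Z n \<in> borel_measurable (F t)" for n
  proof -
    have [measurable]: "W (p n i) \<in> borel_measurable (F t)" if "i \<le> m n" for i
    proof -
      have "p n i \<in> {0..T}" "t \<in> {p n i..T}"
        using partition_in_bounds[OF p that] t by auto
      then show ?thesis using F_measurable_mono W_adapted by blast
    qed
    show ?thesis unfolding Z_def step_integral_def by measurable
  qed
  have YF: "Y \<in> borel_measurable (F t)"
    unfolding Y_def using ZF by (rule borel_measurable_lim_metric)
  have [measurable]: "Y \<in> borel_measurable P" using F_measurable_P[OF t YF] .
  have fatou: "(\<integral>\<^sup>+\<omega>. ennreal ((Z n \<omega> - Y \<omega>)\<^sup>2) \<partial>P) \<le> ennreal (4 * r ^ n)" for n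
  proof -
    have "(\<integral>\<^sup>+\<omega>. ennreal ((Z n \<omega> - Y \<omega>)\<^sup>2) \<partial>P) = (\<integral>\<^sup>+\<omega>. liminf (\<lambda>k. ennreal ((Z k \<omega> - Z n \<omega>)\<^sup>2)) \<partial>P)"
    proof (rule nn_integral_cong_AE, use conv in eventually_elim)
      case (elim \<omega>)
      have "(\<lambda>k. ennreal ((Z k \<omega> - Z n \<omega>)\<^sup>2)) \<longlonglongrightarrow> ennreal ((Y \<omega> - Z n \<omega>)\<^sup>2)"
        using elim unfolding Y_def by (intro tendsto_intros)
      then have "liminf (\<lambda>k. ennreal ((Z k \<omega> - Z n \<omega>)\<^sup>2)) = ennreal ((Y \<omega> - Z n \<omega>)\<^sup>2)"
        by (intro lim_imp_Liminf) auto
      then show ?case by (simp add: power2_commute)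
    qed
    also have "\<dots> \<le> liminf (\<lambda>k. \<integral>\<^sup>+\<omega>. ennreal ((Z k \<omega> - Z n \<omega>)\<^sup>2) \<partial>P)"
      by (rule nn_integral_liminf) simp
    also have "\<dots> \<le> ennreal (4 * r ^ n)"
    proof (rule Liminf_le)
      show "\<forall>\<^sub>F k in sequentially. (\<integral>\<^sup>+\<omega>. ennreal ((Z k \<omega> - Z n \<omega>)\<^sup>2) \<partial>P) \<le> ennreal (4 * r ^ n)"
        using eventually_ge_at_top[of n]
      proof eventually_elim
        case (elim k)
        have "(\<integral>\<^sup>+\<omega>. ennreal ((Z k \<omega> - Z n \<omega>)\<^sup>2) \<partial>P) = ennreal (\<integral>\<omega>. (Z k \<omega> - Z n \<omega>)\<^sup>2 \<partial>P)"
          using iZ by (intro nn_integral_eq_integral) auto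
        then show ?case using iso[OF elim] by (simp add: ennreal_leI)
      qed
    qed simp
    finally show ?thesis .
  qed
  have r0: "(\<lambda>n. ennreal (4 * r ^ n)) \<longlonglongrightarrow> ennreal (4 * 0)"
    by (intro tendsto_intros LIMSEQ_realpow_zero) (auto simp: r_def)
  have "(\<lambda>n. \<integral>\<^sup>+\<omega>. ennreal ((Z n \<omega> - Y \<omega>)\<^sup>2) \<partial>P) \<longlonglongrightarrow> 0"
    by (rule tendsto_sandwich[OF _ _ tendsto_const]) (use fatou r0 in auto)
  moreover have "(\<lambda>n. \<integral>\<^sup>+u. ennreal ((\<phi> n u - f u)\<^sup>2) \<partial>lebesgue_on {0..t}) \<longlonglongrightarrow> 0"
  proof (rule L2_lim_nn)
    have "(\<lambda>n. \<integral>u. (\<phi> n u - f u)\<^sup>2 \<partial>lebesgue_on {0..t}) \<longlonglongrightarrow> 0"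
    proof (rule tendsto_sandwich[OF _ _ tendsto_const])
      show "(\<lambda>n. r ^ n) \<longlonglongrightarrow> 0" by (intro LIMSEQ_realpow_zero) (auto simp: r_def)
      show "\<forall>\<^sub>F n in sequentially. (\<integral>u. (\<phi> n u - f u)\<^sup>2 \<partial>lebesgue_on {0..t}) \<le> r ^ n"
        using err by (auto simp: \<phi>_def intro!: always_eventually less_imp_le)
    qed auto
    then show "L2_lim (lebesgue_on {0..t}) \<phi> f"
      using sq step_fun_square_integrable unfolding L2_lim_def \<phi>_def by blast
  qed
  ultimately have "is_wiener_integral P F W t f Y"
    unfolding is_wiener_integral_def using YF p unfolding partition_in_def \<phi>_def Z_def by blast
  then show ?thesis by blast
qed

lemma wiener_integral_pair:
  assumes t: "t \<in> {0..T}" and f: "square_integrable \<L> f"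
  shows "wiener_pair (\<lambda>u. indicator {0..t} u * f u) (wiener_integral P F W t f)"
    "wiener_integral P F W t f \<in> borel_measurable (F t)"
    "is_wiener_integral P F W t f (wiener_integral P F W t f)"
proof -
  show *: "is_wiener_integral P F W t f (wiener_integral P F W t f)"
    unfolding wiener_integral_def using ex_wiener_integral[OF assms] by (rule someI_ex)
  show "wiener_pair (\<lambda>u. indicator {0..t} u * f u) (wiener_integral P F W t f)"
    "wiener_integral P F W t f \<in> borel_measurable (F t)"
    using is_wiener_integral_pair[OF assms *] by auto
qed

end

section \<open>Change of measure and the drifted Brownian motion\<close>

context wiener begin

text \<open>The measure that turns the Wiener integral of a deterministic \<open>\<psi>\<close> into a drift; \<open>Z\<close> is the integral
  of \<open>\<psi>\<close>.\<close>

definition girsanov :: "(real \<Rightarrow> real) \<Rightarrow> ('w \<Rightarrow> real) \<Rightarrow> 'w measure" where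
  "girsanov \<psi> Z = density P (\<lambda>\<omega>. ennreal (exp (Z \<omega> - 1/2 * (sqnorm \<psi>))))"

lemma sets_girsanov [simp, measurable_cong]: "sets (girsanov \<psi> Z) = sets P"
  and space_girsanov [simp]: "space (girsanov \<psi> Z) = space P"
  by (simp_all add: girsanov_def)

lemma integral_girsanov:
  fixes f :: "'w \<Rightarrow> 'b::{banach, second_countable_topology}"
  assumes "wiener_pair \<psi> Z" "f \<in> borel_measurable P"
  shows "(\<integral>\<omega>. f \<omega> \<partial>girsanov \<psi> Z) = (\<integral>\<omega>. exp (Z \<omega> - 1/2 * (sqnorm \<psi>)) *\<^sub>R f \<omega> \<partial>P)"
  unfolding girsanov_def using assms wiener_pair_measurable(1)[OF assms(1)]
  by (intro integral_density) auto

lemma prob_space_girsanov: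
  assumes "wiener_pair \<psi> Z"
  shows "prob_space (girsanov \<psi> Z)"
proof
  have [measurable]: "Z \<in> borel_measurable P" using wiener_pair_measurable(1)[OF assms] .
  have "emeasure (girsanov \<psi> Z) (space (girsanov \<psi> Z)) = (\<integral>\<^sup>+\<omega>. ennreal (exp (Z \<omega> - 1/2 * (sqnorm \<psi>))) \<partial>P)"
    unfolding girsanov_def by (subst emeasure_density) (auto intro!: nn_integral_cong simp: indicator_def)
  also have "\<dots> = (\<integral>\<^sup>+\<omega>. ennreal (exp (- 1/2 * (sqnorm \<psi>)) * exp (1 * Z \<omega>)) \<partial>P)"
    by (simp add: exp_add[symmetric])
  also have "\<dots> = ennreal (\<integral>\<omega>. exp (- 1/2 * (sqnorm \<psi>)) * exp (1 * Z \<omega>) \<partial>P)"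
    using wiener_pair_exp_moment(1)[OF assms, of 1] by (intro nn_integral_eq_integral) auto
  also have "\<dots> = ennreal (exp (- 1/2 * (sqnorm \<psi>)) * exp (1\<^sup>2 * (sqnorm \<psi>) / 2))"
    by (simp only: integral_mult_right_zero wiener_pair_exp_moment(2)[OF assms])
  finally show "emeasure (girsanov \<psi> Z) (space (girsanov \<psi> Z)) = 1"
    by (simp flip: exp_add)
qed

lemma AE_girsanov:
  assumes "wiener_pair \<psi> Z"
  shows "(AE \<omega> in girsanov \<psi> Z. R \<omega>) \<longleftrightarrow> (AE \<omega> in P. R \<omega>)"
  unfolding girsanov_def using wiener_pair_measurable(1)[OF assms] by (subst AE_density) auto

text \<open>Girsanov's theorem for deterministic integrands: a Wiener integral keeps its variance and gets the
  mean \<open>\<integral> \<psi> \<phi>\<close>.\<close>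

lemma girsanov_char:
  assumes \<psi>: "wiener_pair \<psi> Z" and \<phi>: "wiener_pair \<phi> Y"
  shows "(\<integral>\<omega>. exp (\<i> * of_real (Y \<omega>)) \<partial>girsanov \<psi> Z)
    = exp (\<i> * of_real (inner_prod \<psi> \<phi>) - of_real (sqnorm \<phi> / 2))"
proof -
  define q where "q = (sqnorm \<psi>)"
  have [measurable]: "Y \<in> borel_measurable P" using wiener_pair_measurable(1)[OF \<phi>] .
  have "(\<integral>\<omega>. exp (\<i> * of_real (Y \<omega>)) \<partial>girsanov \<psi> Z) = (\<integral>\<omega>. exp (Z \<omega> - 1/2 * q) *\<^sub>R exp (\<i> * of_real (Y \<omega>)) \<partial>P)"
    unfolding q_def by (rule integral_girsanov[OF \<psi>]) simp
  also have "\<dots> = (\<integral>\<omega>. exp (of_real (- 1/2 * q)) * exp (of_real (Z \<omega>) + \<i> * of_real (Y \<omega>)) \<partial>P)"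
  proof (intro Bochner_Integration.integral_cong refl)
    fix \<omega>
    have "exp (Z \<omega> - 1/2 * q) *\<^sub>R exp (\<i> * of_real (Y \<omega>)) = exp (of_real (Z \<omega>
        - 1/2 * q)) * exp (\<i> * of_real (Y \<omega>))"
      by (simp only: scaleR_conv_of_real exp_of_real)
    also have "\<dots> = exp (of_real (- 1/2 * q)) * exp (of_real (Z \<omega>) + \<i> * of_real (Y \<omega>))"
      by (simp add: algebra_simps flip: exp_add)
    finally show "exp (Z \<omega> - 1/2 * q) *\<^sub>R exp (\<i> * of_real (Y \<omega>)) = \<dots>" .
  qed
  also have "\<dots> = exp (of_real (- 1/2 * q)) * exp (of_real ((q - (sqnorm \<phi>)) / 2)
      + \<i> * of_real (inner_prod \<psi> \<phi>))"
    unfolding q_def by (simp only: integral_mult_right_zero wiener_pair_exp(2)[OF assms])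
  also have "\<dots> = exp (\<i> * of_real (inner_prod \<psi> \<phi>) - of_real (sqnorm \<phi> / 2))"
    by (simp add: diff_divide_distrib flip: exp_add)
  finally show ?thesis .
qed

text \<open>After removal of its new mean, a Wiener integral satisfies the same isometry as before the change of
  measure. This makes mean square convergence available under the new measure.\<close>

lemma girsanov_isometry:
  assumes \<psi>: "wiener_pair \<psi> Z" and \<phi>: "wiener_pair \<phi> Y"
  shows "(\<integral>\<^sup>+\<omega>. ennreal ((Y \<omega> - (inner_prod \<psi> \<phi>))\<^sup>2) \<partial>girsanov \<psi> Z) = ennreal (sqnorm \<phi>)"
proof -
  define m where "m = (inner_prod \<psi> \<phi>)"
  define v where "v = (sqnorm \<phi>)"
  have v: "0 \<le> v" by (simp add: v_def)
  have "Y \<in> borel_measurable P" using wiener_pair_measurable(1)[OF \<phi>] .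
  then have m': "(\<lambda>\<omega>. Y \<omega> - m) \<in> borel_measurable (girsanov \<psi> Z)" by simp
  have "distr (girsanov \<psi> Z) borel (\<lambda>\<omega>. Y \<omega> - m) = distr std_normal_distribution borel (\<lambda>x. 0 + sqrt v * x)"
  proof (rule normal_lawI[OF prob_space_girsanov[OF \<psi>] m' _ v])
    fix u
    have p: "wiener_pair (\<lambda>s. u * \<phi> s + 0 * \<phi> s) (\<lambda>\<omega>. u * Y \<omega> + 0 * Y \<omega>)"
      by (rule wiener_pair_lincomb[OF \<phi> \<phi>])
    have "(\<integral>s. \<psi> s * (u * \<phi> s) \<partial>\<L>) = u * m"
      by (simp add: m_def mult.left_commute)
    moreover have "(\<integral>s. (u * \<phi> s)\<^sup>2 \<partial>\<L>) = u\<^sup>2 * v"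
      by (simp add: v_def power_mult_distrib)
    ultimately have ch: "(\<integral>\<omega>. exp (\<i> * of_real (u * Y \<omega>)) \<partial>girsanov \<psi> Z)
        = exp (\<i> * of_real (u * m) - of_real (u\<^sup>2 * v / 2))"
      using girsanov_char[OF \<psi> p] by simp
    have "(\<integral>\<omega>. exp (\<i> * of_real (u * (Y \<omega> - m))) \<partial>girsanov \<psi> Z)
        = (\<integral>\<omega>. exp (- (\<i> * of_real (u * m))) * exp (\<i> * of_real (u * Y \<omega>)) \<partial>girsanov \<psi> Z)"
      by (intro Bochner_Integration.integral_cong refl) (simp add: right_diff_distrib flip: exp_add)
    also have "\<dots> = exp (- (\<i> * of_real (u * m))) * exp (\<i> * of_real (u * m) - of_real (u\<^sup>2 * v / 2))"
      by (simp only: integral_mult_right_zero ch)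
    also have "\<dots> = exp (\<i> * of_real (u * 0) - of_real (u\<^sup>2 * v / 2))"
      by (simp flip: exp_add)
    finally show "(\<integral>\<omega>. exp (\<i> * of_real (u * (Y \<omega> - m))) \<partial>girsanov \<psi> Z)
        = exp (\<i> * of_real (u * 0) - of_real (u\<^sup>2 * v / 2))" .
  qed
  from normal_law_second_moment[OF this m' v] show ?thesis
    by (simp add: m_def v_def)
qed

end

text \<open>The lower bound on the volatility makes the market price of risk square integrable.\<close>

locale black_scholes = wiener +
  fixes r \<sigma> :: "real \<Rightarrow> real" and \<delta> :: real
  assumes r: "square_integrable \<L> r" and \<sigma>: "square_integrable \<L> \<sigma>"
    and \<delta>: "0 < \<delta>" and \<sigma>_ge: "AE u in \<L>. \<delta> \<le> \<sigma> u"
begin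

abbreviation \<theta> :: "real \<Rightarrow> real" where "\<theta> \<equiv> market_price_of_risk r \<sigma>"

lemma \<theta>: "square_integrable \<L> \<theta>"
proof -
  have m: "\<theta> \<in> borel_measurable \<L>"
    unfolding market_price_of_risk_def using r \<sigma> by (auto simp: square_integrable_def)
  have "integrable \<L> (\<lambda>u. (\<theta> u)\<^sup>2)"
  proof (rule Bochner_Integration.integrable_bound)
    show "integrable \<L> (\<lambda>u. (r u)\<^sup>2 / \<delta>\<^sup>2)" using r by (simp add: square_integrable_def)
    show "AE u in \<L>. norm ((\<theta> u)\<^sup>2) \<le> norm ((r u)\<^sup>2 / \<delta>\<^sup>2)"
      using \<sigma>_ge
    proof eventually_elim
      case (elim u)
      have "(r u)\<^sup>2 / (\<sigma> u)\<^sup>2 \<le> (r u)\<^sup>2 / \<delta>\<^sup>2"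
        using elim \<delta> by (intro divide_left_mono power_mono) auto
      then show ?case by (simp add: market_price_of_risk_def power_divide)
    qed
  qed (use m in simp)
  then show ?thesis using m by (simp add: square_integrable_def)
qed

lemma \<theta>_mult_\<sigma>: "AE u in \<L>. \<theta> u * \<sigma> u = r u"
  using \<sigma>_ge by eventually_elim (use \<delta> in \<open>simp add: market_price_of_risk_def\<close>)

definition Z where "Z = wiener_integral P F W T \<theta>"

lemma pair_initial_T:
  assumes "wiener_pair (\<lambda>u. indicator {0..T} u * f u) Y" "square_integrable \<L> f"
  shows "wiener_pair f Y"
proof (rule wiener_pair_cong[OF assms(1)])
  show "f \<in> borel_measurable \<L>"
    using assms(2) by (rule square_integrable_measurable)
  show "AE u in \<L>. indicator {0..T} u * f u = f u"
    by (rule AE_I2) simp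
qed

lemma Z: "wiener_pair \<theta> Z"
  unfolding Z_def by (rule pair_initial_T[OF wiener_integral_pair(1)[OF _ \<theta>] \<theta>]) (use T in simp)

abbreviation Q where "Q \<equiv> limit_QT P F T W r \<sigma>"

lemma Q_eq: "Q = girsanov \<theta> Z"
  by (simp add: limit_QT_def girsanov_def Z_def)

definition Y where "Y t = wiener_integral P F W t \<sigma>"

lemma Y: "t \<in> {0..T} \<Longrightarrow> wiener_pair (\<lambda>u. indicator {0..t} u * \<sigma> u) (Y t)"
  and Y_measurable: "t \<in> {0..T} \<Longrightarrow> Y t \<in> borel_measurable (F t)"
  unfolding Y_def using wiener_integral_pair[OF _ \<sigma>] by auto

lemma step_integral_W_bar:
  assumes t: "t \<in> {0..T}" and p: "partition_in t m p"
  shows "step_integral (W_bar W r \<sigma>) m p c \<omega> = step_integral W m p c \<omega> - (\<integral>u. \<theta> u * step_fun m p c u \<partial>\<L>)"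
proof -
  have ind: "integrable \<L> (\<lambda>u. indicator A u * \<theta> u)" if "A \<in> sets borel" for A
  proof -
    have "square_integrable \<L> (indicator A)"
    proof -
      have m: "indicator A \<in> borel_measurable \<L>"
        using that by (intro measurable_restrict_space1 measurable_completion) simp
      have "integrable \<L> (\<lambda>u. (indicator A u :: real)\<^sup>2)"
        by (rule \<L>.integrable_const_bound[where B=1])
           (use borel_measurable_power[OF m] in \<open>auto simp: indicator_def\<close>)
      then show ?thesis using m unfolding square_integrable_def by blast
    qed
    then show ?thesis using square_integrable_mult \<theta> by blast
  qed
  have "W_bar W r \<sigma> (p (Suc i)) \<omega> - W_bar W r \<sigma> (p i) \<omega>
     = (W (p (Suc i)) \<omega> - W (p i) \<omega>) - (\<integral>u. indicator {p i<..p (Suc i)} u * \<theta> u \<partial>\<L>)" if i: "i < m" for i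
  proof -
    have b: "0 \<le> p i" "p i \<le> p (Suc i)" "p (Suc i) \<le> t"
      using partition_in_bounds[OF p, of i] partition_in_bounds[OF p, of "Suc i"] partition_in_mono[OF p, of
          i "Suc i"] i by auto
    have "(\<integral>u. indicator {p i<..p (Suc i)} u * \<theta> u \<partial>\<L>) = (\<integral>u. indicator {0..p (Suc i)} u * \<theta> u
        - indicator {0..p i} u * \<theta> u \<partial>\<L>)"
      using b by (intro Bochner_Integration.integral_cong) (auto simp: indicator_def)
    also have "\<dots> = (\<integral>u. indicator {0..p (Suc i)} u * \<theta> u \<partial>\<L>) - (\<integral>u. indicator {0..p i} u * \<theta> u \<partial>\<L>)"
      by (intro Bochner_Integration.integral_diff ind) auto
    finally show ?thesis
      using b t integral_initial[of "p i" \<theta>] integral_initial[of "p (Suc i)" \<theta>] by (simp add: W_bar_def)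
  qed
  then have "step_integral (W_bar W r \<sigma>) m p c \<omega>
    = (\<Sum>i<m. c i * (W (p (Suc i)) \<omega> - W (p i) \<omega>) - c i * (\<integral>u. indicator {p i<..p (Suc i)} u * \<theta> u \<partial>\<L>))"
    by (simp add: step_integral_def right_diff_distrib)
  also have "\<dots> = step_integral W m p c \<omega> - (\<Sum>i<m. \<integral>u. c i * (indicator {p i<..p (Suc i)} u * \<theta> u) \<partial>\<L>)"
    by (simp add: step_integral_def sum_subtractf)
  also have "(\<Sum>i<m. \<integral>u. c i * (indicator {p i<..p (Suc i)} u * \<theta> u) \<partial>\<L>)
      = (\<integral>u. (\<Sum>i<m. c i * (indicator {p i<..p (Suc i)} u * \<theta> u)) \<partial>\<L>)"
    by (intro Bochner_Integration.integral_sum[symmetric] integrable_mult_right ind) auto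
  also have "\<dots> = (\<integral>u. \<theta> u * step_fun m p c u \<partial>\<L>)"
    by (intro Bochner_Integration.integral_cong refl) (simp only: step_fun_def sum_distrib_left mult_ac)
  finally show ?thesis .
qed

text \<open>The candidate for the integral of \<open>\<sigma>\<close> with respect to \<open>W_bar\<close>: the drift \<open>\<integral> \<theta> \<sigma>\<close> equals \<open>\<integral> r\<close>.\<close>

definition drifted where "drifted t \<omega> = Y t \<omega> - (\<integral>u. indicator {0..t} u * r u \<partial>\<L>)"

text \<open>One identity yields both existence and uniqueness of the integral under \<open>Q\<close>: for every step function
  the distance of its integral to \<open>drifted t\<close> is its distance to \<open>\<sigma>\<close>.\<close>

lemma drifted_isometry:
  assumes t: "t \<in> {0..T}" and p: "partition_in t m p"
  shows "(\<integral>\<^sup>+\<omega>. ennreal ((step_integral (W_bar W r \<sigma>) m p c \<omega> - drifted t \<omega>)\<^sup>2) \<partial>Q)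
    = (\<integral>\<^sup>+u. ennreal ((step_fun m p c u - \<sigma> u)\<^sup>2) \<partial>lebesgue_on {0..t})"
proof -
  note el = elementary_step_fun[OF t p, of c]
  define \<phi> where "\<phi> u = step_fun m p c u - indicator {0..t} u * \<sigma> u" for u
  have pair: "wiener_pair \<phi> (\<lambda>\<omega>. step_integral W m p c \<omega> - Y t \<omega>)"
    using wiener_pair_lincomb[OF elementary_wiener_pair[OF el] Y[OF t], of 1 "-1"] by (simp add: \<phi>_def[abs_def])
  have i1: "integrable \<L> (\<lambda>u. \<theta> u * step_fun m p c u)"
    by (intro square_integrable_mult \<theta> elementary_square_integrable_time[OF el])
  have i2: "integrable \<L> (\<lambda>u. \<theta> u * (indicator {0..t} u * \<sigma> u))"
    by (intro square_integrable_mult \<theta> wiener_pair_square_integrable[OF Y[OF t]])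
  have "(inner_prod \<theta> \<phi>) = (\<integral>u. \<theta> u * step_fun m p c u \<partial>\<L>) - (\<integral>u. \<theta> u * (indicator {0..t} u * \<sigma> u) \<partial>\<L>)"
    unfolding \<phi>_def right_diff_distrib using i1 i2 by (rule Bochner_Integration.integral_diff)
  also have "(\<integral>u. \<theta> u * (indicator {0..t} u * \<sigma> u) \<partial>\<L>) = (\<integral>u. indicator {0..t} u * r u \<partial>\<L>)"
  proof (rule integral_cong_AE)
    show "AE u in \<L>. \<theta> u * (indicator {0..t} u * \<sigma> u) = indicator {0..t} u * r u"
      using \<theta>_mult_\<sigma> by eventually_elim (auto simp: indicator_def)
    show "(\<lambda>u. \<theta> u * (indicator {0..t} u * \<sigma> u)) \<in> borel_measurable \<L>"
      using i2 by (rule borel_measurable_integrable)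
    show "(\<lambda>u. indicator {0..t} u * r u) \<in> borel_measurable \<L>"
      using square_integrable_initial_mono[OF t r] unfolding square_integrable_initial[OF t]
          by (simp add: square_integrable_def)
  qed
  finally have m: "(inner_prod \<theta> \<phi>) = (\<integral>u. \<theta> u * step_fun m p c u \<partial>\<L>) - (\<integral>u. indicator {0..t} u * r u \<partial>\<L>)" .
  have "(\<integral>\<^sup>+\<omega>. ennreal ((step_integral (W_bar W r \<sigma>) m p c \<omega> - drifted t \<omega>)\<^sup>2) \<partial>Q)
    = (\<integral>\<^sup>+\<omega>. ennreal (((step_integral W m p c \<omega> - Y t \<omega>) - (inner_prod \<theta> \<phi>))\<^sup>2) \<partial>girsanov \<theta> Z)"
  proof -
    have "step_integral (W_bar W r \<sigma>) m p c \<omega> - drifted t \<omega> = (step_integral W m p c \<omega> - Y t \<omega>)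
        - (inner_prod \<theta> \<phi>)" for \<omega>
      unfolding m step_integral_W_bar[OF t p] drifted_def by linarith
    then show ?thesis by (simp only: Q_eq)
  qed
  also have "\<dots> = ennreal (sqnorm \<phi>)"
    by (rule girsanov_isometry[OF Z pair])
  also have "\<dots> = ennreal (\<integral>u. (step_fun m p c u - \<sigma> u)\<^sup>2 \<partial>lebesgue_on {0..t})"
    by (simp add: integral_initial[OF t] step_fun_initial[OF p] \<phi>_def flip: indicator_square)
  also have "\<dots> = (\<integral>\<^sup>+u. ennreal ((step_fun m p c u - \<sigma> u)\<^sup>2) \<partial>lebesgue_on {0..t})"
    by (rule nn_integral_eq_integral[symmetric])
       (simp_all add: square_integrable_diff_square step_fun_square_integrable
           square_integrable_initial_mono[OF t \<sigma>])
  finally show ?thesis .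
qed

lemma drifted_measurable:
  assumes t: "t \<in> {0..T}"
  shows "drifted t \<in> borel_measurable (F t)"
  unfolding drifted_def[abs_def] by (intro borel_measurable_diff Y_measurable[OF t] borel_measurable_const)

lemma is_wiener_integral_drifted:
  assumes t: "t \<in> {0..T}"
  shows "is_wiener_integral Q F (W_bar W r \<sigma>) t \<sigma> (drifted t)"
proof -
  from is_wiener_integralD[OF wiener_integral_pair(3)[OF t \<sigma>]]
  obtain m p c where p': "\<forall>n. partition_in t (m n) (p n)"
    and L: "(\<lambda>n. \<integral>\<^sup>+u. ennreal ((step_fun (m n) (p n) (c n) u - \<sigma> u)\<^sup>2) \<partial>lebesgue_on {0..t}) \<longlonglongrightarrow> 0"
    by (elim conjE exE)
  note p = p'[rule_format]
  have "(\<lambda>n. \<integral>\<^sup>+\<omega>. ennreal ((step_integral (W_bar W r \<sigma>) (m n) (p n) (c n) \<omega> - drifted t \<omega>)\<^sup>2) \<partial>Q) \<longlonglongrightarrow> 0"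
    unfolding drifted_isometry[OF t p] by (rule L)
  with drifted_measurable[OF t] p' L show ?thesis
    by (rule is_wiener_integralI[where m=m and p=p and c=c])
qed

end

section \<open>The density process of the limit model\<close>

context black_scholes begin

text \<open>Whatever version the choice operator picks, its approximating step integrals also converge to
  \<open>drifted t\<close>, because of \<open>drifted_isometry\<close>. Null sets of \<open>Q\<close> and of \<open>P\<close> agree.\<close>

lemma wiener_integral_W_bar:
  assumes t: "t \<in> {0..T}"
  shows "AE \<omega> in P. wiener_integral Q F (W_bar W r \<sigma>) t \<sigma> \<omega> = drifted t \<omega>"
    and "wiener_integral Q F (W_bar W r \<sigma>) t \<sigma> \<in> borel_measurable (F t)"
proof -
  define X where "X = wiener_integral Q F (W_bar W r \<sigma>) t \<sigma>"
  have X: "is_wiener_integral Q F (W_bar W r \<sigma>) t \<sigma> X"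
    unfolding X_def wiener_integral_def
    by (rule someI[of "is_wiener_integral Q F (W_bar W r \<sigma>) t \<sigma>" "drifted t"])
       (rule is_wiener_integral_drifted[OF t])
  from is_wiener_integralD[OF X] obtain m p c where p': "\<forall>n. partition_in t (m n) (p n)"
    and L: "(\<lambda>n. \<integral>\<^sup>+u. ennreal ((step_fun (m n) (p n) (c n) u - \<sigma> u)\<^sup>2) \<partial>lebesgue_on {0..t}) \<longlonglongrightarrow> 0"
    and LX: "(\<lambda>n. \<integral>\<^sup>+\<omega>. ennreal ((step_integral (W_bar W r \<sigma>) (m n) (p n) (c n) \<omega> - X \<omega>)\<^sup>2) \<partial>Q) \<longlonglongrightarrow> 0"
    by (elim conjE exE)
  note p = p'[rule_format]
  show Xm: "wiener_integral Q F (W_bar W r \<sigma>) t \<sigma> \<in> borel_measurable (F t)"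
    using X[unfolded is_wiener_integral_def, THEN conjunct1] by (simp only: X_def)
  define S where "S n = step_integral (W_bar W r \<sigma>) (m n) (p n) (c n)" for n
  have [measurable]: "X \<in> borel_measurable P" "drifted t \<in> borel_measurable P"
    using F_measurable_P[OF t] Xm drifted_measurable[OF t] by (auto simp: X_def)
  have [measurable]: "S n \<in> borel_measurable P" for n
  proof -
    have "S n = (\<lambda>\<omega>. step_integral W (m n) (p n) (c n) \<omega> - (\<integral>u. \<theta> u * step_fun (m n) (p n) (c n) u \<partial>\<L>))"
      by (rule ext) (simp only: S_def step_integral_W_bar[OF t p])
    then show ?thesis using elementary_measurable[OF elementary_step_fun[OF t p]] by simp
  qed
  have LD: "(\<lambda>n. \<integral>\<^sup>+\<omega>. ennreal ((S n \<omega> - drifted t \<omega>)\<^sup>2) \<partial>Q) \<longlonglongrightarrow> 0"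
    using L by (simp add: S_def drifted_isometry[OF t p])
  have "(\<integral>\<^sup>+\<omega>. ennreal ((X \<omega> - drifted t \<omega>)\<^sup>2) \<partial>Q) \<le>
     2 * (\<integral>\<^sup>+\<omega>. ennreal ((S n \<omega> - X \<omega>)\<^sup>2) \<partial>Q) + 2 * (\<integral>\<^sup>+\<omega>. ennreal ((S n \<omega> - drifted t \<omega>)\<^sup>2) \<partial>Q)" for n
  proof -
    have "(\<integral>\<^sup>+\<omega>. ennreal ((X \<omega> - drifted t \<omega>)\<^sup>2) \<partial>Q) \<le> (\<integral>\<^sup>+\<omega>. 2 * ennreal ((S n \<omega> - X \<omega>)\<^sup>2)
        + 2 * ennreal ((S n \<omega> - drifted t \<omega>)\<^sup>2) \<partial>Q)"
    proof (intro nn_integral_mono)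
      fix \<omega>
      have "(X \<omega> - drifted t \<omega>)\<^sup>2 \<le> 2 * (S n \<omega> - X \<omega>)\<^sup>2 + 2 * (S n \<omega> - drifted t \<omega>)\<^sup>2"
        using sum_square_le[of "X \<omega> - S n \<omega>" "S n \<omega> - drifted t \<omega>"] by (simp add: power2_commute[of "X \<omega>"])
      then have "ennreal ((X \<omega> - drifted t \<omega>)\<^sup>2) \<le> ennreal (2 * (S n \<omega> - X \<omega>)\<^sup>2 + 2 * (S n \<omega> - drifted t \<omega>)\<^sup>2)"
        by (rule ennreal_leI)
      then show "ennreal ((X \<omega> - drifted t \<omega>)\<^sup>2) \<le> 2 * ennreal ((S n \<omega> - X \<omega>)\<^sup>2)
          + 2 * ennreal ((S n \<omega> - drifted t \<omega>)\<^sup>2)"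
        by (simp add: ennreal_mult)
    qed
    then show ?thesis by (simp add: Q_eq nn_integral_add nn_integral_cmult)
  qed
  moreover have "(\<lambda>n. 2 * (\<integral>\<^sup>+\<omega>. ennreal ((S n \<omega> - X \<omega>)\<^sup>2) \<partial>Q)
      + 2 * (\<integral>\<^sup>+\<omega>. ennreal ((S n \<omega> - drifted t \<omega>)\<^sup>2) \<partial>Q)) \<longlonglongrightarrow> 2 * 0 + 2 * 0"
    using LX LD unfolding S_def by (intro tendsto_add ennreal_tendsto_cmult) auto
  ultimately have "(\<integral>\<^sup>+\<omega>. ennreal ((X \<omega> - drifted t \<omega>)\<^sup>2) \<partial>Q) \<le> 2 * 0 + 2 * 0"
    by (intro LIMSEQ_le_const) auto
  then have "(\<integral>\<^sup>+\<omega>. ennreal ((X \<omega> - drifted t \<omega>)\<^sup>2) \<partial>Q) = 0" by simp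
  then have "AE \<omega> in Q. ennreal ((X \<omega> - drifted t \<omega>)\<^sup>2) = 0"
    by (subst (asm) nn_integral_0_iff_AE) (auto simp: Q_eq)
  then show "AE \<omega> in P. wiener_integral Q F (W_bar W r \<sigma>) t \<sigma> \<omega> = drifted t \<omega>"
    unfolding Q_eq AE_girsanov[OF Z] X_def by eventually_elim simp
qed

definition total_variance where "total_variance t = (\<integral>u. indicator {0..t} u * (\<sigma> u)\<^sup>2 \<partial>\<L>)"

definition log_BS where "log_BS t \<omega> = drifted t \<omega> - total_variance t / 2"

lemma BS_density_eq:
  assumes t: "t \<in> {0..T}"
  shows "AE \<omega> in P. BS_density P F T W r \<sigma> t \<omega> = exp (log_BS t \<omega>)"
    and "BS_density P F T W r \<sigma> t \<in> borel_measurable (F t)"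
proof -
  have "(\<integral>s. (\<sigma> s)\<^sup>2 / 2 \<partial>lebesgue_on {0..t}) = total_variance t / 2"
    by (simp add: total_variance_def integral_initial[OF t])
  then have e: "BS_density P F T W r \<sigma> t = (\<lambda>\<omega>. exp (wiener_integral Q F (W_bar W r \<sigma>) t \<sigma> \<omega>
      - total_variance t / 2))"
    by (simp add: BS_density_def[abs_def])
  show "AE \<omega> in P. BS_density P F T W r \<sigma> t \<omega> = exp (log_BS t \<omega>)"
    using wiener_integral_W_bar(1)[OF t] by eventually_elim (simp add: e log_BS_def)
  show "BS_density P F T W r \<sigma> t \<in> borel_measurable (F t)"
    unfolding e using wiener_integral_W_bar(2)[OF t] by simp
qed

lemma integrable_initial_r:
  assumes t: "t \<in> {0..T}"
  shows "integrable (lebesgue_on {0..t}) r" "integrable (lebesgue_on {0..t}) (\<lambda>u. (\<sigma> u)\<^sup>2)"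
proof -
  interpret L: finite_measure "lebesgue_on {0..t}"
    by (rule finite_measure_lebesgue_on) simp
  have "square_integrable (lebesgue_on {0..t}) (\<lambda>u. 1)" by (simp add: square_integrable_def)
  from square_integrable_mult[OF square_integrable_initial_mono[OF t r] this]
  show "integrable (lebesgue_on {0..t}) r" by simp
  show "integrable (lebesgue_on {0..t}) (\<lambda>u. (\<sigma> u)\<^sup>2)"
    using square_integrable_initial_mono[OF t \<sigma>] by (rule square_integrable_integrable)
qed

lemma BS_density_real_world:
  assumes t: "t \<in> {0..T}"
  shows "AE \<omega> in P. BS_density P F T W r \<sigma> t \<omega> =
        exp (wiener_integral P F W t \<sigma> \<omega> - (\<integral>s. r s + (\<sigma> s)\<^sup>2 / 2 \<partial>lebesgue_on {0..t}))"
proof -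
  have "(\<integral>s. r s + (\<sigma> s)\<^sup>2 / 2 \<partial>lebesgue_on {0..t}) = (\<integral>u. indicator {0..t} u * r u \<partial>\<L>) + total_variance t / 2"
  proof -
    have "(\<integral>s. r s + (\<sigma> s)\<^sup>2 / 2 \<partial>lebesgue_on {0..t}) = (\<integral>s. r s \<partial>lebesgue_on {0..t})
        + (\<integral>s. (\<sigma> s)\<^sup>2 \<partial>lebesgue_on {0..t}) / 2"
      using integrable_initial_r[OF t] by simp
    then show ?thesis by (simp only: total_variance_def integral_initial[OF t])
  qed
  note e = this
  show ?thesis
    using BS_density_eq(1)[OF t] by eventually_elim (simp add: e log_BS_def drifted_def Y_def)
qed

lemma log_BS_measurable: "t \<in> {0..T} \<Longrightarrow> log_BS t \<in> borel_measurable P"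
  unfolding log_BS_def[abs_def] using F_measurable_P[OF _ drifted_measurable] by simp

lemma inner_initial_volatility:
  "(\<integral>u. (indicator {0..s} u * \<sigma> u) * (indicator {0..t} u * \<sigma> u) \<partial>\<L>) = total_variance (min s t)"
  unfolding total_variance_def
  by (intro Bochner_Integration.integral_cong refl) (auto simp: indicator_def power2_eq_square)

lemma wiener_pair_sum:
  assumes "finite I" "\<And>i. i \<in> I \<Longrightarrow> wiener_pair (\<phi> i) (X i)"
  shows "wiener_pair (\<lambda>u. \<Sum>i\<in>I. l i * \<phi> i u) (\<lambda>\<omega>. \<Sum>i\<in>I. l i * X i \<omega>)"
  using assms
proof (induction I rule: finite_induct)
  case empty
  show ?case using elementary_wiener_pair[OF elementary_zero] by simp
next
  case (insert i I)
  then have "wiener_pair (\<lambda>u. l i * \<phi> i u + 1 * (\<Sum>i\<in>I. l i * \<phi> i u)) (\<lambda>\<omega>. l i * X i \<omega>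
      + 1 * (\<Sum>i\<in>I. l i * X i \<omega>))"
    by (intro wiener_pair_lincomb) auto
  then show ?case using insert by simp
qed

text \<open>Characteristic function of the vector of log prices; \<open>b = 0\<close> is the martingale measure, and \<open>b = 1\<close> the
  measure with the stock as numeraire. The drift coming from the change of measure is
  \<open>\<integral> r + b \<integral> \<sigma>\<^sup>2\<close>, and the log price subtracts \<open>\<integral> r + \<integral> \<sigma>\<^sup>2 / 2\<close>.\<close>

lemma log_BS_char:
  fixes l :: "'i \<Rightarrow> real" and b :: real
  assumes I: "finite I" and \<tau>: "\<And>i. i \<in> I \<Longrightarrow> \<tau> i \<in> {0..T}"
    and \<psi>: "wiener_pair (\<lambda>u. \<theta> u + b * \<sigma> u) X"
  shows "(\<integral>\<omega>. cis (\<Sum>i\<in>I. l i * log_BS (\<tau> i) \<omega>) \<partial>girsanov (\<lambda>u. \<theta> u + b * \<sigma> u) X)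
    = exp (\<i> * of_real ((b - 1/2) * (\<Sum>i\<in>I. l i * total_variance (\<tau> i)))
        - of_real ((\<Sum>i\<in>I. \<Sum>j\<in>I. l i * l j * total_variance (min (\<tau> i) (\<tau> j))) / 2))"
proof -
  define \<phi> where "\<phi> i u = indicator {0..\<tau> i} u * \<sigma> u" for i u
  define a where "a i = (\<integral>u. indicator {0..\<tau> i} u * r u \<partial>\<L>)" for i
  have pY: "wiener_pair (\<phi> i) (Y (\<tau> i))" if "i \<in> I" for i
    using Y[OF \<tau>[OF that]] by (simp add: \<phi>_def[abs_def])
  have pair: "wiener_pair (\<lambda>u. \<Sum>i\<in>I. l i * \<phi> i u) (\<lambda>\<omega>. \<Sum>i\<in>I. l i * Y (\<tau> i) \<omega>)"
    by (rule wiener_pair_sum[OF I pY])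
  note sq\<phi> = wiener_pair_square_integrable(1)[OF pY]
  note sq\<psi> = wiener_pair_square_integrable(1)[OF \<psi>]
  have inner: "(\<integral>u. (\<theta> u + b * \<sigma> u) * \<phi> i u \<partial>\<L>) = a i + b * total_variance (\<tau> i)" if i: "i \<in> I" for i
  proof -
    have i1: "integrable \<L> (\<lambda>u. indicator {0..\<tau> i} u * r u)" "integrable \<L> (\<lambda>u. indicator {0..\<tau> i} u * (\<sigma> u)\<^sup>2)"
      using integrable_initial_r[OF \<tau>[OF i]] by (simp_all add: integrable_initial[OF \<tau>[OF i]])
    have "(\<integral>u. (\<theta> u + b * \<sigma> u) * \<phi> i u \<partial>\<L>) = (\<integral>u. indicator {0..\<tau> i} u * r u
        + b * (indicator {0..\<tau> i} u * (\<sigma> u)\<^sup>2) \<partial>\<L>)"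
    proof (rule integral_cong_AE)
      show "(\<lambda>u. (\<theta> u + b * \<sigma> u) * \<phi> i u) \<in> borel_measurable \<L>"
        using sq\<psi> sq\<phi>[OF i] by (intro borel_measurable_times square_integrable_measurable)
      show "(\<lambda>u. indicator {0..\<tau> i} u * r u + b * (indicator {0..\<tau> i} u * (\<sigma> u)\<^sup>2)) \<in> borel_measurable \<L>"
        by (rule borel_measurable_add[OF _ borel_measurable_times[OF borel_measurable_const]])
           (rule i1[THEN borel_measurable_integrable])+
      show "AE u in \<L>. (\<theta> u + b * \<sigma> u) * \<phi> i u = indicator {0..\<tau> i} u * r u
          + b * (indicator {0..\<tau> i} u * (\<sigma> u)\<^sup>2)"
        using \<theta>_mult_\<sigma> by eventually_elim (auto simp: \<phi>_def indicator_def power2_eq_square algebra_simps)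
    qed
    also have "\<dots> = a i + b * total_variance (\<tau> i)" using i1 by (simp add: a_def total_variance_def)
    finally show ?thesis .
  qed
  have m1: "(\<integral>u. (\<theta> u + b * \<sigma> u) * (\<Sum>i\<in>I. l i * \<phi> i u) \<partial>\<L>) = (\<Sum>i\<in>I. l i * (a i + b * total_variance (\<tau> i)))"
  proof -
    have "(\<integral>u. (\<theta> u + b * \<sigma> u) * (\<Sum>i\<in>I. l i * \<phi> i u) \<partial>\<L>) = (\<integral>u. (\<Sum>i\<in>I. l i * ((\<theta> u + b * \<sigma> u) * \<phi> i u)) \<partial>\<L>)"
      by (simp only: sum_distrib_left mult.left_commute)
    also have "\<dots> = (\<Sum>i\<in>I. \<integral>u. l i * ((\<theta> u + b * \<sigma> u) * \<phi> i u) \<partial>\<L>)"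
      by (rule Bochner_Integration.integral_sum) (intro integrable_mult_right square_integrable_mult sq\<psi> sq\<phi>)
    also have "\<dots> = (\<Sum>i\<in>I. l i * (a i + b * total_variance (\<tau> i)))"
      by (simp only: integral_mult_right_zero inner cong: sum.cong)
    finally show ?thesis .
  qed
  have m2: "(\<integral>u. (\<Sum>i\<in>I. l i * \<phi> i u)\<^sup>2 \<partial>\<L>) = (\<Sum>i\<in>I. \<Sum>j\<in>I. l i * l j * total_variance (min (\<tau> i) (\<tau> j)))"
  proof -
    have "(\<Sum>i\<in>I. l i * \<phi> i u)\<^sup>2 = (\<Sum>i\<in>I. \<Sum>j\<in>I. (l i * l j) * (\<phi> i u * \<phi> j u))" for u
      by (simp only: power2_eq_square sum_product mult_ac)
    then have "(\<integral>u. (\<Sum>i\<in>I. l i * \<phi> i u)\<^sup>2 \<partial>\<L>) = (\<integral>u. (\<Sum>i\<in>I. \<Sum>j\<in>I. (l i * l j) * (\<phi> i u * \<phi> j u)) \<partial>\<L>)"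
      by simp
    also have "\<dots> = (\<Sum>i\<in>I. \<integral>u. (\<Sum>j\<in>I. (l i * l j) * (\<phi> i u * \<phi> j u)) \<partial>\<L>)"
      by (rule Bochner_Integration.integral_sum) (intro Bochner_Integration.integrable_sum
          integrable_mult_right square_integrable_mult sq\<phi>)
    also have "\<dots> = (\<Sum>i\<in>I. \<Sum>j\<in>I. \<integral>u. (l i * l j) * (\<phi> i u * \<phi> j u) \<partial>\<L>)"
      by (intro sum.cong refl Bochner_Integration.integral_sum) (intro integrable_mult_right
          square_integrable_mult sq\<phi>)
    also have "\<dots> = (\<Sum>i\<in>I. \<Sum>j\<in>I. l i * l j * total_variance (min (\<tau> i) (\<tau> j)))"
      by (simp only: integral_mult_right_zero \<phi>_def inner_initial_volatility)
    finally show ?thesis .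
  qed
  define s where "s = (\<Sum>i\<in>I. l i * (a i + total_variance (\<tau> i) / 2))"
  have lin: "(\<Sum>i\<in>I. l i * log_BS (\<tau> i) \<omega>) = (\<Sum>i\<in>I. l i * Y (\<tau> i) \<omega>) - s" for \<omega>
    by (simp add: s_def log_BS_def drifted_def a_def right_diff_distrib distrib_left sum_subtractf sum.distrib)
  have "(\<integral>\<omega>. cis (\<Sum>i\<in>I. l i * log_BS (\<tau> i) \<omega>) \<partial>girsanov (\<lambda>u. \<theta> u + b * \<sigma> u) X)
     = (\<integral>\<omega>. cis (- s) * exp (\<i> * of_real (\<Sum>i\<in>I. l i * Y (\<tau> i) \<omega>)) \<partial>girsanov (\<lambda>u. \<theta> u + b * \<sigma> u) X)"
    unfolding lin by (intro Bochner_Integration.integral_cong refl) (simp only: cis_conv_exp[symmetric]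
        cis_mult uminus_add_conv_diff)
  also have "\<dots> = cis (- s) * exp (\<i> * of_real (\<Sum>i\<in>I. l i * (a i
      + b * total_variance (\<tau> i))) - of_real ((\<Sum>i\<in>I. \<Sum>j\<in>I. l i * l j * total_variance (min (\<tau> i) (\<tau> j))) / 2))"
    by (simp only: integral_mult_right_zero girsanov_char[OF \<psi> pair] m1 m2)
  also have "\<dots> = exp (\<i> * of_real ((\<Sum>i\<in>I. l i * (a i + b * total_variance (\<tau> i))) - s)
      - of_real ((\<Sum>i\<in>I. \<Sum>j\<in>I. l i * l j * total_variance (min (\<tau> i) (\<tau> j))) / 2))"
    by (simp add: cis_conv_exp algebra_simps flip: exp_add)
  also have "(\<Sum>i\<in>I. l i * (a i + b * total_variance (\<tau> i))) - s
      = (b - 1/2) * (\<Sum>i\<in>I. l i * total_variance (\<tau> i))"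
    by (simp add: s_def sum_distrib_left algebra_simps flip: sum_subtractf)
  finally show ?thesis .
qed

text \<open>The exponent of the density of \<open>Q1\<close> with respect to \<open>P\<close>, a Wiener integral of \<open>\<theta> + \<sigma>\<close>.\<close>

definition X1 where "X1 \<omega> = Z \<omega> + Y T \<omega>"

lemma X1: "wiener_pair (\<lambda>u. \<theta> u + 1 * \<sigma> u) X1"
proof -
  have "wiener_pair \<sigma> (Y T)" using T by (intro pair_initial_T[OF Y \<sigma>]) simp
  from wiener_pair_lincomb[OF Z this, of 1 1] show ?thesis
    by (simp add: X1_def[abs_def])
qed

lemma total_variance_T: "total_variance T = (sqnorm \<sigma>)"
  unfolding total_variance_def by (intro Bochner_Integration.integral_cong) auto

text \<open>Multiplying the densities of \<open>Q\<close> with respect to \<open>P\<close> and of \<open>Q1\<close> with respect to \<open>Q\<close>: the mixed term of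
  \<open>(\<theta> + \<sigma>)\<^sup>2\<close> is \<open>2 \<theta> \<sigma> = 2 r\<close>, so the result is again of the exponential form above.\<close>

lemma density_factor:
  "exp (Z \<omega> - 1/2 * (sqnorm \<theta>)) * exp (log_BS T \<omega>) = exp (X1 \<omega> - 1/2 * (sqnorm (\<lambda>u. \<theta> u + 1 * \<sigma> u)))"
proof -
  have "(sqnorm (\<lambda>u. \<theta> u + 1 * \<sigma> u)) = (\<integral>u. (\<theta> u)\<^sup>2 + (\<sigma> u)\<^sup>2 + 2 * (\<theta> u * \<sigma> u) \<partial>\<L>)"
    by (intro Bochner_Integration.integral_cong refl) (simp add: power2_eq_square algebra_simps)
  also have "\<dots> = (sqnorm \<theta>) + total_variance T + 2 * (inner_prod \<theta> \<sigma>)"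
    using \<theta> \<sigma> square_integrable_mult[OF \<theta> \<sigma>] by (simp add: square_integrable_def total_variance_T)
  also have "(inner_prod \<theta> \<sigma>) = (\<integral>u. indicator {0..T} u * r u \<partial>\<L>)"
  proof (rule integral_cong_AE)
    show "AE u in \<L>. \<theta> u * \<sigma> u = indicator {0..T} u * r u"
      using \<theta>_mult_\<sigma> AE_space by eventually_elim simp
    show "(\<lambda>u. indicator {0..T} u * r u) \<in> borel_measurable \<L>"
      using square_integrable_initial_mono[of T, OF _ r] T square_integrable_initial[of T r]
          by (simp add: square_integrable_def)
  qed (use square_integrable_mult[OF \<theta> \<sigma>] in simp)
  finally show ?thesis
    by (simp add: X1_def log_BS_def drifted_def algebra_simps flip: exp_add)
qed

abbreviation Q1 where "Q1 \<equiv> limit_Q1 P F T W r \<sigma> T"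

lemma subalgebra_Q: "t \<in> {0..T} \<Longrightarrow> subalgebra Q (F t)"
  using F_subalgebra by (simp add: subalgebra_def Q_eq)

lemma sets_Q1: "sets Q1 = sets (F T)" and space_Q1: "space Q1 = space P"
  using subalgebra_Q[of T] T by (simp_all add: limit_Q1_def limit_Q_def sets_restr_to_subalg
      space_restr_to_subalg Q_eq)

lemma nn_integral_Q1:
  assumes "f \<in> borel_measurable (F T)"
  shows "(\<integral>\<^sup>+\<omega>. f \<omega> \<partial>Q1) = (\<integral>\<^sup>+\<omega>. f \<omega> \<partial>girsanov (\<lambda>u. \<theta> u + 1 * \<sigma> u) X1)"
proof -
  have TT: "T \<in> {0..T}" using T by simp
  have prod_measurable: "(\<lambda>\<omega>. ennreal (BS_density P F T W r \<sigma> T \<omega>) * f \<omega>) \<in> borel_measurable (F T)"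
    using BS_density_eq(2)[OF TT] assms by measurable
  note [measurable] = F_measurable_P[OF TT assms] log_BS_measurable[OF TT] wiener_pair_measurable(1)[OF Z]
      wiener_pair_measurable(1)[OF X1]
  have BSF: "BS_density P F T W r \<sigma> T \<in> borel_measurable (F T)" by (rule BS_density_eq(2)[OF TT])
  note [measurable] = F_measurable_P[OF TT BSF]
  have BSR: "BS_density P F T W r \<sigma> T \<in> borel_measurable (restr_to_subalg Q (F T))"
     "f \<in> borel_measurable (restr_to_subalg Q (F T))"
    using BSF assms by (simp_all cong: measurable_cong_sets add: sets_restr_to_subalg[OF subalgebra_Q[OF TT]])
  have "(\<integral>\<^sup>+\<omega>. f \<omega> \<partial>Q1) = (\<integral>\<^sup>+\<omega>. ennreal (BS_density P F T W r \<sigma> T \<omega>) * f \<omega> \<partial>restr_to_subalg Q (F T))"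
    unfolding limit_Q1_def limit_Q_def using BSR by (intro nn_integral_density) auto
  also have "\<dots> = (\<integral>\<^sup>+\<omega>. ennreal (BS_density P F T W r \<sigma> T \<omega>) * f \<omega> \<partial>Q)"
    by (intro nn_integral_subalgebra2 subalgebra_Q TT prod_measurable)
  also have "\<dots> = (\<integral>\<^sup>+\<omega>. ennreal (exp (Z \<omega> - 1/2 * (sqnorm \<theta>))) * (ennreal (BS_density P F T W r \<sigma> T \<omega>)
      * f \<omega>) \<partial>P)"
    unfolding Q_eq girsanov_def by (intro nn_integral_density) auto
  also have "\<dots> = (\<integral>\<^sup>+\<omega>. ennreal (exp (X1 \<omega> - 1/2 * (sqnorm (\<lambda>u. \<theta> u + 1 * \<sigma> u)))) * f \<omega> \<partial>P)"
  proof (rule nn_integral_cong_AE, use BS_density_eq(1)[OF TT] in eventually_elim)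
    case (elim \<omega>)
    show ?case
      by (simp only: elim density_factor[symmetric] mult.assoc[symmetric] ennreal_mult''[symmetric] exp_ge_zero)
  qed
  also have "\<dots> = (\<integral>\<^sup>+\<omega>. f \<omega> \<partial>girsanov (\<lambda>u. \<theta> u + 1 * \<sigma> u) X1)"
    unfolding girsanov_def by (intro nn_integral_density[symmetric]) auto
  finally show ?thesis .
qed

lemma Q1_eq: "Q1 = restr_to_subalg (girsanov (\<lambda>u. \<theta> u + 1 * \<sigma> u) X1) (F T)"
proof (rule measure_eqI)
  have TT: "T \<in> {0..T}" using T by simp
  have sub: "subalgebra (girsanov (\<lambda>u. \<theta> u + 1 * \<sigma> u) X1) (F T)"
    using F_subalgebra[OF TT] by (simp add: subalgebra_def)
  show "sets Q1 = sets (restr_to_subalg (girsanov (\<lambda>u. \<theta> u + 1 * \<sigma> u) X1) (F T))"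
    unfolding sets_Q1 sets_restr_to_subalg[OF sub] by (rule refl)
  fix B assume B: "B \<in> sets Q1"
  then have BF: "B \<in> sets (F T)" by (simp add: sets_Q1)
  have "emeasure Q1 B = (\<integral>\<^sup>+\<omega>. indicator B \<omega> \<partial>Q1)" using B by simp
  also have "\<dots> = (\<integral>\<^sup>+\<omega>. indicator B \<omega> \<partial>girsanov (\<lambda>u. \<theta> u + 1 * \<sigma> u) X1)"
    using BF by (intro nn_integral_Q1) simp
  also have "\<dots> = emeasure (restr_to_subalg (girsanov (\<lambda>u. \<theta> u + 1 * \<sigma> u) X1) (F T)) B"
    using BF sub by (simp add: emeasure_restr_to_subalg subalgebra_def subset_eq)
  finally show "emeasure Q1 B = emeasure (restr_to_subalg (girsanov (\<lambda>u. \<theta> u + 1 * \<sigma> u) X1) (F T)) B" .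
qed

end

section \<open>Expansion of the one-period characteristic function\<close>

lemma complex_powr_of_real:
  assumes "0 < x"
  shows "(of_real x :: complex) powr \<kappa> = exp (\<kappa> * of_real (ln x))"
  using assms by (simp add: powr_def Ln_of_real)

text \<open>Taylor's theorem for the complex power \<open>(1 + u)\<^sup>\<kappa>\<close> at \<open>u = 0\<close>. As \<open>Re \<kappa> \<le> 1\<close>, all derivatives of order
  \<open>i \<ge> 1\<close> are bounded on \<open>u \<ge> - 1/2\<close>: their exponent \<open>Re \<kappa> - i\<close> is not positive.\<close>

lemma binomial_remainder:
  fixes \<kappa> :: complex
  assumes \<kappa>: "0 \<le> Re \<kappa>" "Re \<kappa> \<le> 1" and u: "- 1/2 \<le> u"
  shows "norm (exp (\<kappa> * of_real (ln (1 + u))) - (\<Sum>i\<le>n. (\<Prod>j<i. \<kappa> - of_nat j) * of_real u ^ i / fact i))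
     \<le> (\<Prod>j<Suc n. norm \<kappa> + real j) * 2 ^ Suc n * \<bar>u\<bar> ^ Suc n"
proof -
  define S :: "complex set" where "S = {z. - 1/2 \<le> Re z} \<inter> {z. Im z = 0}"
  define c where "c i = (\<Prod>j<i. \<kappa> - of_nat j)" for i
  define f where "f i z = c i * (1 + z) powr (\<kappa> - of_nat i)" for i and z :: complex
  define B where "B = (\<Prod>j<Suc n. norm \<kappa> + real j) * 2 ^ Suc n"
  have cnv: "convex S"
    unfolding S_def by (intro convex_Int convex_halfspace_Re_ge) (simp add: convex_def)
  have S1: "1 + z \<notin> \<real>\<^sub>\<le>\<^sub>0" "1 + z \<in> \<real>" "1 / 2 \<le> Re (1 + z)" if "z \<in> S" for z
    using that by (auto simp: S_def complex_nonpos_Reals_iff complex_is_Real_iff)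
  have der: "(f i has_field_derivative f (Suc i) z) (at z within S)" if "z \<in> S" for i z
  proof -
    have "((\<lambda>z. c i * (1 + z) powr (\<kappa> - of_nat i)) has_field_derivative
        c i * ((\<kappa> - of_nat i) * (1 + z) powr (\<kappa> - of_nat i - 1) * (0 + 1))) (at z)"
      by (intro DERIV_cmult DERIV_chain2[where f="\<lambda>z. z powr (\<kappa>
          - of_nat i)"] has_field_derivative_powr S1(1)[OF that] DERIV_add DERIV_const DERIV_ident)
    moreover have "c i * ((\<kappa> - of_nat i) * (1 + z) powr (\<kappa> - of_nat i - 1) * (0 + 1)) = f (Suc i) z"
      by (simp add: f_def c_def algebra_simps)
    ultimately have "((\<lambda>z. c i * (1 + z) powr (\<kappa> - of_nat i)) has_field_derivative f (Suc i) z) (at z)"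
      by (simp only:)
    moreover have "f i = (\<lambda>z. c i * (1 + z) powr (\<kappa> - of_nat i))"
      by (rule ext) (simp add: f_def)
    ultimately show ?thesis
      by (simp only: has_field_derivative_at_within)
  qed
  have pw: "norm ((1 + z) powr (\<kappa> - of_nat i)) \<le> 2 ^ i" if "z \<in> S" "i > 0" for z i
  proof -
    have a: "Re \<kappa> - real i \<le> 0" using \<kappa> that by simp
    have "norm ((1 + z) powr (\<kappa> - of_nat i)) = Re (1 + z) powr (Re \<kappa> - real i)"
      using S1[OF that(1)] by (subst norm_powr_real_powr) auto
    also have "\<dots> \<le> (1 / 2) powr (Re \<kappa> - real i)"
      using S1(3)[OF that(1)] a by (intro powr_mono2') auto
    also have "\<dots> \<le> (1 / 2) powr (- real i)"
      using \<kappa> by (intro powr_mono') auto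
    also have "\<dots> = 2 ^ i"
      by (simp add: powr_minus powr_realpow power_one_over field_simps)
    finally show ?thesis .
  qed
  have cb: "norm (c i) \<le> (\<Prod>j<i. norm \<kappa> + real j)" for i
    unfolding c_def prod_norm[symmetric] by (intro prod_mono) (auto intro: order_trans[OF norm_triangle_ineq4])
  have pn: "0 \<le> (\<Prod>j<Suc n. norm \<kappa> + real j)" by (intro prod_nonneg) auto
  have B0: "0 \<le> B" unfolding B_def using pn by (intro mult_nonneg_nonneg) auto
  have bound: "norm (f (Suc n) z) \<le> B" if "z \<in> S" for z
    unfolding f_def norm_mult B_def by (intro mult_mono cb pw that pn) auto
  have "norm (f 0 (of_real u) - (\<Sum>i\<le>n. f i 0 * (of_real u - 0) ^ i / fact i))
      \<le> B * norm (complex_of_real u - 0) ^ Suc n / fact n"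
    by (rule field_Taylor[OF cnv der bound]) (use u in \<open>auto simp: S_def\<close>)
  also have "\<dots> \<le> B * norm (complex_of_real u - 0) ^ Suc n / 1"
    using B0 by (intro divide_left_mono) auto
  finally show ?thesis
    using u complex_powr_of_real[of "1 + u" \<kappa>] by (simp add: f_def c_def B_def)
qed

definition binomial_const :: "real \<Rightarrow> real" where "binomial_const B = 8 * (B + 2) ^ 3"

text \<open>One constant for the first three Taylor remainders and for the coefficients.\<close>

lemma binomial_bounds:
  fixes \<kappa> :: complex
  assumes \<kappa>: "0 \<le> Re \<kappa>" "Re \<kappa> \<le> 1" "norm \<kappa> \<le> B" and u: "- 1/2 \<le> u"
  defines "f \<equiv> exp (\<kappa> * of_real (ln (1 + u)))" and "D \<equiv> binomial_const B"
  shows "norm (f - 1) \<le> D * \<bar>u\<bar>"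
    "norm (f - 1 - \<kappa> * of_real u) \<le> D * \<bar>u\<bar>\<^sup>2"
    "norm (f - 1 - \<kappa> * of_real u - \<kappa> * (\<kappa> - 1) / 2 * (of_real u)\<^sup>2) \<le> D * \<bar>u\<bar> ^ 3"
    "norm \<kappa> \<le> D" "norm (\<kappa> * (\<kappa> - 1) / 2) \<le> D"
proof -
  have B: "0 \<le> B" using \<kappa>(3) norm_ge_zero order_trans by blast
  have p1: "norm \<kappa> \<le> B + 2" "norm \<kappa> + 1 \<le> B + 2" "norm \<kappa> + 2 \<le> B + 2" "1 \<le> B + 2" using \<kappa> B by auto
  have D1: "(B + 2) * 2 \<le> D" "(B + 2) * (B + 2) * 4 \<le> D" "(B + 2) * (B + 2) * (B + 2) * 8 \<le> D"
  proof -
    define L where "L = B + 2"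
    have a: "L \<le> L * L" "L * L \<le> L * L * L" "0 \<le> L * L" "0 \<le> L"
      using B by (simp_all add: L_def)
    have D: "D = 8 * (L * L * L)"
      by (simp add: D_def binomial_const_def power3_eq_cube L_def)
    show "(B + 2) * 2 \<le> D" using a unfolding D L_def[symmetric] by linarith
    show "(B + 2) * (B + 2) * 4 \<le> D" using a unfolding D L_def[symmetric] by linarith
    show "(B + 2) * (B + 2) * (B + 2) * 8 \<le> D" unfolding D L_def[symmetric] by simp
  qed
  have q1: "norm \<kappa> * (norm \<kappa> + 1) \<le> (B + 2) * (B + 2)"
    using p1 B by (intro mult_mono) auto
  have q2: "norm \<kappa> * (norm \<kappa> + 1) * (norm \<kappa> + 2) \<le> (B + 2) * (B + 2) * (B + 2)"
    using p1 B q1 by (intro mult_mono) auto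
  have "B + 2 \<le> (B + 2) * 2" using B by simp
  then show nk: "norm \<kappa> \<le> D" using p1(1) D1(1) by linarith
  have "norm (\<kappa> * (\<kappa> - 1)) \<le> norm \<kappa> * (norm \<kappa> + 1)"
    unfolding norm_mult using norm_triangle_ineq4[of \<kappa> 1] by (intro mult_left_mono) auto
  also have "\<dots> \<le> (B + 2) * (B + 2)" by (rule q1)
  also have "\<dots> \<le> (B + 2) * (B + 2) * 4" by simp
  also have "\<dots> \<le> D" by (rule D1)
  finally have "norm (\<kappa> * (\<kappa> - 1)) / 2 \<le> D"
    using norm_ge_zero[of "\<kappa> * (\<kappa> - 1)"] by linarith
  then show "norm (\<kappa> * (\<kappa> - 1) / 2) \<le> D"
    by (simp only: norm_divide norm_numeral)
  have "norm (f - 1) \<le> norm \<kappa> * 2 * \<bar>u\<bar>"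
    using binomial_remainder[OF \<kappa>(1,2) u, of 0] by (simp add: f_def)
  also have "\<dots> \<le> D * \<bar>u\<bar>"
    using p1 D1 by (intro mult_right_mono) auto
  finally show "norm (f - 1) \<le> D * \<bar>u\<bar>" .
  have "norm (f - 1 - \<kappa> * of_real u) \<le> (norm \<kappa> * (norm \<kappa> + 1)) * 4 * \<bar>u\<bar>\<^sup>2"
    using binomial_remainder[OF \<kappa>(1,2) u, of 1] by (simp add: f_def numeral_2_eq_2 algebra_simps)
  also have "\<dots> \<le> D * \<bar>u\<bar>\<^sup>2"
    using q1 D1 by (intro mult_right_mono) auto
  finally show "norm (f - 1 - \<kappa> * of_real u) \<le> D * \<bar>u\<bar>\<^sup>2" .
  have "norm (f - 1 - \<kappa> * of_real u - \<kappa> * (\<kappa> - 1) / 2 * (of_real u)\<^sup>2)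
      \<le> (norm \<kappa> * (norm \<kappa> + 1) * (norm \<kappa> + 2)) * 8 * \<bar>u\<bar> ^ 3"
    using binomial_remainder[OF \<kappa>(1,2) u, of 2] by (simp add: f_def eval_nat_numeral diff_diff_eq)
  also have "\<dots> \<le> D * \<bar>u\<bar> ^ 3"
    using q2 D1 by (intro mult_right_mono) auto
  finally show "norm (f - 1 - \<kappa> * of_real u - \<kappa> * (\<kappa> - 1) / 2 * (of_real u)\<^sup>2) \<le> D * \<bar>u\<bar> ^ 3" .
qed

text \<open>The expansion to second order in \<open>y\<close>, which stands for a value of \<open>g\<close>. Only second moments of \<open>g\<close> are finite, so
  the cubic remainder is used for small and the quadratic one for large \<open>h |y|\<close>; together
  they give \<open>h\<^sup>2 y\<^sup>2 min 1 (h |y|)\<close>.\<close>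

lemma one_period_pointwise:
  fixes \<kappa> :: complex
  assumes \<kappa>: "0 \<le> Re \<kappa>" "Re \<kappa> \<le> 1" "norm \<kappa> \<le> B"
    and h: "0 < h" and s: "0 \<le> s" "s \<le> K" and q: "0 \<le> q" "q \<le> K" and u: "- 1/2 \<le> s * h * y"
  shows "norm (of_real (1 + q * h * y) * exp (\<kappa> * of_real (ln (1 + s * h * y)))
     - (1 + of_real y * ((\<kappa> * of_real s + of_real q) * of_real h)
         + of_real (y\<^sup>2) * (of_real (h\<^sup>2) * (\<kappa> * of_real (s * q) + \<kappa> * (\<kappa> - 1) / 2 * of_real (s\<^sup>2)))))
    \<le> 4 * binomial_const B * K\<^sup>2 * (K + 1) * h\<^sup>2 * (y\<^sup>2 * min 1 (h * \<bar>y\<bar>))"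
proof -
  define D where "D = binomial_const B"
  define u where "u = s * h * y"
  define f where "f = exp (\<kappa> * of_real (ln (1 + u)))"
  define R1 where "R1 = f - 1 - \<kappa> * of_real u"
  define R2 where "R2 = f - 1 - \<kappa> * of_real u - \<kappa> * (\<kappa> - 1) / 2 * (of_real u)\<^sup>2"
  define x where "x = h * \<bar>y\<bar>"
  have x0: "0 \<le> x" using h by (simp add: x_def)
  have K: "0 \<le> K" using s by simp
  have bb: "norm (f - 1) \<le> D * \<bar>u\<bar>" "norm R1 \<le> D * \<bar>u\<bar>\<^sup>2" "norm R2 \<le> D * \<bar>u\<bar> ^ 3"
     "norm \<kappa> \<le> D" "norm (\<kappa> * (\<kappa> - 1) / 2) \<le> D"
    unfolding f_def D_def R1_def R2_def
    by (rule binomial_bounds[OF \<kappa>]; use assms in \<open>simp add: u_def\<close>)+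
  have D: "0 \<le> D" using bb(4) norm_ge_zero order_trans by blast
  have ux: "\<bar>u\<bar> \<le> K * x"
    using s h by (simp add: u_def x_def abs_mult mult.assoc mult_right_mono)
  have R1a: "norm R1 \<le> 2 * D * \<bar>u\<bar>"
  proof -
    have "norm R1 \<le> norm (f - 1) + norm (\<kappa> * of_real u)"
      unfolding R1_def by (rule norm_triangle_ineq4)
    also have "norm (\<kappa> * of_real u) \<le> D * \<bar>u\<bar>"
      using bb(4) by (simp add: norm_mult mult_right_mono)
    finally show ?thesis using bb(1) by linarith
  qed
  have R2a: "norm R2 \<le> 2 * D * \<bar>u\<bar>\<^sup>2"
  proof -
    have "norm R2 \<le> norm R1 + norm (\<kappa> * (\<kappa> - 1) / 2 * (of_real u)\<^sup>2)"
      unfolding R2_def R1_def by (rule norm_triangle_ineq4)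
    also have "norm (\<kappa> * (\<kappa> - 1) / 2 * (of_real u)\<^sup>2) \<le> D * \<bar>u\<bar>\<^sup>2"
      using bb(5) unfolding norm_mult norm_power norm_of_real by (rule mult_right_mono) simp
    finally show ?thesis using bb(2) by linarith
  qed
  have m: "min 1 \<bar>u\<bar> \<le> (K + 1) * min 1 x"
  proof (cases "x \<le> 1")
    case True
    then show ?thesis using ux x0 by (simp add: min_def distrib_right)
  next
    case False
    then show ?thesis using K by (simp add: min_def)
  qed
  have R1b: "norm R1 \<le> 2 * D * \<bar>u\<bar> * min 1 \<bar>u\<bar>"
  proof (cases "\<bar>u\<bar> \<le> 1")
    case True
    have "D * \<bar>u\<bar>\<^sup>2 \<le> 2 * (D * \<bar>u\<bar>\<^sup>2)" using D by simp
    then show ?thesis using bb(2) True by (simp add: min_def power2_eq_square mult.assoc)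
  qed (use R1a in simp)
  have R2b: "norm R2 \<le> 2 * D * \<bar>u\<bar>\<^sup>2 * min 1 \<bar>u\<bar>"
  proof (cases "\<bar>u\<bar> \<le> 1")
    case True
    have "D * \<bar>u\<bar> ^ 3 \<le> 2 * (D * \<bar>u\<bar> ^ 3)" using D by simp
    then show ?thesis using bb(3) True by (simp add: min_def power2_eq_square power3_eq_cube mult.assoc)
  qed (use R2a in simp)
  have uu: "\<bar>u\<bar>\<^sup>2 \<le> (K * x)\<^sup>2" using ux by (intro power_mono) auto
  have "norm R2 \<le> 2 * D * (K * x)\<^sup>2 * ((K + 1) * min 1 x)"
    by (rule order_trans[OF R2b], intro mult_mono mult_left_mono uu m) (use D K x0 in auto)
  moreover have "norm (of_real (q * h * y) * R1) \<le> (K * x) * (2 * D * (K * x) * ((K + 1) * min 1 x))"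
    unfolding norm_mult
  proof (rule mult_mono)
    show "norm (of_real (q * h * y) :: complex) \<le> K * x"
      using q h unfolding norm_of_real by (simp add: x_def abs_mult mult.assoc mult_right_mono)
    show "norm R1 \<le> 2 * D * (K * x) * ((K + 1) * min 1 x)"
      by (rule order_trans[OF R1b], intro mult_mono mult_left_mono ux m) (use D K x0 in auto)
  qed (use K x0 in auto)
  moreover have "norm (R2 + of_real (q * h * y) * R1) \<le> norm R2 + norm (of_real (q * h * y) * R1)"
    by (rule norm_triangle_ineq)
  moreover have "2 * D * (K * x)\<^sup>2 * ((K + 1) * min 1 x) + (K * x) * (2 * D * (K * x) * ((K + 1) * min 1 x))
    = 4 * D * K\<^sup>2 * (K + 1) * (x\<^sup>2 * min 1 x)"
    by (simp add: power2_eq_square algebra_simps)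
  ultimately have "norm (R2 + of_real (q * h * y) * R1) \<le> 4 * D * K\<^sup>2 * (K + 1) * (x\<^sup>2 * min 1 x)"
    by linarith
  also have "R2 + of_real (q * h * y) * R1 = of_real (1 + q * h * y) * exp (\<kappa> * of_real (ln (1 + s * h * y)))
     - (1 + of_real y * ((\<kappa> * of_real s + of_real q) * of_real h)
         + of_real (y\<^sup>2) * (of_real (h\<^sup>2) * (\<kappa> * of_real (s * q) + \<kappa> * (\<kappa> - 1) / 2 * of_real (s\<^sup>2))))"
  proof -
    have "R2 + of_real (q * h * y) * R1 = of_real (1 + q * h * y) * f
     - (1 + of_real y * ((\<kappa> * of_real s + of_real q) * of_real h)
         + of_real (y\<^sup>2) * (of_real (h\<^sup>2) * (\<kappa> * of_real (s * q) + \<kappa> * (\<kappa> - 1) / 2 * of_real (s\<^sup>2))))"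
      by (simp add: R1_def R2_def u_def power2_eq_square algebra_simps)
    then show ?thesis by (simp only: f_def u_def)
  qed
  also have "x\<^sup>2 * min 1 x = h\<^sup>2 * (y\<^sup>2 * min 1 (h * \<bar>y\<bar>))"
    by (simp add: x_def power_mult_distrib)
  finally show ?thesis by (simp add: D_def mult.assoc)
qed

text \<open>Bounds the remainder of the expansion, divided by \<open>h\<^sup>2\<close>; by dominated convergence it vanishes as \<open>h \<rightarrow> 0\<close>.\<close>

definition trunc_moment :: "'a measure \<Rightarrow> ('a \<Rightarrow> real) \<Rightarrow> real \<Rightarrow> real" where
  "trunc_moment P0 g h = (\<integral>y. (g y)\<^sup>2 * min 1 (h * \<bar>g y\<bar>) \<partial>P0)"

lemma trunc_moment_integrable:
  assumes "square_integrable P0 g" "0 \<le> h"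
  shows "integrable P0 (\<lambda>y. (g y)\<^sup>2 * min 1 (h * \<bar>g y\<bar>))"
proof (rule Bochner_Integration.integrable_bound)
  show "integrable P0 (\<lambda>y. (g y)\<^sup>2)" using assms(1) by (rule square_integrable_integrable)
  show "(\<lambda>y. (g y)\<^sup>2 * min 1 (h * \<bar>g y\<bar>)) \<in> borel_measurable P0"
    using assms(1) by (auto simp: square_integrable_def)
  show "AE y in P0. norm ((g y)\<^sup>2 * min 1 (h * \<bar>g y\<bar>)) \<le> norm ((g y)\<^sup>2)"
    using assms(2) by (intro AE_I2) (simp add: abs_mult mult_left_le)
qed

lemma trunc_moment_tendsto:
  assumes g: "square_integrable P0 g" and h: "hs \<longlonglongrightarrow> 0" "\<And>n. 0 \<le> hs n"
  shows "(\<lambda>n. trunc_moment P0 g (hs n)) \<longlonglongrightarrow> 0"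
proof -
  have "(\<lambda>n. trunc_moment P0 g (hs n)) \<longlonglongrightarrow> (\<integral>y. 0 \<partial>P0)"
    unfolding trunc_moment_def
  proof (rule integral_dominated_convergence)
    show "integrable P0 (\<lambda>y. (g y)\<^sup>2)" using g by (rule square_integrable_integrable)
    show "AE y in P0. (\<lambda>n. (g y)\<^sup>2 * min 1 (hs n * \<bar>g y\<bar>)) \<longlonglongrightarrow> 0"
    proof (rule AE_I2)
      fix y
      have "(\<lambda>n. (g y)\<^sup>2 * min 1 (hs n * \<bar>g y\<bar>)) \<longlonglongrightarrow> (g y)\<^sup>2 * min 1 (0 * \<bar>g y\<bar>)"
        by (intro tendsto_intros h)
      then show "(\<lambda>n. (g y)\<^sup>2 * min 1 (hs n * \<bar>g y\<bar>)) \<longlonglongrightarrow> 0" by simp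
    qed
    show "AE y in P0. norm ((g y)\<^sup>2 * min 1 (hs n * \<bar>g y\<bar>)) \<le> (g y)\<^sup>2" for n
      using h(2) by (intro AE_I2) (simp add: abs_mult mult_left_le)
    show "(\<lambda>y. (g y)\<^sup>2 * min 1 (hs n * \<bar>g y\<bar>)) \<in> borel_measurable P0" for n
      using g by (auto simp: square_integrable_def)
  qed auto
  then show ?thesis by simp
qed

lemma trunc_moment_nonneg: "0 \<le> h \<Longrightarrow> 0 \<le> trunc_moment P0 g h"
  unfolding trunc_moment_def by (intro integral_nonneg_AE AE_I2) simp

lemma one_period_expansion:
  fixes \<kappa> :: complex
  assumes P0: "prob_space P0" and g: "square_integrable P0 g" "(\<integral>x. g x \<partial>P0) = 0" "(\<integral>x. (g x)\<^sup>2 \<partial>P0) = 1"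
    and \<kappa>: "0 \<le> Re \<kappa>" "Re \<kappa> \<le> 1" "norm \<kappa> \<le> B"
    and h: "0 < h" and s: "0 \<le> s" "s \<le> K" and q: "0 \<le> q" "q \<le> K" and u: "\<And>y. y \<in> space P0 \<Longrightarrow> - 1/2 \<le> s * h * g y"
  shows "norm ((\<integral>y. of_real (1 + q * h * g y) * exp (\<kappa> * of_real (ln (1 + s * h * g y))) \<partial>P0)
     - (1 + of_real (h\<^sup>2) * (\<kappa> * of_real (s * q) + \<kappa> * (\<kappa> - 1) / 2 * of_real (s\<^sup>2))))
    \<le> 4 * binomial_const B * K\<^sup>2 * (K + 1) * h\<^sup>2 * trunc_moment P0 g h"
proof -
  interpret prob_space P0 by fact
  define f where "f y = of_real (1 + q * h * g y) * exp (\<kappa> * of_real (ln (1 + s * h * g y)))" for y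
  define b where "b = of_real (h\<^sup>2) * (\<kappa> * of_real (s * q) + \<kappa> * (\<kappa> - 1) / 2 * of_real (s\<^sup>2))"
  define a where "a = (\<kappa> * of_real s + of_real q) * of_real h"
  define M where "M y = 1 + of_real (g y) * a + of_real ((g y)\<^sup>2) * b" for y
  define C where "C = 4 * binomial_const B * K\<^sup>2 * (K + 1) * h\<^sup>2"
  have gm[measurable]: "g \<in> borel_measurable P0" using g(1) by (rule square_integrable_measurable)
  have "square_integrable P0 (\<lambda>x. 1)" by (simp add: square_integrable_def)
  from square_integrable_mult[OF g(1) this] have ig: "integrable P0 g" by simp
  have ig2: "integrable P0 (\<lambda>y. (g y)\<^sup>2)" using g(1) by (rule square_integrable_integrable)
  have i1: "integrable P0 (\<lambda>y. complex_of_real (g y) * a)" "integrable P0 (\<lambda>y. complex_of_real ((g y)\<^sup>2) * b)"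
    by (intro integrable_mult_left integrable_of_real ig ig2)+
  have iM: "integrable P0 M"
    unfolding M_def by (intro Bochner_Integration.integrable_add i1 integrable_const)
  have eM: "(\<integral>y. M y \<partial>P0) = 1 + b"
  proof -
    have "(\<integral>y. M y \<partial>P0) = (\<integral>y. 1 + complex_of_real (g y) * a \<partial>P0) + (\<integral>y. complex_of_real ((g y)\<^sup>2) * b \<partial>P0)"
      unfolding M_def by (intro Bochner_Integration.integral_add Bochner_Integration.integrable_add i1
          integrable_const)
    also have "(\<integral>y. 1 + complex_of_real (g y) * a \<partial>P0) = (\<integral>y. 1 \<partial>P0) + (\<integral>y. complex_of_real (g y) * a \<partial>P0)"
      by (intro Bochner_Integration.integral_add i1 integrable_const)
    finally show ?thesis
      by (simp only: integral_mult_left_zero integral_complex_of_real g) (simp add: prob_space)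
  qed
  have pt: "norm (f y - M y) \<le> C * ((g y)\<^sup>2 * min 1 (h * \<bar>g y\<bar>))" if "y \<in> space P0" for y
    using one_period_pointwise[OF \<kappa> h s q u[OF that]] by (simp add: f_def M_def a_def b_def C_def)
  have iR: "integrable P0 (\<lambda>y. C * ((g y)\<^sup>2 * min 1 (h * \<bar>g y\<bar>)))"
    using trunc_moment_integrable[OF g(1)] h by simp
  have fm: "f \<in> borel_measurable P0" unfolding f_def by measurable
  have id: "integrable P0 (\<lambda>y. f y - M y)"
    by (rule Bochner_Integration.integrable_bound[OF iR])
       (use fm iM pt in \<open>auto intro!: AE_I2 intro: order_trans[OF _ abs_ge_self]\<close>)
  then have "integrable P0 (\<lambda>y. (f y - M y) + M y)" using iM by (rule Bochner_Integration.integrable_add)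
  then have "integrable P0 f" by simp
  then have "(\<integral>y. f y \<partial>P0) - (1 + b) = (\<integral>y. f y - M y \<partial>P0)"
    using iM by (simp add: eM)
  also have "norm \<dots> \<le> (\<integral>y. C * ((g y)\<^sup>2 * min 1 (h * \<bar>g y\<bar>)) \<partial>P0)"
    by (rule norm_integral_le[OF id iR pt])
  finally show ?thesis
    unfolding f_def b_def C_def trunc_moment_def by simp
qed

definition one_period_const :: "real \<Rightarrow> real \<Rightarrow> real" where
  "one_period_const B K = 4 * binomial_const B * K\<^sup>2 * (K + 1)
     + exp (B * K\<^sup>2 + B * (B + 1) / 2 * K\<^sup>2) * (B * K\<^sup>2 + B * (B + 1) / 2 * K\<^sup>2)\<^sup>2
     + exp (B * K\<^sup>2 + B * (B + 1) / 2 * K\<^sup>2) * (2 * B * K ^ 4)"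

text \<open>Here \<open>s\<close> is the volatility and \<open>q\<close> the market price of risk of a period, so \<open>s * q\<close> is the interest
  rate. The expansion of the integral has the term \<open>\<kappa> s q h\<^sup>2\<close>, and the discount factor to the
  power \<open>- \<kappa>\<close> removes exactly this term.\<close>

lemma one_period_char:
  fixes \<kappa> :: complex
  assumes P0: "prob_space P0" and g: "square_integrable P0 g" "(\<integral>x. g x \<partial>P0) = 0" "(\<integral>x. (g x)\<^sup>2 \<partial>P0) = 1"
    and \<kappa>: "0 \<le> Re \<kappa>" "Re \<kappa> \<le> 1" "norm \<kappa> \<le> B" and h: "0 < h" "h \<le> 1" "h\<^sup>2 * K\<^sup>2 \<le> 1"
    and s: "0 \<le> s" "s \<le> K" and q: "0 \<le> q" "q \<le> K" and u: "\<And>y. y \<in> space P0 \<Longrightarrow> - 1/2 \<le> s * h * g y"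
  shows "norm ((\<integral>y. of_real (1 + q * h * g y) * exp (\<kappa> * of_real (ln (1
      + s * h * g y))) \<partial>P0) * exp (- \<kappa> * of_real (ln (1 + s * q * h\<^sup>2)))
       - exp (of_real (h\<^sup>2 * s\<^sup>2) * (\<kappa> * (\<kappa> - 1) / 2))) \<le> one_period_const B K * h\<^sup>2 * (trunc_moment P0 g h + h\<^sup>2)"
proof -
  have B: "0 \<le> B" using \<kappa>(3) norm_ge_zero order_trans by blast
  have K: "0 \<le> K" using s by simp
  define C where "C = 4 * binomial_const B * K\<^sup>2 * (K + 1)"
  define m where "m = B * K\<^sup>2 + B * (B + 1) / 2 * K\<^sup>2"
  define D where "D = C + exp m * m\<^sup>2 + exp m * (2 * B * K ^ 4)"
  have D_eq: "one_period_const B K = D"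
    unfolding one_period_const_def D_def C_def m_def ..
  have C0: "0 \<le> C" using B K by (simp add: C_def binomial_const_def)
  have m0: "0 \<le> m" using B K by (simp add: m_def)
  have D0: "0 \<le> D" using C0 m0 B K by (simp add: D_def)
  define E where "E = (\<integral>y. of_real (1 + q * h * g y) * exp (\<kappa> * of_real (ln (1 + s * h * g y))) \<partial>P0)"
  define c where "c = \<kappa> * of_real (s * q) + \<kappa> * (\<kappa> - 1) / 2 * of_real (s\<^sup>2)"
  define x where "x = of_real (h\<^sup>2) * c"
  define p where "p = exp (- \<kappa> * of_real (ln (1 + s * q * h\<^sup>2)))"
  define p' where "p' = exp (- \<kappa> * of_real (s * q * h\<^sup>2))"
  have h2: "h\<^sup>2 \<le> 1" using h by (simp add: power_le_one)
  have sq: "0 \<le> s * q" "s * q \<le> K\<^sup>2" "s\<^sup>2 \<le> K\<^sup>2"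
    using s q K by (auto simp: power2_eq_square intro!: mult_mono)
  have sqh: "0 \<le> s * q * h\<^sup>2" "s * q * h\<^sup>2 \<le> K\<^sup>2 * h\<^sup>2"
    using sq by (auto intro!: mult_right_mono)
  have cb: "norm c \<le> m"
  proof -
    have "norm (\<kappa> - 1) \<le> B + 1" using norm_triangle_ineq4[of \<kappa> 1] \<kappa> by simp
    then have "norm (\<kappa> * (\<kappa> - 1) / 2 * of_real (s\<^sup>2)) \<le> B * (B + 1) / 2 * K\<^sup>2"
      using \<kappa> sq B unfolding norm_mult norm_divide by (auto intro!: mult_mono divide_right_mono simp:
          norm_power)
    moreover have "norm (\<kappa> * of_real (s * q)) \<le> B * K\<^sup>2"
      unfolding norm_mult norm_of_real using \<kappa> sq B by (intro mult_mono) auto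
    ultimately show ?thesis
      unfolding c_def m_def by (intro order_trans[OF norm_triangle_ineq] add_mono)
  qed
  have xb: "norm x \<le> m * h\<^sup>2" "norm x \<le> m"
  proof -
    show "norm x \<le> m * h\<^sup>2" unfolding x_def norm_mult using cb
        by (simp add: norm_power mult.commute mult_right_mono)
    also have "\<dots> \<le> m" using h2 m0 by (simp add: mult_left_le)
    finally show "norm x \<le> m" .
  qed
  have t1: "norm (E - (1 + x)) \<le> C * h\<^sup>2 * trunc_moment P0 g h"
    using one_period_expansion[OF P0 g \<kappa> h(1) s q u] by (simp add: E_def x_def c_def C_def)
  have t2: "norm (1 + x - exp x) \<le> exp m * m\<^sup>2 * h\<^sup>2 * h\<^sup>2"
  proof -
    have "norm (exp x - (\<Sum>i\<le>1. x ^ i / fact i)) \<le> exp \<bar>Re x\<bar> * norm x ^ Suc 1 / fact 1"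
      by (rule Taylor_exp)
    also have "(\<Sum>i\<le>1. x ^ i / fact i) = 1 + x" by simp
    also have "exp \<bar>Re x\<bar> * norm x ^ Suc 1 / fact 1 \<le> exp m * (m * h\<^sup>2)\<^sup>2"
      using xb abs_Re_le_cmod[of x] by (auto simp: power2_eq_square intro!: mult_mono)
    finally show ?thesis by (simp add: norm_minus_commute power2_eq_square mult_ac)
  qed
  have t3: "norm (p - p') \<le> 2 * B * K ^ 4 * h\<^sup>2 * h\<^sup>2"
  proof -
    define y where "y = s * q * h\<^sup>2"
    have y: "0 \<le> y" "y \<le> K\<^sup>2 * h\<^sup>2" "y \<le> 1" using sqh h(3) by (auto simp: y_def mult.commute)
    have ln: "\<bar>ln (1 + y) - y\<bar> \<le> y\<^sup>2"
      using y by (intro abs_ln_one_plus_x_minus_x_bound_nonneg) auto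
    have "norm (p - p') \<le> norm (- \<kappa> * of_real (ln (1 + y)) -
        - \<kappa> * of_real y) * (exp (Re (- \<kappa> * of_real (ln (1 + y)))) + exp (Re (- \<kappa> * of_real y)))"
      unfolding p_def p'_def y_def by (rule norm_exp_diff_le)
    also have "\<dots> \<le> (B * y\<^sup>2) * (1 + 1)"
    proof (rule mult_mono)
      have "- \<kappa> * of_real (ln (1 + y)) - - \<kappa> * of_real y = - \<kappa> * of_real (ln (1 + y) - y)"
        by (simp add: algebra_simps)
      then show "norm (- \<kappa> * of_real (ln (1 + y)) - - \<kappa> * of_real y) \<le> B * y\<^sup>2"
        using \<kappa>(3) ln B by (simp only: norm_mult norm_of_real norm_minus_cancel) (intro mult_mono, auto)
      show "exp (Re (- \<kappa> * of_real (ln (1 + y)))) + exp (Re (- \<kappa> * of_real y)) \<le> 1 + 1"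
        using \<kappa> y by (intro add_mono) auto
    qed (use B in auto)
    also have "\<dots> \<le> (B * (K\<^sup>2 * h\<^sup>2)\<^sup>2) * 2"
      using y B by (auto intro!: mult_left_mono power_mono)
    finally show ?thesis by (simp add: power2_eq_square power4_eq_xxxx mult_ac)
  qed
  have pb: "norm p \<le> 1" using \<kappa> sqh by (simp add: p_def)
  have eb: "norm (exp x) \<le> exp m"
    using xb(2) complex_Re_le_cmod[of x] by simp
  have w: "exp (of_real (h\<^sup>2 * s\<^sup>2) * (\<kappa> * (\<kappa> - 1) / 2)) = exp x * p'"
  proof -
    have "of_real (h\<^sup>2 * s\<^sup>2) * (\<kappa> * (\<kappa> - 1) / 2) = x + - \<kappa> * of_real (s * q * h\<^sup>2)"
      by (simp add: x_def c_def algebra_simps)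
    then show ?thesis by (simp only: p'_def exp_add)
  qed
  have "E * p - exp x * p' = (E - (1 + x)) * p + (1 + x - exp x) * p + exp x * (p - p')"
    by (simp add: algebra_simps)
  also have "norm \<dots> \<le> norm ((E - (1 + x)) * p) + norm ((1 + x - exp x) * p) + norm (exp x * (p - p'))"
    by (intro order_trans[OF norm_triangle_ineq] add_right_mono norm_triangle_ineq)
  also have "\<dots> \<le> C * h\<^sup>2 * trunc_moment P0 g h * 1 + exp m * m\<^sup>2 * h\<^sup>2 * h\<^sup>2 * 1
      + exp m * (2 * B * K ^ 4 * h\<^sup>2 * h\<^sup>2)"
    unfolding norm_mult using t1 t2 t3 pb eb
    by (intro add_mono mult_mono) (auto intro: order_trans[OF norm_ge_zero])
  also have "\<dots> = h\<^sup>2 * (C * trunc_moment P0 g h + (exp m * m\<^sup>2 + exp m * (2 * B * K ^ 4)) * h\<^sup>2)"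
    by (simp add: algebra_simps)
  also have "\<dots> \<le> h\<^sup>2 * (D * trunc_moment P0 g h + D * h\<^sup>2)"
    using trunc_moment_nonneg[of h P0 g] h C0 m0 B K
    by (intro mult_left_mono add_mono mult_right_mono) (auto simp: D_def)
  also have "\<dots> = D * h\<^sup>2 * (trunc_moment P0 g h + h\<^sup>2)"
    by (simp add: algebra_simps)
  finally show ?thesis
    unfolding D_eq w E_def p_def .
qed

section \<open>The discrete market\<close>

text \<open>Telescoping: factors of modulus at most one do not enlarge the errors of the other factors.\<close>

lemma norm_prod_diff_le:
  fixes z w :: "'i \<Rightarrow> complex"
  assumes "finite I" "\<And>i. i \<in> I \<Longrightarrow> norm (z i) \<le> 1" "\<And>i. i \<in> I \<Longrightarrow> norm (w i) \<le> 1"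
  shows "norm ((\<Prod>i\<in>I. z i) - (\<Prod>i\<in>I. w i)) \<le> (\<Sum>i\<in>I. norm (z i - w i))"
  using assms
proof (induction I rule: finite_induct)
  case (insert i I)
  have "(\<Prod>i\<in>insert i I. z i) - (\<Prod>i\<in>insert i I. w i) = (z i - w i) * (\<Prod>i\<in>I. z i)
      + w i * ((\<Prod>i\<in>I. z i) - (\<Prod>i\<in>I. w i))"
    using insert by (simp add: algebra_simps)
  also have "norm \<dots> \<le> norm (z i - w i) * norm (\<Prod>i\<in>I. z i) + norm (w i) * norm ((\<Prod>i\<in>I. z i) - (\<Prod>i\<in>I. w i))"
    by (intro order_trans[OF norm_triangle_ineq]) (simp add: norm_mult)
  also have "\<dots> \<le> norm (z i - w i) * 1 + 1 * (\<Sum>i\<in>I. norm (z i - w i))"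
    using insert by (intro add_mono mult_mono) (auto simp: prod_norm[symmetric] intro!: prod_le_1 prod_nonneg)
  finally show ?case using insert by simp
qed simp

locale discrete_market =
  fixes T R C \<delta> K :: real and rho sig :: "nat \<Rightarrow> nat \<Rightarrow> real" and P0 :: "'a measure" and g :: "'a \<Rightarrow> real"
  assumes T: "0 < T"
    and rates: "\<And>i N. 1 \<le> i \<Longrightarrow> i \<le> N \<Longrightarrow> 0 \<le> rho i N \<and> rho i N \<le> R"
    and P0: "prob_space P0"
    and g_sq: "square_integrable P0 g"
    and g_mean: "(\<integral>x. g x \<partial>P0) = 0"
    and g_var: "(\<integral>x. (g x)\<^sup>2 \<partial>P0) = 1"
    and C: "0 < C"
    and g_bound: "\<And>x. x \<in> space P0 \<Longrightarrow> - C < g x"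
    and \<delta>: "0 < \<delta>"
    and vol: "\<And>i N. 1 \<le> i \<Longrightarrow> i \<le> N \<Longrightarrow> \<delta> \<le> sig i N \<and> sig i N \<le> K"
begin

sublocale P0: prob_space P0 by (rule P0)

lemma g_measurable[measurable]: "g \<in> borel_measurable P0"
  using g_sq by (rule square_integrable_measurable)

lemma g_integrable: "integrable P0 g" "integrable P0 (\<lambda>y. (g y)\<^sup>2)"
proof -
  have "square_integrable P0 (\<lambda>x. 1)" by (simp add: square_integrable_def)
  from square_integrable_mult[OF g_sq this] show "integrable P0 g" by simp
  show "integrable P0 (\<lambda>y. (g y)\<^sup>2)" using g_sq by (rule square_integrable_integrable)
qed

definition h :: "nat \<Rightarrow> real" where "h N = sqrt T / sqrt (real N)"

text \<open>A common bound for the volatilities and the market prices of risk of all periods.\<close>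

definition bound :: real where "bound = max K (R / \<delta>)"

text \<open>The stages at which all parameters are admissible: path densities are at least \<open>1/2\<close> and the
  remainder estimates apply.\<close>

definition large :: "nat \<Rightarrow> bool" where
  "large N \<longleftrightarrow> 0 < N \<and> h N \<le> 1 \<and> (h N)\<^sup>2 * bound\<^sup>2 \<le> 1 \<and> bound * h N * C \<le> 1 / 2"

lemma h_square: "0 < N \<Longrightarrow> (h N)\<^sup>2 = T / real N"
  using T by (simp add: h_def power_divide)

lemma h_pos: "0 < N \<Longrightarrow> 0 < h N"
  using T by (simp add: h_def)

lemma h_nonneg: "0 \<le> h N"
  using T by (simp add: h_def)

lemma h_tendsto: "h \<longlonglongrightarrow> 0"
  unfolding h_def[abs_def]
  by (intro tendsto_divide_0[OF tendsto_const] filterlim_at_top_imp_at_infinity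
      filterlim_compose[OF sqrt_at_top filterlim_real_sequentially])

lemma eventually_large: "eventually large sequentially"
proof -
  have "(\<lambda>N. (h N)\<^sup>2 * bound\<^sup>2) \<longlonglongrightarrow> 0\<^sup>2 * bound\<^sup>2" "(\<lambda>N. bound * h N * C) \<longlonglongrightarrow> bound * 0 * C"
    by (intro tendsto_intros h_tendsto)+
  from order_tendstoD(2)[OF this(1), of 1] order_tendstoD(2)[OF this(2), of "1 / 2"]
  have "\<forall>\<^sub>F N in sequentially. (h N)\<^sup>2 * bound\<^sup>2 < 1" "\<forall>\<^sub>F N in sequentially. bound * h N * C < 1 / 2"
    by simp_all
  moreover have "\<forall>\<^sub>F N in sequentially. h N < 1"
    using h_tendsto by (rule order_tendstoD) simp
  ultimately show ?thesis
    using eventually_gt_at_top[of "0::nat"] unfolding large_def by eventually_elim simp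
qed

definition q :: "nat \<Rightarrow> nat \<Rightarrow> real" where "q k N = rho k N / sig k N"

context
  fixes N :: nat
  assumes N: "large N"
begin

lemma N_pos: "0 < N" and h0: "0 < h N"
  using N h_pos by (auto simp: large_def)

lemma parameters:
  assumes k: "k \<in> {1..N}"
  shows "0 \<le> sig k N" "sig k N \<le> bound" "0 \<le> q k N" "q k N \<le> bound" "sig k N * q k N = rho k N" "0 < sig k N"
proof -
  have s: "\<delta> \<le> sig k N" "sig k N \<le> K" and r: "0 \<le> rho k N" "rho k N \<le> R"
    using vol[of k N] rates[of k N] k by auto
  show "0 < sig k N" "0 \<le> sig k N" "sig k N \<le> bound" using s \<delta> by (auto simp: bound_def)
  show "0 \<le> q k N" using s r \<delta> by (simp add: q_def)
  have "rho k N / sig k N \<le> R / \<delta>" using s r \<delta> by (intro frac_le) auto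
  then show "q k N \<le> bound" by (simp add: q_def bound_def)
  show "sig k N * q k N = rho k N" using s \<delta> by (simp add: q_def)
qed

lemma density_ge_half:
  assumes "0 \<le> c" "c \<le> bound" "y \<in> space P0"
  shows "- 1 / 2 \<le> c * h N * g y"
proof -
  have "c * h N * C \<le> bound * h N * C"
    using assms h0 C by (intro mult_right_mono) auto
  also have "\<dots> \<le> 1 / 2" using N by (simp add: large_def)
  finally have "c * h N * C \<le> 1 / 2" .
  moreover have "c * h N * (- C) \<le> c * h N * g y"
    using assms h0 g_bound[OF assms(3)] by (intro mult_left_mono) auto
  ultimately show ?thesis by simp
qed

lemma path_density_eq: "path_density g (period_param T N c) y = 1 + c * h N * g y"
  by (simp add: path_density_def period_param_def h_def)

lemma discount_eq:
  assumes "k \<in> {1..N}"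
  shows "rho k N * T / real N = sig k N * q k N * (h N)\<^sup>2"
  using parameters(5)[OF assms] by (simp add: h_square[OF N_pos])

definition log_ratio :: "nat \<Rightarrow> 'a \<Rightarrow> real" where
  "log_ratio k y = ln (1 + sig k N * h N * g y) - ln (1 + sig k N * q k N * (h N)\<^sup>2)"

lemma discount_pos: "k \<in> {1..N} \<Longrightarrow> 0 < 1 + sig k N * q k N * (h N)\<^sup>2"
  using parameters(1,3)[of k] by (simp add: add_pos_nonneg)

lemma exp_log_ratio:
  assumes "k \<in> {1..N}" "y \<in> space P0"
  shows "discounted_ratio T rho sig g N k y = exp (log_ratio k y)"
proof -
  have "0 < 1 + sig k N * h N * g y"
    using density_ge_half[OF parameters(1,2)[OF assms(1)] assms(2)] by linarith
  then show ?thesis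
    using discount_pos[OF assms(1)]
    by (simp only: discounted_ratio_def path_density_eq discount_eq[OF assms(1)] log_ratio_def exp_diff exp_ln)
qed

lemma log_ratio_measurable[measurable]: "log_ratio k \<in> borel_measurable P0"
  unfolding log_ratio_def[abs_def] by measurable

lemma discounted_ratio_measurable[measurable]: "discounted_ratio T rho sig g N k \<in> borel_measurable P0"
  unfolding discounted_ratio_def[abs_def] path_density_def by measurable

text \<open>Both martingale measures are treated together; \<open>b\<close> tells whether the measure has the stock as
  numeraire.\<close>

definition period :: "bool \<Rightarrow> nat \<Rightarrow> 'a measure" where
  "period b k = (if b then period_Q1 T rho sig P0 g N k else period_Q T rho sig P0 g N k)"

definition weight :: "bool \<Rightarrow> nat \<Rightarrow> 'a \<Rightarrow> real" where
  "weight b k y = (1 + q k N * h N * g y) * (if b then discounted_ratio T rho sig g N k y else 1)"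

lemma weight_nonneg: "k \<in> {1..N} \<Longrightarrow> y \<in> space P0 \<Longrightarrow> 0 \<le> weight b k y"
  unfolding weight_def using density_ge_half[OF parameters(3,4), of k y]
  by (auto simp: exp_log_ratio intro!: mult_nonneg_nonneg)

lemma weight_measurable[measurable]: "weight b k \<in> borel_measurable P0"
  unfolding weight_def[abs_def] by (cases b) simp_all

lemma period_eq:
  assumes k: "k \<in> {1..N}"
  shows "period b k = density P0 (\<lambda>y. ennreal (weight b k y))"
proof -
  have Q: "period_Q T rho sig P0 g N k = density P0 (\<lambda>y. ennreal (1 + q k N * h N * g y))"
    unfolding period_Q_def path_measure_def path_density_eq q_def ..
  show ?thesis
  proof (cases b)
    case True
    have "period b k = density P0 (\<lambda>y. ennreal (1 + q k N * h N * g y)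
        * ennreal (discounted_ratio T rho sig g N k y))"
      using True by (simp add: period_def period_Q1_def Q density_density_eq)
    also have "\<dots> = density P0 (\<lambda>y. ennreal (weight b k y))"
    proof (rule density_cong)
      show "AE y in P0. ennreal (1 + q k N * h N * g y) * ennreal (discounted_ratio T rho sig g N k y)
          = ennreal (weight b k y)"
        using True by (intro AE_I2) (simp add: weight_def exp_log_ratio[OF k] ennreal_mult'')
    qed simp_all
    finally show ?thesis .
  next
    case False
    then show ?thesis by (simp add: period_def Q weight_def)
  qed
qed

lemma weight_integral:
  assumes k: "k \<in> {1..N}"
  shows "integrable P0 (weight b k)" "(\<integral>y. weight b k y \<partial>P0) = 1"
proof -
  define a where "a = q k N * h N"
  define d where "d = sig k N * h N"
  define e where "e = 1 + sig k N * q k N * (h N)\<^sup>2"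
  have e: "0 < e" "1 + a * d = e" using discount_pos[OF k] by (simp_all add: e_def a_def d_def power2_eq_square)
  have "integrable P0 (weight b k) \<and> (\<integral>y. weight b k y \<partial>P0) = 1"
  proof (cases b)
    case True
    have "weight b k y = (1 + a * g y) * ((1 + d * g y) / e)" for y
      by (simp only: weight_def discounted_ratio_def path_density_eq discount_eq[OF k] a_def d_def e_def
          True if_True)
    then have w: "weight b k = (\<lambda>y. (1 + (a + d) * g y + a * d * (g y)\<^sup>2) / e)"
      by (simp add: fun_eq_iff power2_eq_square algebra_simps)
    have i: "integrable P0 (\<lambda>y. 1 + (a + d) * g y)" "integrable P0 (\<lambda>y. a * d * (g y)\<^sup>2)"
      using g_integrable by auto
    have "(\<integral>y. weight b k y \<partial>P0) = (\<integral>y. 1 + (a + d) * g y + a * d * (g y)\<^sup>2 \<partial>P0) / e"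
      unfolding w by simp
    also have "(\<integral>y. 1 + (a + d) * g y + a * d * (g y)\<^sup>2 \<partial>P0) = (\<integral>y. 1 + (a + d) * g y \<partial>P0)
        + (\<integral>y. a * d * (g y)\<^sup>2 \<partial>P0)"
      by (rule Bochner_Integration.integral_add[OF i])
    also have "\<dots> = e"
      using g_integrable e by (simp add: g_mean g_var P0.prob_space)
    finally show ?thesis
      using e i unfolding w by simp
  next
    case False
    have w: "weight b k = (\<lambda>y. 1 + a * g y)"
      using False by (simp add: fun_eq_iff weight_def a_def)
    show ?thesis unfolding w using g_integrable by (simp add: g_mean P0.prob_space)
  qed
  then show "integrable P0 (weight b k)" "(\<integral>y. weight b k y \<partial>P0) = 1" by auto
qed

lemma period_prob:
  assumes k: "k \<in> {1..N}"
  shows "prob_space (period b k)" "sets (period b k) = sets P0" "space (period b k) = space P0"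
proof -
  show "sets (period b k) = sets P0" "space (period b k) = space P0"
    by (simp_all add: period_eq[OF k])
  have "(\<integral>\<^sup>+y. ennreal (weight b k y) \<partial>P0) = ennreal 1"
    using weight_integral[OF k] weight_nonneg[OF k]
    by (subst nn_integral_eq_integral) auto
  then show "prob_space (period b k)"
    unfolding period_eq[OF k] by (intro prob_spaceI) (simp add: emeasure_density cong: nn_integral_cong)
qed

text \<open>The density of the second measure is \<open>exp\<close> of the logarithmic price ratio itself, so passing to it
  raises the exponent \<open>\<kappa>\<close> by one.\<close>

lemma period_char:
  fixes l :: real and b :: bool
  assumes k: "k \<in> {1..N}"
  defines "\<kappa> \<equiv> of_bool b + \<i> * of_real l"
  shows "(\<integral>y. cis (l * log_ratio k y) \<partial>period b k)
    = (\<integral>y. of_real (1 + q k N * h N * g y) * exp (\<kappa> * of_real (ln (1 + sig k N * h N * g y))) \<partial>P0)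
      * exp (- \<kappa> * of_real (ln (1 + sig k N * q k N * (h N)\<^sup>2)))"
proof -
  have cm[measurable]: "cis \<in> borel_measurable borel"
    by (intro borel_measurable_continuous_onI continuous_intros)
  have "(\<integral>y. cis (l * log_ratio k y) \<partial>period b k) = (\<integral>y. weight b k y *\<^sub>R cis (l * log_ratio k y) \<partial>P0)"
    unfolding period_eq[OF k] using weight_nonneg[OF k] by (intro integral_density) auto
  also have "\<dots> = (\<integral>y. of_real (1 + q k N * h N * g y) * exp (\<kappa> * of_real (ln (1 + sig k N * h N * g y)))
      * exp (- \<kappa> * of_real (ln (1 + sig k N * q k N * (h N)\<^sup>2))) \<partial>P0)"
  proof (intro Bochner_Integration.integral_cong refl)
    fix y assume y: "y \<in> space P0"
    have "(if b then discounted_ratio T rho sig g N k y else 1) *\<^sub>R cis (l * log_ratio k y)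
        = exp (\<kappa> * of_real (log_ratio k y))"
      by (simp add: \<kappa>_def exp_log_ratio[OF k y] distrib_right exp_add scaleR_conv_of_real cis_conv_exp
          exp_of_real mult.assoc)
    also have "\<dots> = exp (\<kappa> * of_real (ln (1 + sig k N * h N * g y))) * exp (- \<kappa> * of_real (ln (1
        + sig k N * q k N * (h N)\<^sup>2)))"
      by (simp add: log_ratio_def right_diff_distrib flip: exp_add)
    finally show "weight b k y *\<^sub>R cis (l * log_ratio k y) = of_real (1
        + q k N * h N * g y) * exp (\<kappa> * of_real (ln (1 + sig k N * h N * g y)))
      * exp (- \<kappa> * of_real (ln (1 + sig k N * q k N * (h N)\<^sup>2)))"
      unfolding weight_def scaleR_scaleR[symmetric] by (simp only: scaleR_conv_of_real mult.assoc)
  qed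
  finally show ?thesis by simp
qed

definition market :: "bool \<Rightarrow> (nat \<Rightarrow> 'a) measure" where
  "market b = PiM {1..N} (period b)"

lemma market_eq:
  "market b = (if b then product_Q1 T rho sig P0 g N else product_Q T rho sig P0 g N)"
  unfolding market_def product_Q1_def product_Q_def by (cases b) (auto simp: period_def[abs_def])

text \<open>Outside \<open>{1..N}\<close> the period measures need not be probability measures; there they are replaced by
  \<open>P0\<close>, as the theorems on product measures refer to all indices.\<close>

lemma market_regular:
  obtains M where "market b = PiM {1..N} M" "product_prob_space M" "\<And>k. k \<in> {1..N} \<Longrightarrow> M k = period b k"
proof
  define M where "M k = (if k \<in> {1..N} then period b k else P0)" for k
  show "market b = PiM {1..N} M"
    unfolding market_def by (intro PiM_cong refl) (auto simp: M_def)
  show "M k = period b k" if "k \<in> {1..N}" for k using that by (simp add: M_def)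
  show "product_prob_space M"
    by (rule product_prob_spaceI) (auto simp: M_def period_prob(1) P0)
qed

lemma market_prob: "prob_space (market b)"
proof -
  obtain M where M: "market b = PiM {1..N} M" "product_prob_space M" "\<And>k. k \<in> {1..N} \<Longrightarrow> M k = period b k"
    using market_regular by blast
  interpret product_prob_space M by (rule M(2))
  show ?thesis unfolding M(1) by (rule prob_space_PiM) (rule prob_space)
qed

lemma space_market: "x \<in> space (market b) \<Longrightarrow> k \<in> {1..N} \<Longrightarrow> x k \<in> space P0"
  unfolding market_def space_PiM using period_prob(3) by (auto simp: PiE_iff)

lemma log_ratio_market_measurable: "k \<in> {1..N} \<Longrightarrow> (\<lambda>x. log_ratio k (x k)) \<in> borel_measurable (market b)"
  unfolding market_def
  by (rule measurable_compose[OF measurable_component_singleton])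
     (auto simp: measurable_cong_sets[OF period_prob(2) refl])

lemma market_char:
  "(\<integral>x. cis (\<Sum>k\<in>{1..N}. l k * log_ratio k (x k)) \<partial>market b) = (\<Prod>k\<in>{1..N}. \<integral>y. cis (l k
      * log_ratio k y) \<partial>period b k)"
proof -
  obtain M where M: "market b = PiM {1..N} M" "product_prob_space M" "\<And>k. k \<in> {1..N} \<Longrightarrow> M k = period b k"
    using market_regular by blast
  interpret product_prob_space M by (rule M(2))
  have cm[measurable]: "cis \<in> borel_measurable borel"
    by (intro borel_measurable_continuous_onI continuous_intros)
  have cs: "cis (\<Sum>k\<in>I. f k) = (\<Prod>k\<in>I. cis (f k))" if "finite I" for f :: "nat \<Rightarrow> real" and I
    using that by (induction I rule: finite_induct) (auto simp flip: cis_mult)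
  have i: "integrable (M k) (\<lambda>y. cis (l k * log_ratio k y))" if k: "k \<in> {1..N}" for k
  proof -
    interpret Mk: prob_space "period b k" by (rule period_prob(1)[OF k])
    have "(\<lambda>y. cis (l k * log_ratio k y)) \<in> borel_measurable (period b k)"
      by (subst measurable_cong_sets[OF period_prob(2)[OF k] refl]) simp
    then show ?thesis unfolding M(3)[OF k]
      by (intro Mk.integrable_const_bound[where B=1]) auto
  qed
  have "(\<integral>x. cis (\<Sum>k\<in>{1..N}. l k * log_ratio k (x k)) \<partial>market b)
      = (\<integral>x. (\<Prod>k\<in>{1..N}. cis (l k * log_ratio k (x k))) \<partial>PiM {1..N} M)"
    unfolding M(1) by (simp add: cs)
  also have "\<dots> = (\<Prod>k\<in>{1..N}. \<integral>y. cis (l k * log_ratio k y) \<partial>M k)"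
    by (rule product_integral_prod) (use i in auto)
  finally show ?thesis by (simp add: M(3))
qed

lemma discounted_price_eq:
  assumes "x \<in> space (market b)" "m \<le> N"
  shows "discounted_price T rho sig g N m x = exp (\<Sum>k\<in>{1..m}. log_ratio k (x k))"
proof -
  have "discounted_price T rho sig g N m x = (\<Prod>k\<in>{1..m}. exp (log_ratio k (x k)))"
    unfolding discounted_price_def
    using assms by (intro prod.cong refl exp_log_ratio space_market[OF assms(1)]) auto
  then show ?thesis by (simp add: exp_sum)
qed

end

text \<open>The variance that the log price has accumulated after \<open>m\<close> periods.\<close>

definition clock :: "nat \<Rightarrow> nat \<Rightarrow> real" where
  "clock N m = (\<Sum>k\<in>{1..m}. (sig k N)\<^sup>2 * (T / real N))"

abbreviation combination :: "('i::finite \<Rightarrow> real) \<Rightarrow> ('i \<Rightarrow> nat \<Rightarrow> nat) \<Rightarrow> nat \<Rightarrow> (nat \<Rightarrow> 'a) \<Rightarrow> real" where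
  "combination l m N x \<equiv> (\<Sum>i\<in>UNIV. l i * (\<Sum>k\<in>{1..m i N}. log_ratio N k (x k)))"

text \<open>In a linear combination of log prices, period \<open>k\<close> has the weight \<open>lk N k\<close>, the sum of the \<open>l i\<close> over those \<open>i\<close>
  with \<open>k \<le> m i N\<close>. The \<open>N\<close> factors are replaced by exponentials with an error \<open>o(1/N)\<close> each;
  the exponents then add up to values of the clock.\<close>

lemma market_char_tendsto:
  fixes l :: "'i::finite \<Rightarrow> real" and m :: "'i \<Rightarrow> nat \<Rightarrow> nat" and b :: bool
  assumes m: "\<And>i N. m i N \<le> N"
    and A: "\<And>i j. (\<lambda>N. clock N (min (m i N) (m j N))) \<longlonglongrightarrow> A i j"
  shows "(\<lambda>N. \<integral>x. cis (combination l m N x) \<partial>market N b) \<longlonglongrightarrow>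
    exp (\<i> * of_real ((of_bool b - 1/2) * (\<Sum>i\<in>UNIV. l i * A i i))
        - of_real ((\<Sum>i\<in>UNIV. \<Sum>j\<in>UNIV. l i * l j * A i j) / 2))"
proof -
  define L where "L = (\<Sum>i\<in>UNIV. \<bar>l i\<bar>)"
  define lk where "lk N k = (\<Sum>i\<in>UNIV. l i * of_bool (k \<le> m i N))" for N k
  have lkL: "\<bar>lk N k\<bar> \<le> L" for N k
    unfolding lk_def L_def by (rule order_trans[OF sum_abs]) (auto intro!: sum_mono)
  have B: "0 \<le> 1 + L" by (auto simp: L_def intro!: add_nonneg_nonneg sum_nonneg)
  define D where "D = one_period_const (1 + L) bound"
  define \<kappa> where "\<kappa> N k = of_bool b + \<i> * complex_of_real (lk N k)" for N k
  define z where "z N k = (\<integral>y. cis (lk N k * log_ratio N k y) \<partial>period N b k)" for N k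
  define w where "w N k = exp (of_real ((h N)\<^sup>2 * (sig k N)\<^sup>2) * (\<kappa> N k * (\<kappa> N k - 1) / 2))" for N k
  define limit where "limit = exp (\<i> * of_real ((of_bool b - 1/2) * (\<Sum>i\<in>UNIV. l i * A i i))
      - of_real ((\<Sum>i\<in>UNIV. \<Sum>j\<in>UNIV. l i * l j * A i j) / 2))"
  \<comment> \<open>the square of \<open>of_bool b\<close> is \<open>of_bool b\<close>\<close>
  have \<kappa>2: "\<kappa> N k * (\<kappa> N k - 1) / 2 = \<i> * of_real ((of_bool b - 1/2) * lk N k)
      - of_real ((lk N k)\<^sup>2 / 2)" for N k
    by (cases b) (simp_all add: \<kappa>_def power2_eq_square algebra_simps add_divide_distrib diff_divide_distrib)
  have weq: "w N k = exp (\<i> * of_real ((of_bool b - 1/2) * ((h N)\<^sup>2 * (sig k N)\<^sup>2 * lk N k))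
      - of_real (((h N)\<^sup>2 * (sig k N)\<^sup>2 * (lk N k)\<^sup>2) / 2))" for N k
    unfolding w_def \<kappa>2 by (simp add: algebra_simps)
  have wb: "norm (w N k) \<le> 1" for N k
    unfolding weq by simp
  have z1: "norm (z N k) \<le> 1" "norm (z N k - w N k) \<le> D * (h N)\<^sup>2 * (trunc_moment P0 g (h N) + (h N)\<^sup>2)"
    if N: "large N" and k: "k \<in> {1..N}" for N k
  proof -
    interpret M: prob_space "period N b k" by (rule period_prob(1)[OF N k])
    have "norm (z N k) \<le> (\<integral>y. 1 \<partial>period N b k)"
      unfolding z_def by (rule order_trans[OF integral_norm_bound]) simp
    then show "norm (z N k) \<le> 1" by (simp add: M.prob_space)
    have "norm (\<kappa> N k) \<le> 1 + L"
      unfolding \<kappa>_def by (rule order_trans[OF norm_triangle_ineq]) (use lkL[of N k] in \<open>auto simp: norm_mult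
          intro!: add_mono\<close>)
    then show "norm (z N k - w N k) \<le> D * (h N)\<^sup>2 * (trunc_moment P0 g (h N) + (h N)\<^sup>2)"
      unfolding z_def w_def period_char[OF N k] \<kappa>_def[symmetric]
      unfolding D_def using N h0[OF N] parameters[OF N k] density_ge_half[OF N parameters(1,2)[OF N k]]
      by (intro one_period_char[OF P0 g_sq g_mean g_var]) (auto simp: \<kappa>_def large_def)
  qed
  have char_eq: "(\<integral>x. cis (combination l m N x) \<partial>market N b) = (\<Prod>k\<in>{1..N}. z N k)"
    if N: "large N" for N
  proof -
    have "(\<Sum>i\<in>UNIV. l i * (\<Sum>k\<in>{1..m i N}. f k)) = (\<Sum>k\<in>{1..N}. lk N k * f k)" for f :: "nat \<Rightarrow> real"
    proof -
      have "(\<Sum>k\<in>{1..m i N}. f k) = (\<Sum>k\<in>{1..N}. of_bool (k \<le> m i N) * f k)" for i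
        using m[of i N] by (intro sum.mono_neutral_cong_left) auto
      then show ?thesis
        by (simp only: lk_def sum_distrib_left sum_distrib_right mult.assoc) (rule sum.swap)
    qed
    then show ?thesis
      unfolding z_def by (simp only: market_char[OF N])
  qed
  have "(\<lambda>N. (\<integral>x. cis (combination l m N x) \<partial>market N b) - (\<Prod>k\<in>{1..N}. w N k)) \<longlonglongrightarrow> 0"
  proof (rule Lim_null_comparison)
    show "\<forall>\<^sub>F N in sequentially. norm ((\<integral>x. cis (combination l m N x) \<partial>market N b) - (\<Prod>k\<in>{1..N}. w N k))
       \<le> D * T * (trunc_moment P0 g (h N) + (h N)\<^sup>2)"
      using eventually_large
    proof eventually_elim
      case (elim N)
      have "norm ((\<Prod>k\<in>{1..N}. z N k) - (\<Prod>k\<in>{1..N}. w N k)) \<le> (\<Sum>k\<in>{1..N}. norm (z N k - w N k))"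
        using z1(1)[OF elim] wb by (intro norm_prod_diff_le) auto
      also have "\<dots> \<le> (\<Sum>k\<in>{1..N}. D * (h N)\<^sup>2 * (trunc_moment P0 g (h N) + (h N)\<^sup>2))"
        using z1(2)[OF elim] by (intro sum_mono) auto
      also have "\<dots> = D * (real N * (h N)\<^sup>2) * (trunc_moment P0 g (h N) + (h N)\<^sup>2)"
        by simp
      also have "real N * (h N)\<^sup>2 = T"
        using elim by (simp add: large_def h_square)
      finally show ?case unfolding char_eq[OF elim] .
    qed
    have "(\<lambda>N. D * T * (trunc_moment P0 g (h N) + (h N)\<^sup>2)) \<longlonglongrightarrow> D * T * (0 + 0\<^sup>2)"
      by (intro tendsto_intros trunc_moment_tendsto[OF g_sq h_tendsto h_nonneg] h_tendsto)
    then show "(\<lambda>N. D * T * (trunc_moment P0 g (h N) + (h N)\<^sup>2)) \<longlonglongrightarrow> 0" by simp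
  qed
  moreover have "(\<lambda>N. \<Prod>k\<in>{1..N}. w N k) \<longlonglongrightarrow> limit"
  proof (rule Lim_transform_eventually)
    show "(\<lambda>N. exp (\<i> * of_real ((of_bool b - 1/2) * (\<Sum>i\<in>UNIV. l i * clock N (min (m i N) (m i N))))
        - of_real ((\<Sum>i\<in>UNIV. \<Sum>j\<in>UNIV. l i * l j * clock N (min (m i N) (m j N))) / 2))) \<longlonglongrightarrow> limit"
      unfolding limit_def by (intro tendsto_intros A) auto
    show "\<forall>\<^sub>F N in sequentially. exp (\<i> * of_real ((of_bool b
        - 1/2) * (\<Sum>i\<in>UNIV. l i * clock N (min (m i N) (m i N))))
        - of_real ((\<Sum>i\<in>UNIV. \<Sum>j\<in>UNIV. l i * l j * clock N (min (m i N) (m j N))) / 2)) = (\<Prod>k\<in>{1..N}. w N k)"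
      using eventually_gt_at_top[of "0::nat"]
    proof eventually_elim
      case (elim N)
      have cl: "clock N n = (\<Sum>k\<in>{1..N}. (h N)\<^sup>2 * (sig k N)\<^sup>2 * of_bool (k \<le> n))" if "n \<le> N" for n
        unfolding clock_def h_square[OF elim] using that by (intro sum.mono_neutral_cong_left) auto
      have s1: "(\<Sum>k\<in>{1..N}. (h N)\<^sup>2 * (sig k N)\<^sup>2 * lk N k) = (\<Sum>i\<in>UNIV. l i * clock N (min (m i N) (m i N)))"
      proof -
        have "(\<Sum>i\<in>UNIV. l i * clock N (min (m i N) (m i N)))
            = (\<Sum>i\<in>UNIV. \<Sum>k\<in>{1..N}. (h N)\<^sup>2 * (sig k N)\<^sup>2 * (l i * of_bool (k \<le> m i N)))"
          by (simp only: min.idem cl[OF m] sum_distrib_left mult_ac)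
        also have "\<dots> = (\<Sum>k\<in>{1..N}. \<Sum>i\<in>UNIV. (h N)\<^sup>2 * (sig k N)\<^sup>2 * (l i * of_bool (k \<le> m i N)))"
          by (rule sum.swap)
        finally show ?thesis by (simp only: lk_def sum_distrib_left)
      qed
      have s2: "(\<Sum>k\<in>{1..N}. (h N)\<^sup>2 * (sig k N)\<^sup>2 * (lk N k)\<^sup>2)
          = (\<Sum>i\<in>UNIV. \<Sum>j\<in>UNIV. l i * l j * clock N (min (m i N) (m j N)))"
      proof -
        have mm: "min (m i N) (m j N) \<le> N" for i j using m[of i N] by simp
        have "(\<Sum>i\<in>UNIV. \<Sum>j\<in>UNIV. l i * l j * clock N (min (m i N) (m j N)))
          = (\<Sum>i\<in>UNIV. \<Sum>j\<in>UNIV. \<Sum>k\<in>{1..N}. (h N)\<^sup>2 * (sig k N)\<^sup>2 * ((l i * of_bool (k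
              \<le> m i N)) * (l j * of_bool (k \<le> m j N))))"
          by (simp only: cl[OF mm] sum_distrib_left min.bounded_iff of_bool_conj mult_ac)
        also have "\<dots> = (\<Sum>i\<in>UNIV. \<Sum>k\<in>{1..N}. \<Sum>j\<in>UNIV. (h N)\<^sup>2 * (sig k N)\<^sup>2 * ((l i * of_bool (k
            \<le> m i N)) * (l j * of_bool (k \<le> m j N))))"
          by (intro sum.cong refl sum.swap)
        also have "\<dots> = (\<Sum>k\<in>{1..N}. \<Sum>i\<in>UNIV. \<Sum>j\<in>UNIV. (h N)\<^sup>2 * (sig k N)\<^sup>2 * ((l i * of_bool (k
            \<le> m i N)) * (l j * of_bool (k \<le> m j N))))"
          by (rule sum.swap)
        moreover have "(lk N k)\<^sup>2 = (\<Sum>i\<in>UNIV. \<Sum>j\<in>UNIV. (l i * of_bool (k \<le> m i N)) * (l j * of_bool (k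
            \<le> m j N)))" for k
          unfolding lk_def power2_eq_square sum_product ..
        ultimately show ?thesis by (simp only: sum_distrib_left)
      qed
      have "(\<Prod>k\<in>{1..N}. w N k) = exp (\<Sum>k\<in>{1..N}. \<i> * of_real ((of_bool b
          - 1/2) * ((h N)\<^sup>2 * (sig k N)\<^sup>2 * lk N k)) - of_real (((h N)\<^sup>2 * (sig k N)\<^sup>2 * (lk N k)\<^sup>2) / 2))"
        unfolding weq by (rule exp_sum[symmetric]) simp
      also have "\<dots> = exp (\<i> * of_real ((of_bool b - 1/2) * (\<Sum>k\<in>{1..N}. (h N)\<^sup>2 * (sig k N)\<^sup>2 * lk N k))
          - of_real ((\<Sum>k\<in>{1..N}. (h N)\<^sup>2 * (sig k N)\<^sup>2 * (lk N k)\<^sup>2) / 2))"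
        by (simp only: sum_subtractf sum_distrib_left[symmetric] of_real_sum[symmetric]
            sum_divide_distrib[symmetric])
      finally show ?case unfolding s1 s2 by simp
    qed
  qed
  ultimately have "(\<lambda>N. ((\<integral>x. cis (combination l m N x) \<partial>market N b) - (\<Prod>k\<in>{1..N}. w N k))
      + (\<Prod>k\<in>{1..N}. w N k)) \<longlonglongrightarrow> 0 + limit"
    by (rule tendsto_add)
  then show ?thesis by (simp add: limit_def)
qed

end

section \<open>Convergence of the accumulated volatility\<close>

lemma step_fun_no_interval:
  assumes "\<not> (\<exists>i<m. p i < u \<and> u \<le> p (Suc i))"
  shows "step_fun m p c u = 0"
  unfolding step_fun_def using assms by (intro sum.neutral) (auto simp: indicator_def)

text \<open>At most one interval of the partition contains \<open>u\<close>.\<close>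

lemma step_fun_square:
  assumes "partition_in t m p"
  shows "(step_fun m p c u)\<^sup>2 = step_fun m p (\<lambda>i. (c i)\<^sup>2) u"
proof (cases "\<exists>i<m. p i < u \<and> u \<le> p (Suc i)")
  case True
  then obtain i where "i < m" "p i < u" "u \<le> p (Suc i)" by blast
  then show ?thesis by (simp add: step_fun_eq[OF assms])
qed (simp add: step_fun_no_interval)

lemma step_fun_prefix:
  assumes p: "partition_in t m p" and n: "n \<le> m"
  shows "indicator {0..p n} u * step_fun m p c u = step_fun n p c u"
proof (cases "\<exists>i<m. p i < u \<and> u \<le> p (Suc i)")
  case True
  then obtain i where i: "i < m" "p i < u" "u \<le> p (Suc i)" by blast
  have pn: "partition_in (p n) n p" using p n by (auto simp: partition_in_def)
  show ?thesis
  proof (cases "i < n")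
    case True
    then have "p (Suc i) \<le> p n" using n p by (intro partition_in_mono[OF p]) auto
    moreover have "0 \<le> p i" using partition_in_bounds[OF p, of i] i by simp
    ultimately show ?thesis
      using i True by (simp add: step_fun_eq[OF p] step_fun_eq[OF pn])
  next
    case False
    then have "p n < u" using i partition_in_mono[OF p, of n i] by simp
    then show ?thesis by (simp add: step_fun_outside[OF pn])
  qed
next
  case False
  then have "\<not> (\<exists>i<n. p i < u \<and> u \<le> p (Suc i))" using n by auto
  then show ?thesis using False by (simp add: step_fun_no_interval)
qed

lemma step_volatility_eq:
  "step_volatility T sig N = step_fun N (\<lambda>i. real i * T / real N) (\<lambda>i. sig (Suc i) N)"
proof
  fix u
  have "(\<Sum>k=1..N. sig k N * indicator {(real k - 1) * T / real N <.. real k * T / real N} u)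
      = (\<Sum>i<N. sig (Suc i) N * indicator {(real (Suc i) - 1) * T / real N <.. real (Suc i) * T / real N} u)"
    by (rule sum.reindex_bij_witness[of _ Suc "\<lambda>k. k - 1"]) auto
  then show "step_volatility T sig N u = step_fun N (\<lambda>i. real i * T / real N) (\<lambda>i. sig (Suc i) N) u"
    by (simp add: step_volatility_def step_fun_def)
qed

context wiener begin

lemma integral_step_fun:
  assumes p: "partition_in T m p"
  shows "(\<integral>u. step_fun m p c u \<partial>\<L>) = (\<Sum>i<m. c i * (p (Suc i) - p i))"
proof -
  have i: "integrable \<L> (\<lambda>u. indicator {p i<..p (Suc i)} u :: real)"
      "(\<integral>u. (indicator {p i<..p (Suc i)} u :: real) \<partial>\<L>) = p (Suc i) - p i" if "i < m" for i
  proof -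
    have b: "0 \<le> p i" "p i \<le> p (Suc i)" "p (Suc i) \<le> T"
      using partition_in_bounds[OF p, of i] partition_in_bounds[OF p, of "Suc i"] partition_in_mono[OF p, of
          i "Suc i"] that by auto
    show "integrable \<L> (\<lambda>u. indicator {p i<..p (Suc i)} u :: real)"
      "(\<integral>u. (indicator {p i<..p (Suc i)} u :: real) \<partial>\<L>) = p (Suc i) - p i"
      using integral_interval[OF b] by auto
  qed
  have "(\<integral>u. step_fun m p c u \<partial>\<L>) = (\<Sum>i<m. \<integral>u. c i * indicator {p i<..p (Suc i)} u \<partial>\<L>)"
    unfolding step_fun_def using i by (intro Bochner_Integration.integral_sum) auto
  also have "\<dots> = (\<Sum>i<m. c i * (p (Suc i) - p i))"
    using i by (intro sum.cong refl) simp
  finally show ?thesis .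
qed

lemma step_volatility_L2:
  assumes \<sigma>: "square_integrable \<L> \<sigma>"
    and conv: "(\<lambda>N. \<integral>u. (step_volatility T sig N u - \<sigma> u)\<^sup>2 \<partial>\<L>) \<longlonglongrightarrow> 0"
  shows "L2_lim \<L> (step_volatility T sig) \<sigma>"
  unfolding L2_lim_def using assms step_fun_square_integrable by (simp add: step_volatility_eq)

lemma step_volatility_bounds:
  assumes vol: "\<And>i N. 1 \<le> i \<Longrightarrow> i \<le> N \<Longrightarrow> \<delta> \<le> sig i N \<and> sig i N \<le> K"
    and N: "0 < N" and u: "u \<in> {0<..T}"
  shows "\<delta> \<le> step_volatility T sig N u" "step_volatility T sig N u \<le> K"
proof -
  obtain i where i: "i < N" "real i * T / real N < u" "u \<le> real (Suc i) * T / real N"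
    using uniform_partition_cover[OF u N] by blast
  have "step_volatility T sig N u = sig (Suc i) N"
    unfolding step_volatility_eq
    by (rule step_fun_eq[OF uniform_partition]) (use T i in auto)
  then show "\<delta> \<le> step_volatility T sig N u" "step_volatility T sig N u \<le> K"
    using vol[of "Suc i" N] i by auto
qed

lemma AE_time_pos: "AE u in \<L>. u \<in> {0<..T}"
proof -
  have "AE u in lebesgue. u \<noteq> (0::real)"
    by (rule AE_completion) (rule AE_lborel_singleton)
  then have "AE u in \<L>. u \<noteq> 0"
    by (subst AE_restrict_space_iff) auto
  then show ?thesis
    using AE_space by eventually_elim auto
qed

text \<open>The lower bound passes to the mean square limit.\<close>

lemma volatility_lower_bound:
  assumes \<sigma>: "square_integrable \<L> \<sigma>"
    and vol: "\<And>i N. 1 \<le> i \<Longrightarrow> i \<le> N \<Longrightarrow> \<delta> \<le> sig i N \<and> sig i N \<le> K"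
    and conv: "(\<lambda>N. \<integral>u. (step_volatility T sig N u - \<sigma> u)\<^sup>2 \<partial>\<L>) \<longlonglongrightarrow> 0"
  shows "AE u in \<L>. \<delta> \<le> \<sigma> u"
proof -
  note L = step_volatility_L2[OF \<sigma> conv, unfolded L2_lim_def]
  define f where "f u = (max 0 (\<delta> - \<sigma> u))\<^sup>2" for u
  have m: "f \<in> borel_measurable \<L>" unfolding f_def using \<sigma> by (auto simp: square_integrable_def)
  have le: "AE u in \<L>. f u \<le> (step_volatility T sig N u - \<sigma> u)\<^sup>2" if "0 < N" for N
    using AE_time_pos
  proof eventually_elim
    case (elim u)
    have "\<delta> \<le> step_volatility T sig N u"
      by (rule step_volatility_bounds(1)[where K=K, OF _ that elim]) (use vol in blast)
    then have "max 0 (\<delta> - \<sigma> u) \<le> \<bar>step_volatility T sig N u - \<sigma> u\<bar>"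
      by simp
    then have "(max 0 (\<delta> - \<sigma> u))\<^sup>2 \<le> \<bar>step_volatility T sig N u - \<sigma> u\<bar>\<^sup>2" by (intro power_mono) auto
    then show ?case by (simp add: f_def)
  qed
  have i: "integrable \<L> (\<lambda>u. (step_volatility T sig N u - \<sigma> u)\<^sup>2)" for N
    using L by (auto intro: square_integrable_diff_square)
  have f_integrable: "integrable \<L> f"
    using le[of 1] by (intro Bochner_Integration.integrable_bound[OF i m]) (auto simp: f_def)
  have "\<forall>\<^sub>F N in sequentially. (\<integral>u. f u \<partial>\<L>) \<le> (\<integral>u. (step_volatility T sig N u - \<sigma> u)\<^sup>2 \<partial>\<L>)"
    using eventually_gt_at_top[of "0::nat"] by eventually_elim (intro integral_mono_AE f_integrable i le)
  then have "(\<integral>u. f u \<partial>\<L>) \<le> 0"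
    using conv by (intro tendsto_le[OF _ _ tendsto_const]) auto
  moreover have "0 \<le> (\<integral>u. f u \<partial>\<L>)" by (intro integral_nonneg_AE) (simp add: f_def)
  ultimately have "(\<integral>u. f u \<partial>\<L>) = 0" by simp
  then have "AE u in \<L>. f u = 0"
    using f_integrable by (subst (asm) integral_nonneg_eq_0_iff_AE) (auto simp: f_def)
  then show ?thesis by eventually_elim (simp add: f_def max_def split: if_splits)
qed

text \<open>The sum is the integral of the squared step volatility up to the last grid point before \<open>t\<close>. It
  differs from the integral up to \<open>t\<close> by at most \<open>K\<^sup>2 * T / N\<close>, and the latter converges because
  mean square convergence implies convergence of the norms.\<close>

lemma volatility_clock:
  assumes \<sigma>: "square_integrable \<L> \<sigma>" and \<delta>: "0 < \<delta>"
    and vol: "\<And>i N. 1 \<le> i \<Longrightarrow> i \<le> N \<Longrightarrow> \<delta> \<le> sig i N \<and> sig i N \<le> K"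
    and conv: "(\<lambda>N. \<integral>u. (step_volatility T sig N u - \<sigma> u)\<^sup>2 \<partial>\<L>) \<longlonglongrightarrow> 0"
    and t: "t \<in> {0..T}"
  shows "(\<lambda>N. \<Sum>k\<in>{1..nat \<lfloor>t / T * real N\<rfloor>}. (sig k N)\<^sup>2 * (T / real N)) \<longlonglongrightarrow> (\<integral>u. indicator {0..t} u * (\<sigma> u)\<^sup>2 \<partial>\<L>)"
proof -
  note L = step_volatility_L2[OF \<sigma> conv, unfolded L2_lim_def]
  define s where "s N u = step_volatility T sig N u" for N u
  define m where "m N = nat \<lfloor>t / T * real N\<rfloor>" for N
  have sq: "square_integrable \<L> (s N)" for N using L by (simp add: s_def[abs_def])
  have L': "L2_lim (lebesgue_on {0..t}) s \<sigma>"
    unfolding L2_lim_def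
  proof (intro conjI allI square_integrable_initial_mono[OF t] sq \<sigma>)
    show "(\<lambda>N. \<integral>u. (s N u - \<sigma> u)\<^sup>2 \<partial>lebesgue_on {0..t}) \<longlonglongrightarrow> 0"
    proof (rule tendsto_sandwich[OF _ _ tendsto_const conv], goal_cases)
      case 2
      have "(\<integral>u. (s N u - \<sigma> u)\<^sup>2 \<partial>lebesgue_on {0..t}) \<le> (\<integral>u. (s N u - \<sigma> u)\<^sup>2 \<partial>\<L>)" for N
      proof -
        have "integrable \<L> (\<lambda>u. (s N u - \<sigma> u)\<^sup>2)" by (rule square_integrable_diff_square[OF sq \<sigma>])
        moreover have "integrable \<L> (\<lambda>u. indicator {0..t} u * (s N u - \<sigma> u)\<^sup>2)"
          unfolding integrable_initial[OF t, symmetric]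
          by (intro square_integrable_diff_square square_integrable_initial_mono[OF t] sq \<sigma>)
        ultimately show ?thesis
          unfolding integral_initial[OF t] by (intro integral_mono) (auto simp: indicator_def)
      qed
      then show ?case by (simp add: s_def)
    qed simp
  qed
  have "(\<lambda>N. \<integral>u. indicator {0..t} u * (s N u)\<^sup>2 \<partial>\<L>) \<longlonglongrightarrow> (\<integral>u. indicator {0..t} u * (\<sigma> u)\<^sup>2 \<partial>\<L>)"
    using L2_lim_norm[OF L'] unfolding integral_initial[OF t] .
  moreover have "(\<lambda>N. (\<Sum>k\<in>{1..m N}. (sig k N)\<^sup>2 * (T / real N)) - (\<integral>u. indicator {0..t} u * (s N u)\<^sup>2 \<partial>\<L>)) \<longlonglongrightarrow> 0"
  proof (rule Lim_null_comparison)
    show "(\<lambda>N. K\<^sup>2 * (T / real N)) \<longlonglongrightarrow> 0"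
      by (intro tendsto_mult_right_zero tendsto_divide_0[OF tendsto_const] filterlim_at_top_imp_at_infinity
          filterlim_real_sequentially)
    show "\<forall>\<^sub>F N in sequentially. norm ((\<Sum>k\<in>{1..m N}. (sig k N)\<^sup>2 * (T / real N))
        - (\<integral>u. indicator {0..t} u * (s N u)\<^sup>2 \<partial>\<L>)) \<le> K\<^sup>2 * (T / real N)"
      using eventually_gt_at_top[of "0::nat"]
    proof eventually_elim
      case (elim N)
      define p where "p i = real i * T / real N" for i
      define c where "c i = sig (Suc i) N" for i
      have p: "partition_in T N p" unfolding p_def using T by (intro uniform_partition) simp
      have sN: "s N = step_fun N p c" by (simp add: s_def[abs_def] step_volatility_eq p_def[abs_def]
          c_def[abs_def])
      have r: "0 \<le> t / T * real N" "t / T * real N \<le> real N"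
          using t T mult_right_mono[of "t / T" 1 "real N"] by auto
      have mN: "m N \<le> N" unfolding m_def using r by linarith
      have "real (m N) \<le> t / T * real N" "t / T * real N < real (m N) + 1" unfolding m_def using r by linarith+
      then have "p (m N) \<le> t" "t \<le> (real (m N) + 1) * T / real N"
        using T elim by (auto simp: p_def field_simps)
      then have pm: "p (m N) \<le> t" "t - p (m N) \<le> T / real N"
        by (simp_all add: p_def distrib_right add_divide_distrib)
      have pm0: "0 \<le> p (m N)" using T by (simp add: p_def)
      have pref: "indicator {0..p (m N)} u * (s N u)\<^sup>2 = step_fun (m N) p (\<lambda>i. (c i)\<^sup>2) u" for u
        unfolding sN step_fun_square[OF p] by (rule step_fun_prefix[OF p mN])
      have pT: "partition_in T (m N) p" using T mN elim p by (auto simp: partition_in_def p_def field_simps)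
      have "(\<integral>u. indicator {0..p (m N)} u * (s N u)\<^sup>2 \<partial>\<L>) = (\<Sum>i<m N. (c i)\<^sup>2 * (p (Suc i) - p i))"
        unfolding pref by (rule integral_step_fun[OF pT])
      also have "\<dots> = (\<Sum>i<m N. (sig (Suc i) N)\<^sup>2 * (T / real N))"
      proof -
        have "p (Suc i) - p i = T / real N" for i
          by (simp add: p_def distrib_right add_divide_distrib)
        then show ?thesis by (simp only: c_def)
      qed
      also have "\<dots> = (\<Sum>k\<in>{1..m N}. (sig k N)\<^sup>2 * (T / real N))"
        by (rule sum.reindex_bij_witness[of _ "\<lambda>k. k - 1" Suc]) auto
      finally have cl: "(\<Sum>k\<in>{1..m N}. (sig k N)\<^sup>2 * (T / real N))
          = (\<integral>u. indicator {0..p (m N)} u * (s N u)\<^sup>2 \<partial>\<L>)" ..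
      have pin: "p (m N) \<in> {0..T}" using pm pm0 t by auto
      have ii: "integrable \<L> (\<lambda>u. indicator {0..x} u * (s N u)\<^sup>2)" if "x \<in> {0..T}" for x
        unfolding integrable_initial[OF that, symmetric]
        by (intro square_integrable_integrable square_integrable_initial_mono[OF that] sq)
      define w where "w = step_fun 1 (\<lambda>i. if i = 0 then p (m N) else t) (\<lambda>_. K\<^sup>2)"
      have pw: "partition_in T 1 (\<lambda>i. if i = 0 then p (m N) else t)" using pm pm0 t
          by (auto simp: partition_in_def)
      have w: "w u = K\<^sup>2 * indicator {p (m N)<..t} u" for u by (simp add: w_def step_fun_def)
      have iw: "(\<integral>u. w u \<partial>\<L>) = K\<^sup>2 * (t - p (m N))"
        unfolding w_def integral_step_fun[OF pw] by simp
      have integrable_w: "integrable \<L> w"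
      proof -
        have "square_integrable \<L> (\<lambda>u. 1)" by (simp add: square_integrable_def)
        from square_integrable_mult[OF step_fun_square_integrable this] show ?thesis by (simp add: w_def)
      qed
      have "norm ((\<Sum>k\<in>{1..m N}. (sig k N)\<^sup>2 * (T / real N)) - (\<integral>u. indicator {0..t} u * (s N u)\<^sup>2 \<partial>\<L>))
         = norm (\<integral>u. indicator {0..p (m N)} u * (s N u)\<^sup>2 - indicator {0..t} u * (s N u)\<^sup>2 \<partial>\<L>)"
        unfolding cl using ii[OF pin] ii[OF t] by simp
      also have "\<dots> \<le> (\<integral>u. w u \<partial>\<L>)"
      proof (rule norm_integral_le)
        show "norm (indicator {0..p (m N)} u * (s N u)\<^sup>2 - indicator {0..t} u * (s N u)\<^sup>2) \<le> w u" for u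
        proof (cases "u \<in> {p (m N)<..t}")
          case True
          then have "u \<in> {0<..T}" using pm0 t by auto
          have "\<delta> \<le> s N u" "s N u \<le> K"
            unfolding s_def by (rule step_volatility_bounds[OF _ elim \<open>u \<in> {0<..T}\<close>]; use vol in blast)+
          then have "(s N u)\<^sup>2 \<le> K\<^sup>2" using \<delta> by (intro power_mono) auto
          then show ?thesis using True pm0 by (simp add: w)
        next
          case False
          then have "indicator {0..p (m N)} u = (indicator {0..t} u :: real)" using pm
              by (auto simp: indicator_def)
          moreover have "0 \<le> w u" by (simp add: w)
          ultimately show ?thesis by simp
        qed
      qed (use ii[OF pin] ii[OF t] integrable_w in auto)
      also have "\<dots> \<le> K\<^sup>2 * (T / real N)" unfolding iw using pm by (intro mult_left_mono) auto
      finally show ?case .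
    qed
  qed
  ultimately have "(\<lambda>N. ((\<Sum>k\<in>{1..m N}. (sig k N)\<^sup>2 * (T / real N)) - (\<integral>u. indicator {0..t} u * (s N u)\<^sup>2 \<partial>\<L>))
      + (\<integral>u. indicator {0..t} u * (s N u)\<^sup>2 \<partial>\<L>))
     \<longlonglongrightarrow> 0 + (\<integral>u. indicator {0..t} u * (\<sigma> u)\<^sup>2 \<partial>\<L>)"
    by (intro tendsto_add)
  then show ?thesis by (simp add: m_def)
qed

end

lemma borel_measurable_vec_lambda:
  fixes f :: "'n::finite \<Rightarrow> 'a \<Rightarrow> real"
  assumes "\<And>i. f i \<in> borel_measurable M"
  shows "(\<lambda>x. \<chi> i. f i x) \<in> borel_measurable M"
  unfolding borel_measurable_euclidean_space[of "\<lambda>x. \<chi> i. f i x"]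
  using assms by (auto simp: Basis_vec_def inner_axis)

text \<open>Continuous mapping: the vectors \<open>V N\<close> and \<open>U\<close> of logarithms converge by Levy's theorem. The hypotheses
  on \<open>M N\<close> are only required for large \<open>N\<close>, since for small \<open>N\<close> the discrete prices may fail to be positive.\<close>

lemma weak_limit_exponential:
  fixes V :: "nat \<Rightarrow> 'a \<Rightarrow> real ^ 'n" and U :: "'b \<Rightarrow> real ^ 'n"
  assumes M: "\<forall>\<^sub>F N in sequentially. prob_space (M N) \<and> V N \<in> borel_measurable (M N) \<and>
      (\<forall>x\<in>space (M N). X N x = (\<chi> i. exp (V N x $ i)))"
    and L: "prob_space L" "U \<in> borel_measurable L" "B \<in> borel_measurable L" "AE x in L. B x
        = (\<chi> i. exp (U x $ i))"
    and conv: "\<And>l. (\<lambda>N. \<integral>x. cis (l \<bullet> V N x) \<partial>M N) \<longlonglongrightarrow> (\<integral>x. cis (l \<bullet> U x) \<partial>L)"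
  shows "weakly_converges (\<lambda>N. distr (M N) borel (X N)) (distr L borel B)"
proof -
  define ok where "ok N \<longleftrightarrow> prob_space (M N) \<and> V N \<in> borel_measurable (M N) \<and>
      (\<forall>x\<in>space (M N). X N x = (\<chi> i. exp (V N x $ i)))" for N
  define M' where "M' N = (if ok N then distr (M N) borel (V N) else distr L borel U)" for N
  have ev: "\<forall>\<^sub>F N in sequentially. ok N" using M by (simp add: ok_def)
  have E: "continuous_on UNIV (\<lambda>v::real^'n. \<chi> i. exp (v $ i))" (is "continuous_on UNIV ?E")
    by (intro continuous_intros)
  have Em: "?E \<in> borel_measurable borel" using E by (rule borel_measurable_continuous_onI)
  have cm: "(\<lambda>v. cis (l \<bullet> v)) \<in> borel_measurable borel" for l :: "real^'n"
    by (intro borel_measurable_continuous_onI continuous_intros)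
  have "weakly_converges M' (distr L borel U)"
  proof (rule levy_continuity_euclidean)
    show "prob_space (M' N)" for N
      using L by (auto simp: M'_def ok_def intro!: prob_space.prob_space_distr)
    show "prob_space (distr L borel U)" using L by (intro prob_space.prob_space_distr)
    show "sets (M' N) = sets borel" for N by (simp add: M'_def)
    fix l :: "real ^ 'n"
    have "\<forall>\<^sub>F N in sequentially. (\<integral>x. cis (l \<bullet> V N x) \<partial>M N) = (\<integral>x. cis (l \<bullet> x) \<partial>M' N)"
      using ev by eventually_elim (simp add: M'_def ok_def integral_distr cm)
    with conv[of l] have "(\<lambda>N. \<integral>x. cis (l \<bullet> x) \<partial>M' N) \<longlonglongrightarrow> (\<integral>x. cis (l \<bullet> U x) \<partial>L)"
      by (rule Lim_transform_eventually)
    then show "(\<lambda>N. \<integral>x. cis (l \<bullet> x) \<partial>M' N) \<longlonglongrightarrow> (\<integral>x. cis (l \<bullet> x) \<partial>distr L borel U)"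
      using L by (simp add: integral_distr cm)
  qed simp
  then have weak: "(\<lambda>N. \<integral>x. f x \<partial>M' N) \<longlonglongrightarrow> (\<integral>x. f x \<partial>distr L borel U)"
    if "continuous_on UNIV f" "bounded (range f)" for f :: "real^'n \<Rightarrow> real"
    using that by (simp add: weakly_converges_def)
  show ?thesis
    unfolding weakly_converges_def
  proof (intro allI impI, elim conjE)
    fix f :: "real ^ 'n \<Rightarrow> real"
    assume f: "continuous_on UNIV f" "bounded (range f)"
    have fm: "f \<in> borel_measurable borel" using f(1) by (rule borel_measurable_continuous_onI)
    have fE: "(\<lambda>v. f (?E v)) \<in> borel_measurable borel" using measurable_compose[OF Em fm] .
    have "(\<lambda>N. \<integral>x. f (?E x) \<partial>M' N) \<longlonglongrightarrow> (\<integral>x. f (?E x) \<partial>distr L borel U)"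
    proof (rule weak)
      show "continuous_on UNIV (\<lambda>v. f (?E v))" by (rule continuous_on_compose2[OF f(1) E]) simp
      show "bounded (range (\<lambda>v. f (?E v)))" using f(2) by (rule bounded_subset) auto
    qed
    also have "(\<integral>x. f (?E x) \<partial>distr L borel U) = (\<integral>x. f (?E (U x)) \<partial>L)"
      using L fE by (simp add: integral_distr)
    also have "\<dots> = (\<integral>x. f (B x) \<partial>L)"
    proof (rule integral_cong_AE)
      show "(\<lambda>x. f (?E (U x))) \<in> borel_measurable L" using measurable_compose[OF L(2) fE] .
      show "(\<lambda>x. f (B x)) \<in> borel_measurable L" using measurable_compose[OF L(3) fm] .
      show "AE x in L. f (?E (U x)) = f (B x)" using L(4) by eventually_elim simp
    qed
    also have "\<dots> = (\<integral>x. f x \<partial>distr L borel B)"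
      using L fm by (simp add: integral_distr)
    finally have lim: "(\<lambda>N. \<integral>x. f (?E x) \<partial>M' N) \<longlonglongrightarrow> (\<integral>x. f x \<partial>distr L borel B)" .
    have "\<forall>\<^sub>F N in sequentially. (\<integral>x. f (?E x) \<partial>M' N) = (\<integral>x. f x \<partial>distr (M N) borel (X N))"
      using ev
    proof eventually_elim
      case (elim N)
      then have o: "V N \<in> borel_measurable (M N)" "\<And>x. x \<in> space (M N) \<Longrightarrow> X N x = ?E (V N x)"
        by (auto simp: ok_def)
      have "(\<lambda>x. ?E (V N x)) \<in> borel_measurable (M N)" using measurable_compose[OF o(1) Em] .
      then have Xm: "X N \<in> borel_measurable (M N)" using o(2) by (subst measurable_cong) auto
      have "(\<integral>x. f (?E x) \<partial>M' N) = (\<integral>x. f (?E (V N x)) \<partial>M N)"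
        using elim o fE by (simp add: M'_def integral_distr)
      also have "\<dots> = (\<integral>x. f (X N x) \<partial>M N)"
        by (intro Bochner_Integration.integral_cong refl) (simp add: o(2))
      also have "\<dots> = (\<integral>x. f x \<partial>distr (M N) borel (X N))"
        using Xm fm by (simp add: integral_distr)
      finally show ?case .
    qed
    with lim show "(\<lambda>N. \<integral>x. f x \<partial>distr (M N) borel (X N)) \<longlonglongrightarrow> (\<integral>x. f x \<partial>distr L borel B)"
      by (rule Lim_transform_eventually)
  qed
qed

section \<open>Weak convergence of the discounted price process\<close>

lemma AE_all_finite:
  assumes "\<And>i::'n::finite. AE \<omega> in M. p i \<omega>"
  shows "AE \<omega> in M. \<forall>i. p i \<omega>"
proof -
  have "AE \<omega> in M. \<forall>i\<in>UNIV. p i \<omega>"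
    using assms by (subst AE_finite_all) auto
  then show ?thesis by simp
qed

locale market_with_limit = black_scholes P F T W r \<sigma> \<delta> + discrete_market T R C \<delta> K rho sig P0 g
  for P :: "'w measure" and F T W r \<sigma> \<delta> R C K rho sig and P0 :: "'a measure" and g +
  assumes conv: "(\<lambda>N. \<integral>u. (step_volatility T sig N u - \<sigma> u)\<^sup>2 \<partial>lebesgue_on {0..T}) \<longlonglongrightarrow> 0"
begin

definition step_index :: "nat \<Rightarrow> real \<Rightarrow> nat" where
  "step_index N t = nat \<lfloor>t / T * real N\<rfloor>"

lemma step_index_le: "t \<in> {0..T} \<Longrightarrow> step_index N t \<le> N"
proof -
  assume t: "t \<in> {0..T}"
  have "t / T * real N \<le> 1 * real N"
    using t T by (intro mult_right_mono) auto
  then show ?thesis unfolding step_index_def by linarith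
qed

lemma step_index_min: "min (step_index N s) (step_index N t) = step_index N (min s t)"
proof -
  have "mono (step_index N)"
    unfolding step_index_def using T by (intro monoI nat_mono floor_mono mult_right_mono divide_right_mono) auto
  then show ?thesis by (simp add: min_of_mono)
qed

lemma clock_tendsto: "t \<in> {0..T} \<Longrightarrow> (\<lambda>N. clock N (step_index N t)) \<longlonglongrightarrow> total_variance t"
  unfolding clock_def step_index_def total_variance_def
  by (rule volatility_clock[OF \<sigma> \<delta> _ conv]) (use vol in auto)

abbreviation market_measure :: "bool \<Rightarrow> nat \<Rightarrow> (nat \<Rightarrow> 'a) measure" where
  "market_measure b N \<equiv> (if b then product_Q1 T rho sig P0 g N else product_Q T rho sig P0 g N)"

abbreviation price_vector :: "('n::finite \<Rightarrow> real) \<Rightarrow> nat \<Rightarrow> (nat \<Rightarrow> 'a) \<Rightarrow> real ^ 'n" where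
  "price_vector \<tau> N \<equiv> (\<lambda>x. \<chi> i. discounted_price T rho sig g N (nat \<lfloor>\<tau> i / T * real N\<rfloor>) x)"

abbreviation limit_vector :: "('n::finite \<Rightarrow> real) \<Rightarrow> 'w \<Rightarrow> real ^ 'n" where
  "limit_vector \<tau> \<equiv> (\<lambda>\<omega>. \<chi> i. BS_density P F T W r \<sigma> (\<tau> i) \<omega>)"

definition log_price :: "('n::finite \<Rightarrow> real) \<Rightarrow> nat \<Rightarrow> (nat \<Rightarrow> 'a) \<Rightarrow> real ^ 'n" where
  "log_price \<tau> N x = (\<chi> i. \<Sum>k\<in>{1..step_index N (\<tau> i)}. log_ratio N k (x k))"

text \<open>Both assertions in one: the only inputs on the side of the limit are the characteristic function of
  the log prices, and the identity of prices and exponentials up to null sets.\<close>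

lemma price_convergence:
  fixes \<tau> :: "'n::finite \<Rightarrow> real" and b :: bool and Q' :: "'w measure"
  assumes \<tau>: "\<And>i. \<tau> i \<in> {0..T}"
    and Q': "prob_space Q'" "(\<lambda>\<omega>. \<chi> i. log_BS (\<tau> i) \<omega>) \<in> borel_measurable Q'"
      "(limit_vector \<tau>) \<in> borel_measurable Q'"
      "AE \<omega> in Q'. \<forall>i. BS_density P F T W r \<sigma> (\<tau> i) \<omega> = exp (log_BS (\<tau> i) \<omega>)"
    and ch: "\<And>l :: real ^ 'n. (\<integral>\<omega>. cis (\<Sum>i\<in>UNIV. l $ i * log_BS (\<tau> i) \<omega>) \<partial>Q')
      = exp (\<i> * of_real ((of_bool b - 1/2) * (\<Sum>i\<in>UNIV. l $ i * total_variance (\<tau> i)))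
          - of_real ((\<Sum>i\<in>UNIV. \<Sum>j\<in>UNIV. l $ i * l $ j * total_variance (min (\<tau> i) (\<tau> j))) / 2))"
  shows "weakly_converges
     (\<lambda>N. distr (market_measure b N) borel
         (price_vector \<tau> N))
     (distr Q' borel (limit_vector \<tau>))"
proof (rule weak_limit_exponential[where V="log_price \<tau>" and U="\<lambda>\<omega>. \<chi> i. log_BS (\<tau> i) \<omega>", OF _ Q'(1-3)])
  show "\<forall>\<^sub>F N in sequentially. prob_space (market_measure b N) \<and>
      log_price \<tau> N \<in> borel_measurable (market_measure b N) \<and>
      (\<forall>x\<in>space (market_measure b N).
         price_vector \<tau> N x = (\<chi> i. exp (log_price \<tau> N x $ i)))"
    using eventually_large
  proof eventually_elim
    case (elim N)
    have "log_price \<tau> N \<in> borel_measurable (market N b)"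
      unfolding log_price_def
    proof (intro borel_measurable_vec_lambda borel_measurable_sum)
      fix i k assume "k \<in> {1..step_index N (\<tau> i)}"
      then have "k \<in> {1..N}" using step_index_le[OF \<tau>[of i], of N] by auto
      then show "(\<lambda>x. log_ratio N k (x k)) \<in> borel_measurable (market N b)"
        by (rule log_ratio_market_measurable[OF elim])
    qed
    moreover have "discounted_price T rho sig g N (nat \<lfloor>\<tau> i / T * real N\<rfloor>) x = exp (log_price \<tau> N x $ i)"
      if "x \<in> space (market N b)" for x i
      using discounted_price_eq[OF elim that step_index_le[OF \<tau>[of i]]]
          by (simp add: log_price_def step_index_def)
    ultimately show ?case
      using market_prob[OF elim, of b] unfolding market_eq[OF elim, of b, symmetric] by simp
  qed
  show "AE \<omega> in Q'. (\<chi> i. BS_density P F T W r \<sigma> (\<tau> i) \<omega>) = (\<chi> i. exp ((\<chi> i. log_BS (\<tau> i) \<omega>) $ i))"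
    using Q'(4) by eventually_elim simp
  fix l :: "real ^ 'n"
  have lim: "(\<lambda>N. \<integral>x. cis (\<Sum>i\<in>UNIV. l $ i * (\<Sum>k\<in>{1..step_index N (\<tau> i)}. log_ratio N k (x k))) \<partial>market N b) \<longlonglongrightarrow>
    exp (\<i> * of_real ((of_bool b - 1/2) * (\<Sum>i\<in>UNIV. l $ i * total_variance (min (\<tau> i) (\<tau> i))))
        - of_real ((\<Sum>i\<in>UNIV. \<Sum>j\<in>UNIV. l $ i * l $ j * total_variance (min (\<tau> i) (\<tau> j))) / 2))"
  proof (rule market_char_tendsto)
    show "step_index N (\<tau> i) \<le> N" for i N by (rule step_index_le[OF \<tau>])
    show "(\<lambda>N. clock N (min (step_index N (\<tau> i)) (step_index N (\<tau> j))))
        \<longlonglongrightarrow> total_variance (min (\<tau> i) (\<tau> j))" for i j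
      unfolding step_index_min using \<tau>[of i] \<tau>[of j] by (intro clock_tendsto) auto
  qed
  have "\<forall>\<^sub>F N in sequentially. (\<integral>x. cis (\<Sum>i\<in>UNIV. l $ i * (\<Sum>k\<in>{1..step_index N (\<tau> i)}. log_ratio N k (x k)))
      \<partial>market N b)
      = (\<integral>x. cis (l \<bullet> log_price \<tau> N x) \<partial>(market_measure b N))"
    using eventually_large
    by eventually_elim (simp only: market_eq[symmetric] inner_vec_def inner_real_def log_price_def
        vec_lambda_beta)
  from Lim_transform_eventually[OF lim this]
  show "(\<lambda>N. \<integral>x. cis (l \<bullet> log_price \<tau> N x) \<partial>(market_measure b N))
    \<longlonglongrightarrow> (\<integral>\<omega>. cis (l \<bullet> (\<chi> i. log_BS (\<tau> i) \<omega>)) \<partial>Q')"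
    by (simp only: inner_vec_def inner_real_def vec_lambda_beta ch min.idem)
qed

lemma price_convergence_Q:
  fixes \<tau> :: "'n::finite \<Rightarrow> real"
  assumes \<tau>: "\<And>i. \<tau> i \<in> {0..T}"
  shows "weakly_converges
     (\<lambda>N. distr (product_Q T rho sig P0 g N) borel (price_vector \<tau> N))
     (distr Q borel (limit_vector \<tau>))"
proof -
  have sQ: "sets Q = sets P" by (simp add: Q_eq)
  have Z0: "wiener_pair (\<lambda>u. \<theta> u + 0 * \<sigma> u) Z" using Z by simp
  have "log_BS (\<tau> i) \<in> borel_measurable Q" for i
    using log_BS_measurable[OF \<tau>] by (simp add: measurable_cong_sets[OF sQ refl])
  moreover have "BS_density P F T W r \<sigma> (\<tau> i) \<in> borel_measurable Q" for i
    using F_measurable_P[OF \<tau> BS_density_eq(2)[OF \<tau>]] by (simp add: measurable_cong_sets[OF sQ refl])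
  moreover have "AE \<omega> in Q. \<forall>i. BS_density P F T W r \<sigma> (\<tau> i) \<omega> = exp (log_BS (\<tau> i) \<omega>)"
    unfolding Q_eq AE_girsanov[OF Z] by (rule AE_all_finite) (rule BS_density_eq(1)[OF \<tau>])
  moreover have "prob_space Q" unfolding Q_eq by (rule prob_space_girsanov[OF Z])
  moreover have "(\<integral>\<omega>. cis (\<Sum>i\<in>UNIV. l $ i * log_BS (\<tau> i) \<omega>) \<partial>Q)
      = exp (\<i> * of_real ((of_bool False - 1/2) * (\<Sum>i\<in>UNIV. l $ i * total_variance (\<tau> i)))
          - of_real ((\<Sum>i\<in>UNIV. \<Sum>j\<in>UNIV. l $ i * l $ j * total_variance (min (\<tau> i) (\<tau> j))) / 2))"
    for l :: "real ^ 'n"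
    using log_BS_char[OF finite_class.finite_UNIV \<tau> Z0, where l="\<lambda>i. l $ i"] by (simp add: Q_eq)
  ultimately have "weakly_converges
     (\<lambda>N. distr (market_measure False N) borel
         (price_vector \<tau> N))
     (distr Q borel (limit_vector \<tau>))"
    by (intro price_convergence[OF \<tau>] borel_measurable_vec_lambda)
  then show ?thesis by (simp only: if_False)
qed

lemma price_convergence_Q1:
  fixes \<tau> :: "'n::finite \<Rightarrow> real"
  assumes \<tau>: "\<And>i. \<tau> i \<in> {0..T}"
  shows "weakly_converges
     (\<lambda>N. distr (product_Q1 T rho sig P0 g N) borel (price_vector \<tau> N))
     (distr Q1 borel (limit_vector \<tau>))"
proof -
  have TT: "T \<in> {0..T}" using T by simp
  let ?G = "girsanov (\<lambda>u. \<theta> u + 1 * \<sigma> u) X1"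
  have sub: "subalgebra ?G (F T)" using F_subalgebra[OF TT] by (simp add: subalgebra_def)
  have lF: "log_BS (\<tau> i) \<in> borel_measurable (F T)" for i
    unfolding log_BS_def[abs_def]
    using F_measurable_mono[OF \<tau>[of i] _ drifted_measurable[OF \<tau>[of i]], where t=T] \<tau>[of i] by simp
  have bF: "BS_density P F T W r \<sigma> (\<tau> i) \<in> borel_measurable (F T)" for i
    using F_measurable_mono[OF \<tau>[of i] _ BS_density_eq(2)[OF \<tau>[of i]], where t=T] \<tau>[of i] by simp
  have vl: "(\<lambda>\<omega>. \<chi> i. log_BS (\<tau> i) \<omega>) \<in> borel_measurable (F T)"
    by (intro borel_measurable_vec_lambda lF)
  have vb: "(limit_vector \<tau>) \<in> borel_measurable (F T)"
    by (intro borel_measurable_vec_lambda bF)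
  have cm: "cis \<in> borel_measurable borel"
    by (intro borel_measurable_continuous_onI continuous_intros)
  have "prob_space Q1"
  proof
    have "emeasure Q1 (space Q1) = (\<integral>\<^sup>+\<omega>. 1 \<partial>Q1)" by simp
    also have "\<dots> = (\<integral>\<^sup>+\<omega>. 1 \<partial>?G)" by (rule nn_integral_Q1) simp
    also have "\<dots> = 1" using prob_space.emeasure_space_1[OF prob_space_girsanov[OF X1]] by simp
    finally show "emeasure Q1 (space Q1) = 1" .
  qed
  moreover have "AE \<omega> in Q1. \<forall>i. BS_density P F T W r \<sigma> (\<tau> i) \<omega> = exp (log_BS (\<tau> i) \<omega>)"
  proof -
    have "AE \<omega> in ?G. \<forall>i. BS_density P F T W r \<sigma> (\<tau> i) \<omega> = exp (log_BS (\<tau> i) \<omega>)"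
      unfolding AE_girsanov[OF X1] by (rule AE_all_finite) (rule BS_density_eq(1)[OF \<tau>])
    moreover have "Measurable.pred (F T) (\<lambda>\<omega>. \<forall>i. BS_density P F T W r \<sigma> (\<tau> i) \<omega> = exp (log_BS (\<tau> i) \<omega>))"
      using lF bF by measurable
    ultimately show ?thesis
      unfolding Q1_eq by (intro AE_restr_to_subalg2[OF sub] ) auto
  qed
  moreover have "(\<integral>\<omega>. cis (\<Sum>i\<in>UNIV. l $ i * log_BS (\<tau> i) \<omega>) \<partial>Q1)
      = exp (\<i> * of_real ((of_bool True - 1/2) * (\<Sum>i\<in>UNIV. l $ i * total_variance (\<tau> i)))
          - of_real ((\<Sum>i\<in>UNIV. \<Sum>j\<in>UNIV. l $ i * l $ j * total_variance (min (\<tau> i) (\<tau> j))) / 2))"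
    for l :: "real ^ 'n"
  proof -
    have "(\<lambda>\<omega>. \<Sum>i\<in>UNIV. l $ i * log_BS (\<tau> i) \<omega>) \<in> borel_measurable (F T)" using lF by simp
    from measurable_compose[OF this cm]
    have "(\<integral>\<omega>. cis (\<Sum>i\<in>UNIV. l $ i * log_BS (\<tau> i) \<omega>) \<partial>Q1) = (\<integral>\<omega>. cis (\<Sum>i\<in>UNIV. l $ i * log_BS (\<tau> i) \<omega>) \<partial>?G)"
      unfolding Q1_eq by (rule integral_subalgebra2[OF sub])
    then show ?thesis
      using log_BS_char[OF finite_class.finite_UNIV \<tau> X1, where l="\<lambda>i. l $ i"] by simp
  qed
  moreover have "(\<lambda>\<omega>. \<chi> i. log_BS (\<tau> i) \<omega>) \<in> borel_measurable Q1" "(limit_vector \<tau>) \<in> borel_measurable Q1"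
    using vl vb by (simp_all add: measurable_cong_sets[OF sets_Q1 refl])
  ultimately have "weakly_converges
     (\<lambda>N. distr (market_measure True N) borel
         (price_vector \<tau> N))
     (distr Q1 borel (limit_vector \<tau>))"
    by (intro price_convergence[OF \<tau>])
  then show ?thesis by (simp only: if_True)
qed

end

theorem theorem6p4:
  fixes T R C \<delta> K :: real
    and rho sig :: "nat \<Rightarrow> nat \<Rightarrow> real"
    and r \<sigma> :: "real \<Rightarrow> real"
    and P0 :: "'a measure" and g :: "'a \<Rightarrow> real"
    and P :: "'w measure" and F :: "real \<Rightarrow> 'w measure" and W :: "real \<Rightarrow> 'w \<Rightarrow> real"
  assumes T: "0 < T"
    and B1_rates: "\<And>i N. 1 \<le> i \<Longrightarrow> i \<le> N \<Longrightarrow> 0 \<le> rho i N \<and> rho i N \<le> R"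
    and B1_r_nonneg: "\<And>u. u \<in> {0..T} \<Longrightarrow> 0 \<le> r u"
    and B1_r_sq: "square_integrable (lebesgue_on {0..T}) r"
    and B1_conv: "\<And>t. t \<in> {0..T} \<Longrightarrow>
          (\<lambda>N. bond T rho N (nat \<lfloor>t * real N / T\<rfloor>)) \<longlonglongrightarrow> exp (\<integral>u. r u \<partial>lebesgue_on {0..t})"
    and B2_P0: "prob_space P0"
    and B2_g_sq: "square_integrable P0 g"
    and B2_g_mean: "(\<integral>x. g x \<partial>P0) = 0"
    and B2_g_var: "(\<integral>x. (g x)\<^sup>2 \<partial>P0) = 1"
    and B2_C: "0 < C"
    and B2_g_bound: "\<And>x. x \<in> space P0 \<Longrightarrow> - C < g x"
    and B2_delta: "0 < \<delta>"
    and B2_vol: "\<And>i N. 1 \<le> i \<Longrightarrow> i \<le> N \<Longrightarrow> \<delta> \<le> sig i N \<and> sig i N \<le> K"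
    and B2_sigma_sq: "square_integrable (lebesgue_on {0..T}) \<sigma>"
    and B2_conv: "(\<lambda>N. \<integral>u. (step_volatility T sig N u - \<sigma> u)\<^sup>2 \<partial>lebesgue_on {0..T}) \<longlonglongrightarrow> 0"
    and BM: "brownian_motion P F T W"
  shows
    "(\<forall>t\<in>{0..T}. AE \<omega> in P. BS_density P F T W r \<sigma> t \<omega> =
        exp (wiener_integral P F W t \<sigma> \<omega> - (\<integral>s. r s + (\<sigma> s)\<^sup>2 / 2 \<partial>lebesgue_on {0..t})))
     \<and> (\<forall>\<tau> :: 'n::finite \<Rightarrow> real. (\<forall>i. \<tau> i \<in> {0..T}) \<longrightarrow>
          weakly_converges
            (\<lambda>N. distr (product_Q T rho sig P0 g N) borel
                   (\<lambda>x. \<chi> i. discounted_price T rho sig g N (nat \<lfloor>\<tau> i / T * real N\<rfloor>) x))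
            (distr (limit_QT P F T W r \<sigma>) borel (\<lambda>\<omega>. \<chi> i. BS_density P F T W r \<sigma> (\<tau> i) \<omega>))
        \<and> weakly_converges
            (\<lambda>N. distr (product_Q1 T rho sig P0 g N) borel
                   (\<lambda>x. \<chi> i. discounted_price T rho sig g N (nat \<lfloor>\<tau> i / T * real N\<rfloor>) x))
            (distr (limit_Q1 P F T W r \<sigma> T) borel (\<lambda>\<omega>. \<chi> i. BS_density P F T W r \<sigma> (\<tau> i) \<omega>)))"
proof -
  interpret wiener P F T W by (rule wiener.intro) (fact BM, fact T)
  have \<sigma>_ge: "AE u in lebesgue_on {0..T}. \<delta> \<le> \<sigma> u"
    by (rule volatility_lower_bound[OF B2_sigma_sq _ B2_conv]) (rule B2_vol)
  have bs: "black_scholes P F T W r \<sigma> \<delta>"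
    by (intro black_scholes.intro wiener_axioms black_scholes_axioms.intro) (fact assms \<sigma>_ge)+
  have dm: "discrete_market T R C \<delta> K rho sig P0 g"
    by (rule discrete_market.intro) (fact assms)+
  interpret market_with_limit P F T W r \<sigma> \<delta> R C K rho sig P0 g
    by (intro market_with_limit.intro bs dm market_with_limit_axioms.intro) (fact B2_conv)
  show ?thesis
  proof (intro conjI ballI allI impI)
    fix t assume "t \<in> {0..T}"
    then show "AE \<omega> in P. BS_density P F T W r \<sigma> t \<omega> =
        exp (wiener_integral P F W t \<sigma> \<omega> - (\<integral>s. r s + (\<sigma> s)\<^sup>2 / 2 \<partial>lebesgue_on {0..t}))"
      by (rule BS_density_real_world)
  next
    fix \<tau> :: "'n \<Rightarrow> real" assume \<tau>: "\<forall>i. \<tau> i \<in> {0..T}"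
    show "weakly_converges
       (\<lambda>N. distr (product_Q T rho sig P0 g N) borel (\<lambda>x. \<chi> i. discounted_price T rho sig g N (nat \<lfloor>\<tau> i / T * real N\<rfloor>) x))
       (distr (limit_QT P F T W r \<sigma>) borel (\<lambda>\<omega>. \<chi> i. BS_density P F T W r \<sigma> (\<tau> i) \<omega>))"
      by (rule price_convergence_Q) (use \<tau> in blast)
    show "weakly_converges
       (\<lambda>N. distr (product_Q1 T rho sig P0 g N) borel (\<lambda>x. \<chi> i. discounted_price T rho sig g N (nat \<lfloor>\<tau> i / T * real N\<rfloor>) x))
       (distr (limit_Q1 P F T W r \<sigma> T) borel (\<lambda>\<omega>. \<chi> i. BS_density P F T W r \<sigma> (\<tau> i) \<omega>))"
      by (rule price_convergence_Q1) (use \<tau> in blast)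
  qed
qed

end
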